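(* For any Liouville number $\alpha$, there exist a $C^1$ vector field $\nu$ on $\mathbb{R}_+=[0,\infty)$ vanishing only at $0$ and a Cantor set $K\subset\mathbb{R}$ containing $\alpha$ such that the time-$t$ map of $\nu$ is smooth ($C^\infty$) for every $t\in\{1\}\cup K$, but is not $C^2$ for some other $t\in\mathbb{R}$.
   Context: Liouville number: an irrational number $\alpha$ satisfying no diophantine condition, where $\alpha$ satisfies a diophantine condition if there exist constants $c>0$ and $\gamma\ge 0$ such that $|\alpha-p/q|\ge c\,q^{-2-\gamma}$ for every rational number $p/q$ with $q\ge 1$. The time-$t$ map of a vector field $\nu$ on $\mathbb{R}_+$ is the diffeomorphism $f^t$ of $\mathbb{R}_+$ given by its flow $\{f^t,\ t\in\mathbb{R}\}$ at time $t$ (the flow being defined for all times). Regularity on $\mathbb{R}_+$ is understood up to and including $0$. *)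

theory Defs
  imports "HOL-Analysis.Analysis"
begin

definition diophantine :: "real \<Rightarrow> bool" where
  "diophantine \<alpha> \<longleftrightarrow>
     (\<exists>c>0. \<exists>\<gamma>\<ge>0. \<forall>(p::int) (q::nat). q \<ge> 1 \<longrightarrow>
        \<bar>\<alpha> - real_of_int p / real q\<bar> \<ge> c * real q powr (- 2 - \<gamma>))"

definition liouville_number :: "real \<Rightarrow> bool" where
  "liouville_number \<alpha> \<longleftrightarrow> \<alpha> \<notin> \<rat> \<and> \<not> diophantine \<alpha>"

definition cantor_set :: "real set \<Rightarrow> bool" where
  "cantor_set K \<longleftrightarrow>
     K \<noteq> {} \<and> compact K \<and> (\<forall>x\<in>K. x islimpt K) \<and>
     (\<forall>C. C \<subseteq> K \<and> connected C \<longrightarrow> (\<exists>x. C \<subseteq> {x}))"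

text \<open>
  Derivatives are taken within the domain \<open>S\<close>. For \<open>S = {0..}\<close> this means one-sided derivatives
  at \<open>0\<close>, so regularity holds up to and including the endpoint. Values outside \<open>S\<close> are irrelevant.
\<close>

primrec Ck_on :: "nat \<Rightarrow> (real \<Rightarrow> real) \<Rightarrow> real set \<Rightarrow> bool" where
  "Ck_on 0 f S \<longleftrightarrow> continuous_on S f"
| "Ck_on (Suc k) f S \<longleftrightarrow>
     (\<exists>f'. (\<forall>x\<in>S. (f has_real_derivative f' x) (at x within S)) \<and> Ck_on k f' S)"

definition smooth_on :: "(real \<Rightarrow> real) \<Rightarrow> real set \<Rightarrow> bool" where
  "smooth_on f S \<longleftrightarrow> (\<forall>k. Ck_on k f S)"

text \<open>
  \<open>f t\<close> is the time-\<open>t\<close> map of the complete flow on \<open>{0..}\<close> of the vector field \<open>\<nu>\<close>. For \<open>\<nu>\<close> of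
  class \<open>C\<^sup>1\<close>, uniqueness of solutions determines \<open>f t\<close> on \<open>{0..}\<close> and gives
  \<open>f (s + t) = f s \<circ> f t\<close> there; in particular each \<open>f t\<close> is a diffeomorphism of \<open>{0..}\<close>.
\<close>

definition flow_of :: "(real \<Rightarrow> real) \<Rightarrow> (real \<Rightarrow> real \<Rightarrow> real) \<Rightarrow> bool" where
  "flow_of \<nu> f \<longleftrightarrow>
     (\<forall>x\<ge>0. f 0 x = x) \<and>
     (\<forall>x\<ge>0. \<forall>t. f t x \<ge> 0 \<and> ((\<lambda>s. f s x) has_real_derivative \<nu> (f t x)) (at t))"

end

theory Submission
  imports Defs
begin

text \<open>
  In the coordinate \<open>1 / x\<close> cut \<open>(0, \<infinity>)\<close> into unit blocks, indexed by \<open>k\<close>, and choose rational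
  approximations \<open>p k / q k\<close> of \<open>\<alpha>\<close> that are extremely good compared with \<open>q k\<close>. The smooth flat field
  \<open>base_field\<close> is \<open>exp (- 1 / x)\<close> near the ends of the blocks and has the tiny constant value
  \<open>v k = q k ^ - (k + 1)\<close> in the middle of block \<open>k\<close>. Dividing it by \<open>1 + ripple\<close>, where the ripple
  has amplitude \<open>v k\<close> and period \<open>1 / q k\<close> in time, changes its first derivative by \<open>o(1)\<close>, while its
  second derivative becomes unbounded. Where the ripple has full amplitude, the time-\<open>m / q k\<close> maps of
  both fields coincide; hence for \<open>t\<close> close to \<open>\<int> / q k\<close> the time-\<open>t\<close> maps are super-polynomially close
  relative to \<open>1 / v k\<close>. The ripple is switched on and off in the region where the field is
  \<open>exp (- 1 / x) \<ge> 1 / q k\<close>, and there its amplitude is negligible relative to \<open>q k\<close>.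
  In both regions all derivatives of the maps are polynomially bounded in the respective scale, so by
  interpolation all derivatives of their difference tend to \<open>0\<close>. For \<open>t\<close> far from \<open>\<int> / q k\<close> for all \<open>k\<close>,
  the ripple survives in the derivative of the time-\<open>t\<close> map. The Cantor set is the closure of the
  finite sums \<open>\<alpha> + \<Sum>i\<in>F. q i * \<alpha> - p i\<close>, which are as close to \<open>\<int> / q k\<close> as \<open>\<alpha>\<close> is, up to a factor \<open>3 * q k\<close>.
\<close>

section \<open>Functions with controlled derivatives\<close>

text \<open>Where the field equals \<open>v k\<close>, a ripple of relative size \<open>v k\<close>
  and period \<open>1 / q k\<close> in time has period about \<open>v k / q k\<close> in space and
  absolute size \<open>v k ^ 2\<close>. The first derivative changes by about
  \<open>v k * q k\<close>, which tends to 0, the second by about \<open>q k ^ 2\<close>, which does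
  not.

  The obstacle is that each derivative of a time-t map can cost a fixed power of the reciprocal of
  the field. Where the ripple has full amplitude this is a power of \<open>1 / v k\<close>, paid for
  by the distance of t from \<open>\<int> / q k\<close>; while the ripple is being switched no
  resonance helps and the drift is of order \<open>v k\<close>, so the field has to be much larger
  than \<open>v k\<close> there. This forces two scales far apart. The exponents
  \<open>k + 1\<close> in \<open>v k\<close> and \<open>(k + 1) * (k + 2)\<close> in the bound on
  \<open>q k * \<alpha> - p k\<close> grow with \<open>k\<close> because every fixed power must be
  beaten; the second is possible only if no diophantine condition holds.

  Finite sums of \<open>q i * \<alpha> - p i\<close> appear since a single time must be nearly
  rational with denominator \<open>q k\<close> for all \<open>k\<close> at once, and integer
  combinations of \<open>\<alpha>\<close> and 1 inherit this from \<open>\<alpha>\<close>.\<close>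

primrec ctl :: "((real \<Rightarrow> real) \<Rightarrow> bool) \<Rightarrow> real set \<Rightarrow> nat \<Rightarrow> (real \<Rightarrow> real) \<Rightarrow> bool" where
  "ctl P X 0 F \<longleftrightarrow> P F"
| "ctl P X (Suc n) F \<longleftrightarrow>
     P F \<and> (\<forall>x\<in>X. (F has_real_derivative deriv F x) (at x)) \<and> ctl P X n (deriv F)"

text \<open>Such a class is an order ideal for the values on \<open>X\<close>, so membership depends
  only on the restriction to \<open>X\<close>. This lets \<open>ctl\<close> iterate the total
  operator \<open>deriv\<close>, whose values outside \<open>X\<close> are arbitrary, and lets one
  calculus serve bounded, moderate, negligible and unrestricted functions.\<close>

definition solid :: "real set \<Rightarrow> ((real \<Rightarrow> real) \<Rightarrow> bool) \<Rightarrow> bool" where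
  "solid X P \<longleftrightarrow> (\<forall>F G. P G \<longrightarrow> (\<forall>x\<in>X. \<bar>F x\<bar> \<le> \<bar>G x\<bar>) \<longrightarrow> P F) \<and>
     (\<forall>F G. P F \<longrightarrow> P G \<longrightarrow> P (\<lambda>x. F x + G x))"

definition algebra_class :: "real set \<Rightarrow> ((real \<Rightarrow> real) \<Rightarrow> bool) \<Rightarrow> bool" where
  "algebra_class X P \<longleftrightarrow> solid X P \<and> (\<forall>F G. P F \<longrightarrow> P G \<longrightarrow> P (\<lambda>x. F x * G x)) \<and> (\<forall>c. P (\<lambda>_. c))"

lemma solidD:
  assumes "solid X P" "P G" "\<And>x. x \<in> X \<Longrightarrow> \<bar>F x\<bar> \<le> \<bar>G x\<bar>"
  shows "P F"
  using assms(1)[unfolded solid_def, THEN conjunct1, THEN spec[of _ F], THEN spec[of _ G]] assms(2,3)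
  by simp

lemma solid_add:
  assumes "solid X P" "P F" "P G"
  shows "P (\<lambda>x. F x + G x)"
  using assms(1)[unfolded solid_def, THEN conjunct2, THEN spec[of _ F], THEN spec[of _ G]] assms(2,3)
  by simp

lemma solid_uminus:
  assumes "solid X P" "P F"
  shows "P (\<lambda>x. - F x)"
  by (rule solidD[OF assms]) simp

lemma algebra_solid: "algebra_class X P \<Longrightarrow> solid X P"
  by (simp add: algebra_class_def)

lemma algebra_mult:
  assumes "algebra_class X P" "P F" "P G"
  shows "P (\<lambda>x. F x * G x)"
  using assms(1)[unfolded algebra_class_def, THEN conjunct2, THEN conjunct1, THEN spec[of _ F], THEN spec[of _ G]]
    assms(2,3) by simp

lemma algebra_const: "algebra_class X P \<Longrightarrow> P (\<lambda>_. c)"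
  by (simp add: algebra_class_def)

lemma ctl_imp: "ctl P X n F \<Longrightarrow> P F"
  by (cases n) auto

lemma ctl_SucD: "ctl P X (Suc n) F \<Longrightarrow> ctl P X n F"
  by (induction n arbitrary: F) auto

lemma ctl_cong:
  assumes "solid X P" "open X" "ctl P X n F" "\<And>x. x \<in> X \<Longrightarrow> F x = G x"
  shows "ctl P X n G"
  using assms(3,4)
proof (induction n arbitrary: F G)
  case 0
  show ?case
    unfolding ctl.simps by (rule solidD[OF assms(1), of F]) (use 0 in auto)
next
  case (Suc n)
  have D: "(G has_real_derivative deriv F x) (at x)" if "x \<in> X" for x
    by (rule has_field_derivative_transform_within_open[where f = F and S = X])
      (use Suc.prems that assms in auto)
  then have eq: "deriv F x = deriv G x" if "x \<in> X" for x
    using that by (metis DERIV_imp_deriv)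
  have "P G"
    by (rule solidD[OF assms(1), of F]) (use Suc.prems in auto)
  moreover have "ctl P X n (deriv G)"
    using Suc.IH[of "deriv F" "deriv G"] Suc.prems eq by auto
  ultimately show ?case
    using D eq by auto
qed

lemma ctl_SucI:
  assumes "solid X P" "open X" "P F" "\<And>x. x \<in> X \<Longrightarrow> (F has_real_derivative F' x) (at x)" "ctl P X n F'"
  shows "ctl P X (Suc n) F"
proof -
  have eq: "F' x = deriv F x" if "x \<in> X" for x
    using assms(4)[OF that] by (metis DERIV_imp_deriv)
  have "ctl P X n (deriv F)"
    by (rule ctl_cong[OF assms(1,2,5)]) (rule eq)
  then show ?thesis
    using assms(3,4) eq by auto
qed

lemma ctl_weaken:
  assumes "ctl P X n F" "Y \<subseteq> X" "\<And>F. P F \<Longrightarrow> Q F"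
  shows "ctl Q Y n F"
  using assms(1) by (induction n arbitrary: F) (use assms(2,3) in auto)

lemma ctl_Un:
  assumes "ctl P X n F" "ctl Q Y n F" "\<And>F. P F \<Longrightarrow> Q F \<Longrightarrow> R F"
  shows "ctl R (X \<union> Y) n F"
  using assms(1,2) by (induction n arbitrary: F) (use assms(3) in auto)

lemma ctl_add:
  assumes "solid X P" "open X" "ctl P X n F" "ctl P X n G"
  shows "ctl P X n (\<lambda>x. F x + G x)"
  using assms(3,4)
proof (induction n arbitrary: F G)
  case 0
  then show ?case by (simp add: solid_add[OF assms(1)])
next
  case (Suc n)
  show ?case
    by (rule ctl_SucI[OF assms(1,2), where F' = "\<lambda>x. deriv F x + deriv G x"])
      (use Suc in \<open>simp_all add: solid_add[OF assms(1)] DERIV_add\<close>)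
qed

lemma ctl_uminus:
  assumes "solid X P" "open X" "ctl P X n F"
  shows "ctl P X n (\<lambda>x. - F x)"
  using assms(3)
proof (induction n arbitrary: F)
  case 0
  then show ?case by (simp add: solid_uminus[OF assms(1)])
next
  case (Suc n)
  show ?case
    by (rule ctl_SucI[OF assms(1,2), where F' = "\<lambda>x. - deriv F x"])
      (use Suc in \<open>simp_all add: solid_uminus[OF assms(1)] DERIV_minus\<close>)
qed

lemma ctl_diff:
  assumes "solid X P" "open X" "ctl P X n F" "ctl P X n G"
  shows "ctl P X n (\<lambda>x. F x - G x)"
  using ctl_add[OF assms(1-3) ctl_uminus[OF assms(1,2,4)]] by simp

text \<open>Three separate classes, because negligible functions act as an ideal in the moderate
  ones and in general contain no nonzero constants, so they form no
  \<open>algebra_class\<close>.\<close>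

lemma ctl_mult:
  assumes "solid X R" "open X" "\<And>F G. P F \<Longrightarrow> Q G \<Longrightarrow> R (\<lambda>x. F x * G x)"
    "ctl P X n F" "ctl Q X n G"
  shows "ctl R X n (\<lambda>x. F x * G x)"
  using assms(4,5)
proof (induction n arbitrary: F G)
  case 0
  then show ?case using assms(3) by auto
next
  case (Suc n)
  have "ctl R X n (\<lambda>x. deriv F x * G x + F x * deriv G x)"
    using Suc.IH[of "deriv F" G] Suc.IH[of F "deriv G"] Suc.prems[THEN ctl_SucD] Suc.prems
    by (intro ctl_add[OF assms(1,2)]) auto
  then show ?case
    using Suc.prems assms(3)
    by (intro ctl_SucI[OF assms(1,2), where F' = "\<lambda>x. deriv F x * G x + F x * deriv G x"])
      (auto intro!: derivative_eq_intros)
qed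

lemma ctl_algebra_mult:
  assumes "algebra_class X P" "open X" "ctl P X n F" "ctl P X n G"
  shows "ctl P X n (\<lambda>x. F x * G x)"
  by (rule ctl_mult[OF algebra_solid[OF assms(1)] assms(2) algebra_mult[OF assms(1)] assms(3,4)])

text \<open>Meant for functions of \<open>block x\<close>, which vary from block to block but have
  derivative 0 throughout an open set that avoids the block ends.\<close>

lemma ctl_locally_const:
  assumes "solid X P" "open X" "P F" "P (\<lambda>_. 0)" "\<And>x. x \<in> X \<Longrightarrow> (F has_real_derivative 0) (at x)"
  shows "ctl P X n F"
proof -
  have z: "ctl P X n (\<lambda>_. 0)" for n
    by (induction n) (auto intro!: ctl_SucI[OF assms(1,2), where F' = "\<lambda>_. 0"] assms(4))
  have "ctl P X (Suc n) F"
    by (rule ctl_SucI[OF assms(1,2,3,5) z])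
  then show ?thesis by (rule ctl_SucD)
qed

lemma ctl_const:
  assumes "algebra_class X P" "open X"
  shows "ctl P X n (\<lambda>_. c)"
  using assms algebra_const[OF assms(1)]
  by (intro ctl_locally_const algebra_solid) auto

lemma ctl_cmult:
  assumes "algebra_class X P" "open X" "ctl P X n F"
  shows "ctl P X n (\<lambda>x. c * F x)"
  by (rule ctl_algebra_mult[OF assms(1,2) ctl_const[OF assms(1,2)] assms(3)])

lemma ctl_compose:
  assumes "algebra_class X P" "open X" "\<And>G. Q G \<Longrightarrow> P (\<lambda>x. G (F x))"
    "\<And>x. x \<in> X \<Longrightarrow> F x \<in> Y" "ctl Q Y n G" "ctl P X n F"
  shows "ctl P X n (\<lambda>x. G (F x))"
  using assms(5,6)
proof (induction n arbitrary: G)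
  case 0
  then show ?case using assms(3) by auto
next
  case (Suc n)
  have "ctl P X n (\<lambda>x. deriv G (F x) * deriv F x)"
    using Suc.IH[of "deriv G"] Suc.prems(2)[THEN ctl_SucD] Suc.prems
    by (intro ctl_algebra_mult[OF assms(1,2)]) auto
  moreover have "((\<lambda>x. G (F x)) has_real_derivative deriv G (F x) * deriv F x) (at x)" if "x \<in> X" for x
    using Suc.prems assms(4)[OF that] that by (intro DERIV_chain2[of G _ F]) auto
  moreover have "P (\<lambda>x. G (F x))"
    using Suc.prems assms(3) by auto
  ultimately show ?case
    by (intro ctl_SucI[OF algebra_solid[OF assms(1)] assms(2), where F' = "\<lambda>x. deriv G (F x) * deriv F x"])
qed

text \<open>Only the derivative of the inner function has to lie in the class; \<open>F\<close>
  itself may be unbounded, as \<open>1 - y\<close> is on the whole line.\<close>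

lemma ctl_compose_deriv:
  assumes "algebra_class X P" "open X" "\<And>G. Q G \<Longrightarrow> P (\<lambda>x. G (F x))"
    "\<And>x. x \<in> X \<Longrightarrow> F x \<in> Y" "ctl Q Y n G"
    "\<And>x. x \<in> X \<Longrightarrow> (F has_real_derivative F' x) (at x)" "\<And>m. ctl P X m F'"
  shows "ctl P X n (\<lambda>x. G (F x))"
  using assms(5)
proof (induction n arbitrary: G)
  case 0
  then show ?case using assms(3) by auto
next
  case (Suc n)
  have "ctl P X n (\<lambda>x. deriv G (F x) * F' x)"
    using Suc.IH[of "deriv G"] Suc.prems assms(7)
    by (intro ctl_algebra_mult[OF assms(1,2)]) auto
  moreover have "((\<lambda>x. G (F x)) has_real_derivative deriv G (F x) * F' x) (at x)" if "x \<in> X" for x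
    using Suc.prems assms(4)[OF that] assms(6)[OF that] that by (intro DERIV_chain2[of G _ F]) auto
  moreover have "P (\<lambda>x. G (F x))"
    using Suc.prems assms(3) by auto
  ultimately show ?case
    by (intro ctl_SucI[OF algebra_solid[OF assms(1)] assms(2), where F' = "\<lambda>x. deriv G (F x) * F' x"])
qed

text \<open>Since \<open>(1 / F)' = - F' / F ^ 2\<close>, the one new bound is that on
  \<open>1 / F\<close> itself.\<close>

lemma ctl_inverse:
  assumes "algebra_class X P" "open X" "\<And>x. x \<in> X \<Longrightarrow> F x \<noteq> 0" "P (\<lambda>x. inverse (F x))" "ctl P X n F"
  shows "ctl P X n (\<lambda>x. inverse (F x))"
  using assms(5)
proof (induction n)
  case 0
  then show ?case using assms(4) by auto
next
  case (Suc n)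
  note S = algebra_solid[OF assms(1)]
  have I: "ctl P X n (\<lambda>x. inverse (F x))"
    using Suc.IH Suc.prems[THEN ctl_SucD] by auto
  have "ctl P X n (\<lambda>x. - (inverse (F x) * deriv F x * inverse (F x)))"
    using Suc.prems I
    by (intro ctl_uminus[OF S assms(2)] ctl_algebra_mult[OF assms(1,2)]) auto
  then show ?case
    using Suc.prems assms(3,4)
    by (intro ctl_SucI[OF S assms(2), where F' = "\<lambda>x. - (inverse (F x) * deriv F x * inverse (F x))"])
      (auto intro!: derivative_eq_intros)
qed

text \<open>Sine and cosine are bounded whatever their argument, so again only \<open>F'\<close> is
  constrained. In the main application \<open>F\<close> is the phase of the ripple, whose size is
  never estimated.\<close>

lemma ctl_sin_cos:
  assumes "algebra_class X P" "open X" "\<And>x. x \<in> X \<Longrightarrow> (F has_real_derivative F' x) (at x)" "\<And>n. ctl P X n F'"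
  shows "ctl P X n (\<lambda>x. sin (F x)) \<and> ctl P X n (\<lambda>x. cos (F x))"
proof (induction n)
  case 0
  show ?case
    unfolding ctl.simps
    by (intro conjI; rule solidD[OF algebra_solid[OF assms(1)] algebra_const[OF assms(1), of 1]]) auto
next
  case (Suc n)
  note S = algebra_solid[OF assms(1)]
  have "ctl P X n (\<lambda>x. cos (F x) * F' x)" "ctl P X n (\<lambda>x. - (sin (F x) * F' x))"
    using Suc assms(4) by (auto intro!: ctl_uminus[OF S assms(2)] ctl_algebra_mult[OF assms(1,2)])
  moreover have "P (\<lambda>x. sin (F x))" "P (\<lambda>x. cos (F x))"
    using Suc by (auto dest: ctl_imp)
  moreover have "((\<lambda>x. sin (F x)) has_real_derivative cos (F x) * F' x) (at x)"
    "((\<lambda>x. cos (F x)) has_real_derivative - (sin (F x) * F' x)) (at x)" if "x \<in> X" for x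
    using assms(3)[OF that] by (auto intro!: derivative_eq_intros)
  ultimately show ?case
    by (intro conjI ctl_SucI[OF S assms(2), of "\<lambda>x. sin (F x)" "\<lambda>x. cos (F x) * F' x"]
        ctl_SucI[OF S assms(2), of "\<lambda>x. cos (F x)" "\<lambda>x. - (sin (F x) * F' x)"])
qed

text \<open>Bootstrapping: each further derivative of the flow comes from \<open>f' = \<mu>(f) / \<mu>\<close>.\<close>

lemma ctl_flow:
  assumes "algebra_class X P" "open X" "\<And>G. Q G \<Longrightarrow> P (\<lambda>x. G (f x))"
    "\<And>x. x \<in> X \<Longrightarrow> f x \<in> Y" "\<And>n. ctl Q Y n \<mu>" "\<And>n. ctl P X n \<rho>"
    "P f" "\<And>x. x \<in> X \<Longrightarrow> (f has_real_derivative \<mu> (f x) * \<rho> x) (at x)"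
  shows "ctl P X n f"
proof (induction n)
  case 0
  then show ?case using assms(7) by simp
next
  case (Suc n)
  have *: "ctl P X n (\<lambda>x. \<mu> (f x) * \<rho> x)"
    by (rule ctl_algebra_mult[OF assms(1,2) ctl_compose[where Q = Q and Y = Y] assms(6)])
      (fact assms Suc)+
  show ?case
    by (rule ctl_SucI[OF algebra_solid[OF assms(1)] assms(2), where F' = "\<lambda>x. \<mu> (f x) * \<rho> x"])
      (fact assms *)+
qed

text \<open>Moderate and negligible functions in the sense of Colombeau, relative to a scale \<open>\<Lambda>\<close>.\<close>

definition moderate :: "real set \<Rightarrow> (real \<Rightarrow> real) \<Rightarrow> (real \<Rightarrow> real) \<Rightarrow> bool" where
  "moderate X \<Lambda> F \<longleftrightarrow> (\<exists>C c. \<forall>x\<in>X. \<bar>F x\<bar> \<le> C * \<Lambda> x ^ c)"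

definition negligible_wrt :: "real set \<Rightarrow> (real \<Rightarrow> real) \<Rightarrow> (real \<Rightarrow> real) \<Rightarrow> bool" where
  "negligible_wrt X \<Lambda> F \<longleftrightarrow> (\<forall>N. \<exists>C. \<forall>x\<in>X. \<bar>F x\<bar> * \<Lambda> x ^ N \<le> C)"

lemma moderateI: "(\<And>x. x \<in> X \<Longrightarrow> \<bar>F x\<bar> \<le> C * \<Lambda> x ^ c) \<Longrightarrow> moderate X \<Lambda> F"
  unfolding moderate_def by blast

lemma moderateE:
  assumes "moderate X \<Lambda> F" "\<And>x. x \<in> X \<Longrightarrow> \<Lambda> x \<ge> (1::real)"
  obtains C c where "C > 0" "\<And>x. x \<in> X \<Longrightarrow> \<bar>F x\<bar> \<le> C * \<Lambda> x ^ c"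
proof -
  obtain C c where C: "\<forall>x\<in>X. \<bar>F x\<bar> \<le> C * \<Lambda> x ^ c"
    using assms(1) unfolding moderate_def by blast
  have "\<bar>F x\<bar> \<le> (\<bar>C\<bar> + 1) * \<Lambda> x ^ c" if "x \<in> X" for x
  proof -
    have "C * \<Lambda> x ^ c \<le> (\<bar>C\<bar> + 1) * \<Lambda> x ^ c"
      using assms(2)[OF that] by (intro mult_right_mono) auto
    then show ?thesis using C that by fastforce
  qed
  then show thesis using that[of "\<bar>C\<bar> + 1" c] by auto
qed

lemma moderate_algebra:
  assumes "\<And>x. x \<in> X \<Longrightarrow> \<Lambda> x \<ge> (1::real)"
  shows "algebra_class X (moderate X \<Lambda>)"
  unfolding algebra_class_def solid_def
proof (intro conjI allI impI)
  fix F G assume "moderate X \<Lambda> G" "\<forall>x\<in>X. \<bar>F x\<bar> \<le> \<bar>G x\<bar>"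
  then show "moderate X \<Lambda> F" unfolding moderate_def by (meson order_trans)
next
  fix F G assume F: "moderate X \<Lambda> F" and G: "moderate X \<Lambda> G"
  obtain C c where C: "C > 0" "\<And>x. x \<in> X \<Longrightarrow> \<bar>F x\<bar> \<le> C * \<Lambda> x ^ c"
    using moderateE[OF F assms] by metis
  obtain D d where D: "D > 0" "\<And>x. x \<in> X \<Longrightarrow> \<bar>G x\<bar> \<le> D * \<Lambda> x ^ d"
    using moderateE[OF G assms] by metis
  have "\<bar>F x + G x\<bar> \<le> (C + D) * \<Lambda> x ^ (c + d)" if x: "x \<in> X" for x
  proof -
    have "\<Lambda> x ^ c \<le> \<Lambda> x ^ (c + d)" "\<Lambda> x ^ d \<le> \<Lambda> x ^ (c + d)"
      using assms[OF x] by (auto intro!: power_increasing)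
    then have "C * \<Lambda> x ^ c + D * \<Lambda> x ^ d \<le> C * \<Lambda> x ^ (c + d) + D * \<Lambda> x ^ (c + d)"
      using C(1) D(1) by (intro add_mono mult_left_mono) auto
    then show ?thesis using C(2)[OF x] D(2)[OF x] by (simp add: distrib_right)
  qed
  then show "moderate X \<Lambda> (\<lambda>x. F x + G x)" by (rule moderateI)
  have "\<bar>F x * G x\<bar> \<le> (C * D) * \<Lambda> x ^ (c + d)" if x: "x \<in> X" for x
  proof -
    have "\<bar>F x\<bar> * \<bar>G x\<bar> \<le> (C * \<Lambda> x ^ c) * (D * \<Lambda> x ^ d)"
      using C(2)[OF x] D(2)[OF x] by (intro mult_mono) (auto intro: order_trans[OF abs_ge_zero])
    then show ?thesis by (simp add: abs_mult power_add algebra_simps)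
  qed
  then show "moderate X \<Lambda> (\<lambda>x. F x * G x)" by (rule moderateI)
next
  fix c show "moderate X \<Lambda> (\<lambda>_. c)"
    by (rule moderateI[of _ _ "\<bar>c\<bar>" _ 0]) auto
qed

lemma negligible_solid:
  assumes "\<And>x. x \<in> X \<Longrightarrow> \<Lambda> x \<ge> (1::real)"
  shows "solid X (negligible_wrt X \<Lambda>)"
  unfolding solid_def
proof (intro conjI allI impI)
  fix F G assume G: "negligible_wrt X \<Lambda> G" and le: "\<forall>x\<in>X. \<bar>F x\<bar> \<le> \<bar>G x\<bar>"
  show "negligible_wrt X \<Lambda> F" unfolding negligible_wrt_def
  proof (rule allI)
    fix N obtain C where C: "\<forall>x\<in>X. \<bar>G x\<bar> * \<Lambda> x ^ N \<le> C"
      using G unfolding negligible_wrt_def by blast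
    have "\<bar>F x\<bar> * \<Lambda> x ^ N \<le> \<bar>G x\<bar> * \<Lambda> x ^ N" if "x \<in> X" for x
      using le assms[OF that] that by (intro mult_right_mono) auto
    then show "\<exists>C. \<forall>x\<in>X. \<bar>F x\<bar> * \<Lambda> x ^ N \<le> C" using C by (meson order_trans)
  qed
next
  fix F G assume F: "negligible_wrt X \<Lambda> F" and G: "negligible_wrt X \<Lambda> G"
  show "negligible_wrt X \<Lambda> (\<lambda>x. F x + G x)" unfolding negligible_wrt_def
  proof (rule allI)
    fix N
    obtain C D where C: "\<forall>x\<in>X. \<bar>F x\<bar> * \<Lambda> x ^ N \<le> C" and D: "\<forall>x\<in>X. \<bar>G x\<bar> * \<Lambda> x ^ N \<le> D"
      using F G unfolding negligible_wrt_def by blast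
    have "\<bar>F x + G x\<bar> * \<Lambda> x ^ N \<le> C + D" if "x \<in> X" for x
    proof -
      have "\<bar>F x + G x\<bar> * \<Lambda> x ^ N \<le> (\<bar>F x\<bar> + \<bar>G x\<bar>) * \<Lambda> x ^ N"
        using assms[OF that] by (intro mult_right_mono) auto
      also have "\<dots> = \<bar>F x\<bar> * \<Lambda> x ^ N + \<bar>G x\<bar> * \<Lambda> x ^ N" by (simp add: distrib_right)
      finally show ?thesis using C D that by fastforce
    qed
    then show "\<exists>C. \<forall>x\<in>X. \<bar>F x + G x\<bar> * \<Lambda> x ^ N \<le> C" by blast
  qed
qed

lemma negligible_mult_moderate:
  assumes "\<And>x. x \<in> X \<Longrightarrow> \<Lambda> x \<ge> (1::real)" "negligible_wrt X \<Lambda> F" "moderate X \<Lambda> G"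
  shows "negligible_wrt X \<Lambda> (\<lambda>x. F x * G x)"
  unfolding negligible_wrt_def
proof
  fix N
  obtain D d where D: "D > 0" "\<And>x. x \<in> X \<Longrightarrow> \<bar>G x\<bar> \<le> D * \<Lambda> x ^ d"
    using moderateE[OF assms(3,1)] by metis
  obtain C where C: "\<forall>x\<in>X. \<bar>F x\<bar> * \<Lambda> x ^ (N + d) \<le> C"
    using assms(2) unfolding negligible_wrt_def by blast
  have "\<bar>F x * G x\<bar> * \<Lambda> x ^ N \<le> D * C" if x: "x \<in> X" for x
  proof -
    have "\<bar>F x * G x\<bar> * \<Lambda> x ^ N \<le> \<bar>F x\<bar> * (D * \<Lambda> x ^ d) * \<Lambda> x ^ N"
      using D(2)[OF x] assms(1)[OF x]
      by (auto simp: abs_mult intro!: mult_right_mono mult_left_mono)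
    also have "\<dots> = D * (\<bar>F x\<bar> * \<Lambda> x ^ (N + d))" by (simp add: power_add)
    also have "\<dots> \<le> D * C" using C D(1) x by (intro mult_left_mono) auto
    finally show ?thesis .
  qed
  then show "\<exists>C. \<forall>x\<in>X. \<bar>F x * G x\<bar> * \<Lambda> x ^ N \<le> C" by blast
qed

abbreviation flat_on :: "real set \<Rightarrow> (real \<Rightarrow> real) \<Rightarrow> bool" where
  "flat_on X \<equiv> negligible_wrt X (\<lambda>x. 1 / x)"

text \<open>A Landau--Kolmogorov argument: with \<open>d''\<close> moderate, the difference quotients of \<open>d\<close> with step
  \<open>\<kappa> / \<Lambda>\<^sup>m\<close> show that \<open>d'\<close> inherits negligibility from \<open>d\<close>.\<close>

lemma negligible_deriv:
  assumes L: "\<And>x. x \<in> X \<Longrightarrow> \<Lambda> x \<ge> (1::real)" and "\<kappa> > 0"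
    and thick: "\<And>x h. x \<in> X \<Longrightarrow> 0 < h \<Longrightarrow> h \<le> \<kappa> / \<Lambda> x \<Longrightarrow>
        (\<forall>y\<in>{x..x+h}. y \<in> X \<and> \<Lambda> y = \<Lambda> x) \<or> (\<forall>y\<in>{x-h..x}. y \<in> X \<and> \<Lambda> y = \<Lambda> x)"
    and D1: "\<And>x. x \<in> X \<Longrightarrow> (d has_real_derivative d1 x) (at x)"
    and D2: "\<And>x. x \<in> X \<Longrightarrow> (d1 has_real_derivative d2 x) (at x)"
    and m: "moderate X \<Lambda> d2" and n: "negligible_wrt X \<Lambda> d"
  shows "negligible_wrt X \<Lambda> d1"
  unfolding negligible_wrt_def
proof
  fix N
  obtain D c where D: "D > 0" "\<And>x. x \<in> X \<Longrightarrow> \<bar>d2 x\<bar> \<le> D * \<Lambda> x ^ c"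
    using moderateE[OF m L] by metis
  obtain C where C: "\<And>x. x \<in> X \<Longrightarrow> \<bar>d x\<bar> * \<Lambda> x ^ (2*N + c + 1) \<le> C"
    using n unfolding negligible_wrt_def by blast
  have step: "\<bar>d1 x\<bar> \<le> (\<bar>d a\<bar> + \<bar>d b\<bar>) / h + h * (D * l ^ c)"
    if h: "h > 0" "b = a + h" and x: "x \<in> {a..b}" and abX: "{a..b} \<subseteq> X"
      and abL: "\<And>y. y \<in> {a..b} \<Longrightarrow> \<Lambda> y = l" for a b h x l
  proof -
    have "\<exists>z. z > a \<and> z < b \<and> d b - d a = (b - a) * d1 z"
    proof (rule MVT2)
      show "a < b" using h by simp
      show "(d has_real_derivative d1 y) (at y)" if "a \<le> y" "y \<le> b" for y
        using that abX by (intro D1) auto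
    qed
    then obtain z where z: "a < z" "z < b" "d b - d a = h * d1 z"
      using h by auto
    have 1: "norm (d2 y) \<le> D * l ^ c" "(d1 has_real_derivative d2 y) (at y within {a..b})"
      if y: "y \<in> {a..b}" for y
    proof -
      have "y \<in> X" using abX y by blast
      then show "norm (d2 y) \<le> D * l ^ c" "(d1 has_real_derivative d2 y) (at y within {a..b})"
        using D(2)[of y] D2[of y] abL[OF y] by (simp_all add: has_field_derivative_at_within)
    qed
    have "norm (d1 x - d1 z) \<le> D * l ^ c * norm (x - z)"
      by (rule field_differentiable_bound[of "{a..b}" d1 d2]) (use 1 x z in auto)
    also have "\<dots> \<le> D * l ^ c * h"
    proof (rule mult_left_mono)
      show "norm (x - z) \<le> h" using x z h by (auto simp: abs_le_iff)
      show "0 \<le> D * l ^ c" using 1(1)[OF x] norm_ge_zero order_trans by blast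
    qed
    finally have 1: "\<bar>d1 x - d1 z\<bar> \<le> h * (D * l ^ c)" by (simp add: mult.commute)
    have "\<bar>d1 z\<bar> = \<bar>d b - d a\<bar> / h" using z h by (simp add: abs_mult)
    also have "\<dots> \<le> (\<bar>d a\<bar> + \<bar>d b\<bar>) / h" using h by (intro divide_right_mono) auto
    finally show ?thesis using 1 by linarith
  qed
  have "\<bar>d1 x\<bar> * \<Lambda> x ^ N \<le> 2 * C / \<kappa> + \<kappa> * D" if x: "x \<in> X" for x
  proof -
    define l where "l = \<Lambda> x"
    have l: "l \<ge> 1" using L[OF x] l_def by simp
    \<comment> \<open>With this step the difference quotient costs the factor
      \<open>l ^ (N + c + 1)\<close>, covered by negligibility of \<open>d\<close> with exponent
      \<open>2 * N + c + 1\<close>, and the remainder \<open>h * (D * l ^ c)\<close> still absorbs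
      \<open>l ^ N\<close>.\<close>
    define h where "h = \<kappa> / l ^ (N + c + 1)"
    have h0: "h > 0" using l \<open>\<kappa> > 0\<close> by (simp add: h_def)
    have "l \<le> l ^ (N + c + 1)" using l power_increasing[of 1 "N+c+1" l] by simp
    then have h1: "h \<le> \<kappa> / \<Lambda> x" unfolding h_def l_def[symmetric]
      using l \<open>\<kappa> > 0\<close> by (intro divide_left_mono) auto
    define Q where "Q y \<longleftrightarrow> y \<in> X \<and> \<Lambda> y = l" for y
    \<comment> \<open>Only one side of \<open>x\<close> is guaranteed to stay in \<open>X\<close>,
      so \<open>x\<close> becomes an endpoint of an interval of length \<open>h\<close>.\<close>
    have "\<exists>a b. b = a + h \<and> x \<in> {a..b} \<and> (\<forall>y\<in>{a..b}. Q y)"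
      using thick[OF x h0 h1] unfolding l_def[symmetric] Q_def[symmetric]
    proof
      assume "\<forall>y\<in>{x..x + h}. Q y"
      then show ?thesis using h0 by (intro exI[of _ x] exI[of _ "x+h"]) auto
    next
      assume "\<forall>y\<in>{x - h..x}. Q y"
      then show ?thesis using h0 by (intro exI[of _ "x-h"] exI[of _ x]) auto
    qed
    then obtain a b where ab: "b = a + h" "x \<in> {a..b}" "{a..b} \<subseteq> X"
      and abL: "\<And>y. y \<in> {a..b} \<Longrightarrow> \<Lambda> y = l"
      unfolding Q_def by blast
    have s: "\<bar>d1 x\<bar> \<le> (\<bar>d a\<bar> + \<bar>d b\<bar>) / h + h * (D * l ^ c)"
      by (rule step[OF h0 ab abL])
    have "a \<in> {a..b}" "b \<in> {a..b}" using ab h0 by auto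
    then have da: "\<bar>d a\<bar> * l ^ (2*N+c+1) \<le> C" "\<bar>d b\<bar> * l ^ (2*N+c+1) \<le> C"
      using C[of a] C[of b] ab(3) abL by (metis subsetD)+
    have e: "l ^ (2*N+c+1) = l ^ N * l ^ (N+c+1)" by (simp add: mult_2 add.assoc flip: power_add)
    have "\<bar>d1 x\<bar> * l ^ N \<le> ((\<bar>d a\<bar> + \<bar>d b\<bar>) / h + h * (D * l ^ c)) * l ^ N"
      using s l by (intro mult_right_mono) auto
    also have "\<dots> = (\<bar>d a\<bar> * l ^ (2*N+c+1) + \<bar>d b\<bar> * l ^ (2*N+c+1)) / \<kappa> + \<kappa> * D * (l ^ (N+c) / l ^ (N+c+1))"
      using l \<open>\<kappa> > 0\<close> unfolding h_def e by (simp add: field_simps power_add)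
    also have "\<dots> \<le> (C + C) / \<kappa> + \<kappa> * D * 1"
      using da l \<open>\<kappa> > 0\<close> D(1)
      by (intro add_mono divide_right_mono mult_left_mono) (auto simp: divide_le_eq)
    finally show ?thesis by (simp add: l_def)
  qed
  then show "\<exists>C. \<forall>x\<in>X. \<bar>d1 x\<bar> * \<Lambda> x ^ N \<le> C" by blast
qed

text \<open>Bounding the derivative of order \<open>n\<close> by interpolation uses a moderate bound
  of order \<open>n + 1\<close>, hence \<open>Suc n\<close>.\<close>

lemma negligible_ctl:
  assumes "\<And>x. x \<in> X \<Longrightarrow> \<Lambda> x \<ge> (1::real)" and "\<kappa> > 0"
    and "\<And>x h. x \<in> X \<Longrightarrow> 0 < h \<Longrightarrow> h \<le> \<kappa> / \<Lambda> x \<Longrightarrow>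
        (\<forall>y\<in>{x..x+h}. y \<in> X \<and> \<Lambda> y = \<Lambda> x) \<or> (\<forall>y\<in>{x-h..x}. y \<in> X \<and> \<Lambda> y = \<Lambda> x)"
    and "ctl (moderate X \<Lambda>) X (Suc n) d" "negligible_wrt X \<Lambda> d"
  shows "ctl (negligible_wrt X \<Lambda>) X n d"
  using assms(4,5)
proof (induction n arbitrary: d)
  case 0
  then show ?case by simp
next
  case (Suc n)
  have "negligible_wrt X \<Lambda> (deriv d)"
    by (rule negligible_deriv[OF assms(1-3), where ?d2.0 = "deriv (deriv d)" and d = d])
      (use Suc.prems in \<open>auto dest: ctl_imp\<close>)
  then show ?case using Suc by auto
qed

section \<open>Bump functions and the blocks of the half-line\<close>

abbreviation bounded_class :: "real set \<Rightarrow> (real \<Rightarrow> real) \<Rightarrow> bool" where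
  "bounded_class X \<equiv> moderate X (\<lambda>_. 1)"

lemma bounded_algebra: "algebra_class X (bounded_class X)"
  by (rule moderate_algebra) simp

lemma bounded_class_iff: "bounded_class X F \<longleftrightarrow> (\<exists>C. \<forall>x\<in>X. \<bar>F x\<bar> \<le> C)"
  by (simp add: moderate_def)

lemma bounded_class_algebra:
  assumes "algebra_class X P" "bounded_class Y G" "\<And>x. x \<in> X \<Longrightarrow> F x \<in> Y"
  shows "P (\<lambda>x. G (F x))"
proof -
  obtain C where C: "\<forall>y\<in>Y. \<bar>G y\<bar> \<le> C"
    using assms(2) unfolding bounded_class_iff by blast
  show ?thesis
    by (rule solidD[OF algebra_solid[OF assms(1)] algebra_const[OF assms(1), of C]])
      (use C assms(3) in fastforce)
qed

lemma True_algebra: "algebra_class X (\<lambda>_. True)"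
  by (simp add: algebra_class_def solid_def)

section \<open>Flat exponentials and a smooth transition function\<close>

definition flat_exp :: "nat \<Rightarrow> real \<Rightarrow> real" where
  "flat_exp m x = (if x > 0 then exp (- (1 / x)) / x ^ m else 0)"

lemma flat_exp_nonneg: "flat_exp m x \<ge> 0"
  by (simp add: flat_exp_def)

lemma power_le_exp:
  assumes "(y::real) \<ge> 0"
  shows "y ^ m \<le> real m ^ m * exp y"
proof (cases "m = 0")
  case False
  have "(1 + y / real m) ^ m \<le> exp y"
    by (rule exp_ge_one_plus_x_over_n_power_n) (use assms False in auto)
  moreover have "(y / real m) ^ m \<le> (1 + y / real m) ^ m"
    using assms by (intro power_mono) auto
  ultimately have "(y / real m) ^ m \<le> exp y" by linarith
  then show ?thesis using False by (simp add: power_divide field_simps)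
qed (use assms in auto)

lemma flat_exp_le: "\<bar>flat_exp m x\<bar> \<le> real m ^ m"
proof (cases "x > 0")
  case True
  have "(1 / x) ^ m \<le> real m ^ m * exp (1 / x)"
    using True by (intro power_le_exp) auto
  then have "(1 / x) ^ m * exp (- (1 / x)) \<le> real m ^ m * exp (1 / x) * exp (- (1 / x))"
    by (intro mult_right_mono) auto
  also have "\<dots> = real m ^ m" by (simp add: exp_minus field_simps)
  finally show ?thesis using True by (simp add: flat_exp_def power_divide)
qed (simp add: flat_exp_def)

text \<open>The family \<open>flat_exp m\<close> is closed under differentiation up to linear
  combinations, also at 0. One induction over all \<open>m\<close> together therefore bounds every
  derivative.\<close>

lemma DERIV_flat_exp:
  "(flat_exp m has_real_derivative flat_exp (m + 2) x - real m * flat_exp (m + 1) x) (at x)"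
proof -
  consider "x > 0" | "x < 0" | "x = 0" by linarith
  then show ?thesis
  proof cases
    case 1
    have "((\<lambda>x. exp (- (1 / x)) / x ^ m) has_real_derivative
      flat_exp (m + 2) x - real m * flat_exp (m + 1) x) (at x)"
    proof (cases m)
      case 0
      then show ?thesis using 1
        by (auto intro!: derivative_eq_intros simp: flat_exp_def power2_eq_square)
    next
      case (Suc n)
      have "((\<lambda>x. exp (- (1 / x)) / x ^ m) has_real_derivative
         (exp (- (1 / x)) * (1 / x\<^sup>2) * x ^ m - exp (- (1 / x)) * (real m * x ^ n)) / (x ^ m * x ^ m)) (at x)"
      proof (rule DERIV_divide)
        show "((\<lambda>x. exp (- (1 / x))) has_real_derivative exp (- (1 / x)) * (1 / x\<^sup>2)) (at x)"
          using 1 by (auto intro!: derivative_eq_intros simp: power2_eq_square)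
        show "((\<lambda>x. x ^ m) has_real_derivative real m * x ^ n) (at x)"
          using DERIV_pow[of m x] Suc by simp
      qed (use 1 in auto)
      moreover have "(exp (- (1 / x)) * (1 / x\<^sup>2) * x ^ m - exp (- (1 / x)) * (real m * x ^ n)) / (x ^ m * x ^ m)
         = flat_exp (m + 2) x - real m * flat_exp (m + 1) x"
        using 1 Suc by (simp add: flat_exp_def field_simps power2_eq_square)
      ultimately show ?thesis by simp
    qed
    then show ?thesis
      by (rule has_field_derivative_transform_within_open[where S = "{0<..}"])
        (use 1 in \<open>auto simp: flat_exp_def\<close>)
  next
    case 2
    have "((\<lambda>x. 0) has_real_derivative 0) (at x)" by simp
    then have "(flat_exp m has_real_derivative 0) (at x)"
      by (rule has_field_derivative_transform_within_open[where S = "{..<0}"])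
        (use 2 in \<open>auto simp: flat_exp_def\<close>)
    then show ?thesis using 2 by (simp add: flat_exp_def)
  next
    case 3
    \<comment> \<open>At 0 the difference quotient is \<open>h\<close> times the bounded function
      \<open>flat_exp (m + 2)\<close>.\<close>
    have "\<bar>flat_exp m h / h\<bar> \<le> real (m + 2) ^ (m + 2) * \<bar>h\<bar>" if "h \<noteq> 0" for h
    proof -
      have "flat_exp m h / h = flat_exp (m + 2) h * h"
        using that by (simp add: flat_exp_def field_simps)
      then show ?thesis
        using mult_right_mono[OF flat_exp_le[of "m + 2" h], of "\<bar>h\<bar>"] by (simp add: abs_mult)
    qed
    then have "\<forall>\<^sub>F h in at 0. norm (flat_exp m h / h) \<le> real (m + 2) ^ (m + 2) * \<bar>h\<bar>"
      by (auto simp: eventually_at_filter)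
    moreover have "((\<lambda>h. real (m + 2) ^ (m + 2) * \<bar>h\<bar>) \<longlongrightarrow> 0) (at 0)"
      by (auto intro!: tendsto_eq_intros)
    ultimately have "((\<lambda>h. flat_exp m h / h) \<longlongrightarrow> 0) (at 0)"
      by (rule Lim_null_comparison)
    then show ?thesis using 3 by (simp add: DERIV_def flat_exp_def)
  qed
qed

lemma ctl_flat_exp: "ctl (bounded_class UNIV) UNIV n (flat_exp m)"
proof (induction n arbitrary: m)
  case 0
  show ?case by (auto simp: bounded_class_iff intro: flat_exp_le)
next
  case (Suc n)
  note A = bounded_algebra[of UNIV]
  show ?case
  proof (rule ctl_SucI[OF algebra_solid[OF A] _ _ DERIV_flat_exp])
    show "bounded_class UNIV (flat_exp m)" by (auto simp: bounded_class_iff intro: flat_exp_le)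
    show "ctl (bounded_class UNIV) UNIV n (\<lambda>x. flat_exp (m + 2) x - real m * flat_exp (m + 1) x)"
      by (intro ctl_diff[OF algebra_solid[OF A]] ctl_cmult[OF A] Suc) auto
  qed auto
qed

definition smooth_step :: "real \<Rightarrow> real" where
  "smooth_step y = flat_exp 0 y * inverse (flat_exp 0 y + flat_exp 0 (1 - y))"

text \<open>One of \<open>y\<close> and \<open>1 - y\<close> is at least 1/2, and there
  \<open>flat_exp 0\<close> is at least \<open>exp (- 2)\<close>.\<close>

lemma smooth_step_denom: "flat_exp 0 y + flat_exp 0 (1 - y) \<ge> exp (- 2)"
proof (cases "y \<ge> 1 / 2")
  case True
  then have "1 / y \<le> 2" by (simp add: field_simps)
  then have "exp (-2) \<le> flat_exp 0 y" using True by (simp add: flat_exp_def)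
  then show ?thesis using flat_exp_nonneg[of 0 "1 - y"] by linarith
next
  case False
  then have "1 / (1 - y) \<le> 2" by (simp add: field_simps)
  then have "exp (-2) \<le> flat_exp 0 (1 - y)" using False by (simp add: flat_exp_def)
  then show ?thesis using flat_exp_nonneg[of 0 y] by linarith
qed

lemma smooth_step_range: "0 \<le> smooth_step y" "smooth_step y \<le> 1"
proof -
  have p: "flat_exp 0 y + flat_exp 0 (1 - y) > 0"
    using smooth_step_denom[of y] exp_gt_zero[of "-2::real"] by linarith
  then show "0 \<le> smooth_step y" "smooth_step y \<le> 1"
    using flat_exp_nonneg[of 0 y] flat_exp_nonneg[of 0 "1 - y"]
    unfolding smooth_step_def by (auto simp: field_simps)
qed

lemma smooth_step_0: "y \<le> 0 \<Longrightarrow> smooth_step y = 0"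
  by (simp add: smooth_step_def flat_exp_def)

lemma smooth_step_1: "y \<ge> 1 \<Longrightarrow> smooth_step y = 1"
  by (simp add: smooth_step_def flat_exp_def)

lemma ctl_smooth_step: "ctl (bounded_class UNIV) UNIV n smooth_step"
proof -
  note A = bounded_algebra[of UNIV]
  have "ctl (bounded_class UNIV) UNIV n (\<lambda>y. flat_exp 0 (1 - y))" for n
  proof (rule ctl_compose_deriv[OF A _ _ _ ctl_flat_exp, where F' = "\<lambda>_. -1"])
    show "bounded_class UNIV (\<lambda>y. G (1 - y))" if "bounded_class UNIV G" for G
      using bounded_class_algebra[OF A that, of "\<lambda>y. 1 - y"] by simp
  qed (auto intro!: derivative_eq_intros ctl_const[OF A])
  then have d: "ctl (bounded_class UNIV) UNIV n (\<lambda>y. flat_exp 0 y + flat_exp 0 (1 - y))" for n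
    by (intro ctl_add[OF algebra_solid[OF A]] ctl_flat_exp) auto
  have pos: "flat_exp 0 y + flat_exp 0 (1 - y) > 0" for y
    using smooth_step_denom[of y] exp_gt_zero[of "-2::real"] by linarith
  have "\<bar>inverse (flat_exp 0 y + flat_exp 0 (1 - y))\<bar> \<le> exp 2" for y
  proof -
    have "inverse (flat_exp 0 y + flat_exp 0 (1 - y)) \<le> inverse (exp (-2))"
      by (rule le_imp_inverse_le[OF smooth_step_denom]) simp
    then show ?thesis using pos[of y] by (simp add: exp_minus)
  qed
  then have b: "bounded_class UNIV (\<lambda>y. inverse (flat_exp 0 y + flat_exp 0 (1 - y)))"
    unfolding bounded_class_iff by blast
  have "ctl (bounded_class UNIV) UNIV n (\<lambda>y. inverse (flat_exp 0 y + flat_exp 0 (1 - y)))"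
    by (rule ctl_inverse[OF A _ _ b d]) (use pos in \<open>auto simp: less_le\<close>)
  then show ?thesis
    unfolding smooth_step_def[abs_def] by (rule ctl_algebra_mult[OF A open_UNIV ctl_flat_exp])
qed

section \<open>Cutoffs that are periodic in \<open>1 / x\<close>\<close>

lemma ctl_inverse_power:
  assumes "algebra_class X P" "open X" "X \<subseteq> {0<..}" "P (\<lambda>x. 1 / x)"
  shows "ctl P X n (\<lambda>x. 1 / x ^ m)"
proof -
  have b: "P (\<lambda>x. 1 / x ^ m)" for m
  proof (induction m)
    case 0
    show ?case using algebra_const[of X P 1, OF assms(1)] by simp
  next
    case (Suc m)
    show ?case using algebra_mult[of X P "\<lambda>x. 1 / x" "\<lambda>x. 1 / x ^ m", OF assms(1,4) Suc] by simp
  qed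
  show ?thesis
  proof (induction n arbitrary: m)
    case 0
    show ?case using b by simp
  next
    case (Suc n)
    have D: "((\<lambda>x. 1 / x ^ m) has_real_derivative - real m * (1 / x ^ (m + 1))) (at x)" if "x \<in> X" for x
    proof (cases m)
      case (Suc j)
      have x: "x > 0" using that assms(3) by auto
      have "((\<lambda>x. x ^ m) has_real_derivative real m * x ^ j) (at x)"
        using DERIV_pow[of m x] Suc by simp
      then have "((\<lambda>x. 1 / x ^ m) has_real_derivative (0 * x ^ m - 1 * (real m * x ^ j)) / (x ^ m * x ^ m)) (at x)"
        using x by (intro DERIV_divide) auto
      moreover have "(0 * x ^ m - 1 * (real m * x ^ j)) / (x ^ m * x ^ m) = - real m * (1 / x ^ (m + 1))"
        using x Suc by (simp add: field_simps)
      ultimately show ?thesis by simp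
    qed simp
    show ?case
      by (rule ctl_SucI[OF algebra_solid[OF assms(1)] assms(2) b D ctl_cmult[OF assms(1,2) Suc]])
  qed
qed

text \<open>Composing with \<open>cos (2 * pi / x)\<close> instead of \<open>frac (1 / x)\<close>
  keeps the cutoff smooth across the block ends. For \<open>a > 0\<close> it rises from 0 to 1 while
  the cosine falls from \<open>b\<close> to \<open>b - 1 / a\<close>.\<close>

definition cutoff :: "real \<Rightarrow> real \<Rightarrow> real \<Rightarrow> real" where
  "cutoff a b x = smooth_step (a * (b - cos (2 * pi / x)))"

lemma cutoff_range: "0 \<le> cutoff a b x" "cutoff a b x \<le> 1"
  by (simp_all add: cutoff_def smooth_step_range)

lemma cutoff_0: "a > 0 \<Longrightarrow> cos (2 * pi / x) \<ge> b \<Longrightarrow> cutoff a b x = 0"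
  unfolding cutoff_def by (intro smooth_step_0) (simp add: mult_le_0_iff)

lemma cutoff_1: "a > 0 \<Longrightarrow> cos (2 * pi / x) \<le> b - 1 / a \<Longrightarrow> cutoff a b x = 1"
  unfolding cutoff_def by (intro smooth_step_1) (simp add: field_simps)

lemma ctl_cutoff:
  assumes "algebra_class X P" "open X" "X \<subseteq> {0<..}" "P (\<lambda>x. 1 / x)"
  shows "ctl P X n (cutoff a b)"
proof -
  have "ctl P X n (\<lambda>x. cos (2 * pi / x))" for n
  proof (rule conjunct2[OF ctl_sin_cos[OF assms(1,2), where F' = "\<lambda>x. (- (2 * pi)) * (1 / x ^ 2)"]])
    show "((\<lambda>x. 2 * pi / x) has_real_derivative (- (2 * pi)) * (1 / x ^ 2)) (at x)" if "x \<in> X" for x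
      using that assms(3) by (auto intro!: derivative_eq_intros simp: power2_eq_square)
    show "ctl P X n (\<lambda>x. (- (2 * pi)) * (1 / x ^ 2))" for n
      by (intro ctl_cmult[OF assms(1,2)] ctl_inverse_power assms)
  qed
  then have "ctl P X n (\<lambda>x. a * (b - cos (2 * pi / x)))"
    by (intro ctl_cmult[OF assms(1,2)] ctl_diff[OF algebra_solid[OF assms(1)] assms(2)] ctl_const[OF assms(1,2)])
  then show ?thesis unfolding cutoff_def[abs_def]
  proof (rule ctl_compose[OF assms(1,2) _ _ ctl_smooth_step, rotated 2])
    show "P (\<lambda>x. G (a * (b - cos (2 * pi / x))))" if "bounded_class UNIV G" for G
      using bounded_class_algebra[OF assms(1) that, of "\<lambda>x. a * (b - cos (2 * pi / x))"] by simp
  qed auto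
qed

section \<open>Blocks, windows and their geometry\<close>

definition block :: "real \<Rightarrow> nat" where
  "block x = nat \<lfloor>1 / x\<rfloor>"

lemma one_over_eq: "x > 0 \<Longrightarrow> 1 / x = real (block x) + frac (1 / x)"
  by (simp add: block_def frac_def)

lemma block_unique:
  assumes "0 < x" "real k \<le> 1 / x" "1 / x < real k + 1"
  shows "block x = k" "frac (1 / x) = 1 / x - real k"
proof -
  have "\<lfloor>1 / x\<rfloor> = int k" using assms by (intro floor_unique) auto
  then show "block x = k" "frac (1 / x) = 1 / x - real k"
    by (simp_all add: block_def frac_def)
qed

lemma block_tendsto: "0 < x \<Longrightarrow> x \<le> 1 / real (Suc K) \<Longrightarrow> K < block x"
proof -
  assume x: "0 < x" "x \<le> 1 / real (Suc K)"
  then have "real (Suc K) \<le> 1 / x" by (simp add: field_simps)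
  then have "int (Suc K) \<le> \<lfloor>1 / x\<rfloor>" by (simp add: le_floor_iff)
  then show ?thesis unfolding block_def by linarith
qed

lemma block_bounds: "x > 0 \<Longrightarrow> real (block x) \<le> 1 / x" "x > 0 \<Longrightarrow> 1 / x < real (block x) + 1"
  using one_over_eq[of x] frac_ge_0[of "1/x"] frac_lt_1[of "1/x"] by linarith+

text \<open>For \<open>0 \<le> a\<close> and \<open>b \<le> 1\<close> this is a union of open
  intervals, one inside each block from \<open>K\<close> on. The strict inequalities keep it off the
  jumps of \<open>block\<close>.\<close>

definition window :: "real \<Rightarrow> real \<Rightarrow> nat \<Rightarrow> real set" where
  "window a b K = {x. 0 < x \<and> K \<le> block x \<and> a < frac (1 / x) \<and> frac (1 / x) < b}"

lemma window_iff:
  assumes "0 \<le> a" "b \<le> 1"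
  shows "x \<in> window a b K \<longleftrightarrow> 0 < x \<and> (\<exists>k\<ge>K. real k + a < 1 / x \<and> 1 / x < real k + b)"
proof
  assume "x \<in> window a b K"
  then show "0 < x \<and> (\<exists>k\<ge>K. real k + a < 1 / x \<and> 1 / x < real k + b)"
    using one_over_eq[of x] unfolding window_def by (auto intro!: exI[of _ "block x"])
next
  assume "0 < x \<and> (\<exists>k\<ge>K. real k + a < 1 / x \<and> 1 / x < real k + b)"
  then obtain k where k: "0 < x" "k \<ge> K" "real k + a < 1 / x" "1 / x < real k + b" by blast
  then have "block x = k" "frac (1 / x) = 1 / x - real k"
    using block_unique[of x k] assms by auto
  then show "x \<in> window a b K" using k unfolding window_def by auto
qed

lemma open_window:
  assumes "0 \<le> a" "b \<le> 1"
  shows "open (window a b K)"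
proof -
  have "window a b K = (\<Union>k\<in>{K..}. {x. 0 < x \<and> (real k + a) * x < 1 \<and> 1 < (real k + b) * x})"
    unfolding set_eq_iff window_iff[OF assms] by (auto simp: field_simps)
  moreover have "open {x. 0 < x \<and> (real k + a) * x < 1 \<and> 1 < (real k + b) * x}" for k
    by (intro open_Collect_conj open_Collect_less continuous_intros)
  ultimately show ?thesis by auto
qed

lemma window_subset_pos: "window a b K \<subseteq> {0<..}"
  by (auto simp: window_def)

lemma eventually_block_eq:
  assumes "x \<in> window a b K" "0 \<le> a" "b \<le> 1"
  shows "\<forall>\<^sub>F y in nhds x. block y = block x"
proof -
  have x: "0 < x" "0 < frac (1 / x)"
    using assms unfolding window_def mem_Collect_eq by linarith+
  let ?k = "block x"
  let ?S = "{y. 0 < y \<and> real ?k * y < 1 \<and> 1 < (real ?k + 1) * y}"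
  have "open ?S"
    by (intro open_Collect_conj open_Collect_less continuous_intros)
  moreover have "x \<in> ?S"
  proof -
    have "real ?k < 1 / x" using x one_over_eq[OF x(1)] by linarith
    then show ?thesis using x(1) block_bounds(2)[OF x(1)] by (simp add: field_simps)
  qed
  ultimately have "\<forall>\<^sub>F y in nhds x. y \<in> ?S" by (rule eventually_nhds_in_open)
  then show ?thesis
    by (rule eventually_mono) (intro block_unique, auto simp: field_simps)
qed

lemma DERIV_block_const:
  assumes "x \<in> window a b K" "0 \<le> a" "b \<le> 1"
  shows "((\<lambda>y. c (block y)) has_real_derivative 0) (at x)"
proof -
  have "\<forall>\<^sub>F y in nhds x. c (block y) = (c (block x) :: real)"
    using eventually_block_eq[OF assms] by eventually_elim simp
  then show ?thesis by (subst DERIV_cong_ev[OF refl _ refl]) auto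
qed

text \<open>The part of the window in block \<open>k\<close> has length
  \<open>(b - a) / ((k + a) * (k + b))\<close>, hence at least \<open>(b - a) / (k + 1) ^ 2\<close>.
  If the scale dominates \<open>(k + 1) ^ 2\<close>, a step of \<open>(b - a) / 4\<close> divided by
  the scale fits on that side of \<open>x\<close> where the farther end lies.\<close>

lemma window_thick:
  assumes ab: "0 \<le> a" "a < b" "b \<le> 1" and x: "x \<in> window a b K" and K: "K \<ge> 1"
    and L: "real (block x + 1) ^ 2 \<le> \<Lambda> (block x)" and h: "0 < h" "h \<le> (b - a) / 4 / \<Lambda> (block x)"
  shows "(\<forall>y\<in>{x..x+h}. y \<in> window a b K \<and> \<Lambda> (block y) = (\<Lambda> (block x) :: real)) \<or>
    (\<forall>y\<in>{x-h..x}. y \<in> window a b K \<and> \<Lambda> (block y) = \<Lambda> (block x))"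
proof -
  define k where "k = block x"
  have k: "k \<ge> 1" "k \<ge> K" "x > 0" "a < frac (1/x)" "frac (1/x) < b"
    using x K unfolding k_def window_def by auto
  define l r where "l = 1 / (real k + b)" and "r = 1 / (real k + a)"
  have pos: "real k + a > 0" "real k + b > 0" using ab k by auto
  have "real k + a < 1 / x" "1 / x < real k + b"
    using one_over_eq[OF k(3)] k unfolding k_def[symmetric] by linarith+
  then have lx: "l < x" "x < r"
    using k(3) pos unfolding l_def r_def by (auto simp: field_simps)
  have inw: "y \<in> window a b K \<and> \<Lambda> (block y) = \<Lambda> (block x)" if "l < y" "y < r" for y
  proof -
    have y: "0 < y" using that(1) pos unfolding l_def by (smt (verit) divide_pos_pos)
    then have b: "real k + a < 1 / y" "1 / y < real k + b"
      using that pos unfolding l_def r_def by (auto simp: field_simps)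
    then have "block y = k" using ab y by (intro block_unique) auto
    then show ?thesis using b y k ab window_iff[of a b y K] by (auto simp: k_def)
  qed
  have "(b - a) / \<Lambda> (block x) \<le> (b - a) / real (k + 1) ^ 2"
    using L ab k unfolding k_def by (intro divide_left_mono) (auto intro!: mult_pos_pos order.strict_trans2[OF _ L])
  also have "\<dots> \<le> (b - a) / ((real k + a) * (real k + b))"
    using ab pos unfolding power2_eq_square by (intro divide_left_mono mult_mono) auto
  also have "\<dots> = r - l" using pos unfolding l_def r_def by (simp add: field_simps)
  finally have h2: "4 * h \<le> r - l" using h by (simp add: field_simps)
  show ?thesis
  proof (cases "x < (l + r) / 2")
    case True
    then have "\<forall>y\<in>{x..x+h}. l < y \<and> y < r" using h2 lx h(1) by auto
    then show ?thesis using inw by blast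
  next
    case False
    then have "\<forall>y\<in>{x-h..x}. l < y \<and> y < r" using h2 lx h(1) by auto
    then show ?thesis using inw by blast
  qed
qed

lemma cos_frac: "cos (2 * pi / x) = cos (2 * pi * frac (1 / x))"
proof -
  have "2 * pi / x = 2 * pi * frac (1/x) + of_int \<lfloor>1/x\<rfloor> * (2 * pi)"
    by (simp add: frac_def right_diff_distrib)
  then show ?thesis using cos.plus_of_int[of "2 * pi * frac (1/x)" "\<lfloor>1/x\<rfloor>"] by simp
qed

lemma cos_near_integer:
  assumes "\<bar>z - of_int n\<bar> \<le> a" "0 \<le> a" "a \<le> 1 / 2"
  shows "cos (2 * pi * z) \<ge> cos (2 * pi * a)"
proof -
  have "2 * pi * z = 2 * pi * (z - of_int n) + of_int n * (2 * pi)" by (simp add: algebra_simps)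
  then have "cos (2 * pi * z) = cos (2 * pi * (z - of_int n))"
    using cos.plus_of_int[of "2 * pi * (z - of_int n)" n] by simp
  also have "\<dots> = cos (2 * pi * \<bar>z - of_int n\<bar>)"
    by (metis abs_if cos_minus mult_minus_right)
  also have "\<dots> \<ge> cos (2 * pi * a)"
    using assms by (intro cos_monotone_0_pi_le) auto
  finally show ?thesis .
qed

lemma cos_frac_ge:
  assumes "0 \<le> a" "a \<le> 1/2" "frac (1/x) \<le> a \<or> frac (1/x) \<ge> 1 - a"
  shows "cos (2 * pi / x) \<ge> cos (2 * pi * a)"
proof -
  define n where "n = (if frac (1/x) \<le> a then \<lfloor>1/x\<rfloor> else \<lfloor>1/x\<rfloor> + 1)"
  have "\<bar>1/x - of_int n\<bar> \<le> a"
  proof (cases "frac (1/x) \<le> a")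
    case True
    then have "n = \<lfloor>1/x\<rfloor>" by (simp add: n_def)
    then show ?thesis using True frac_ge_0[of "1/x"] assms(1) unfolding frac_def by linarith
  next
    case False
    then have "n = \<lfloor>1/x\<rfloor> + 1" "frac (1/x) \<ge> 1 - a" using assms(3) by (simp_all add: n_def)
    then show ?thesis using frac_lt_1[of "1/x"] assms(1) unfolding frac_def by simp
  qed
  from cos_near_integer[OF this assms(1,2)] show ?thesis by simp
qed

lemma cos_frac_le:
  assumes "0 \<le> a" "a \<le> 1/2" "a \<le> frac (1/x)" "frac (1/x) \<le> 1 - a"
  shows "cos (2 * pi / x) \<le> cos (2 * pi * a)"
proof -
  define u where "u = frac (1/x)"
  have u: "a \<le> u" "u \<le> 1 - a" using assms by (auto simp: u_def)
  show ?thesis unfolding cos_frac u_def[symmetric]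
  proof (cases "u \<le> 1/2")
    case True
    then show "cos (2*pi*u) \<le> cos (2*pi*a)"
      using assms u by (intro cos_monotone_0_pi_le) auto
  next
    case False
    then have "cos (2*pi*(1-u)) \<le> cos (2*pi*a)"
      using assms u by (intro cos_monotone_0_pi_le) auto
    also have "cos (2*pi*(1-u)) = cos (2*pi*u)"
      using cos_2pi_minus[of "2*pi*u"] by (simp add: algebra_simps)
    finally show "cos (2*pi*u) \<le> cos (2*pi*a)" by simp
  qed
qed

text \<open>\<open>inner\<close> vanishes where the cosine is nonnegative and is 1 where it is at
  most -1/2; \<open>outer\<close> vanishes where the cosine is at least 3/4 and is 1 where it is at
  most 1/2. So \<open>outer\<close> is already 1, with room to spare, wherever \<open>inner\<close>
  is nonzero, and it is switched where \<open>inner = 0\<close>.\<close>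

definition inner :: "real \<Rightarrow> real" where "inner = cutoff 2 0"
definition outer :: "real \<Rightarrow> real" where "outer = cutoff 4 (3/4)"

lemma inner_0: "frac (1/x) \<le> 1/4 \<or> frac (1/x) \<ge> 3/4 \<Longrightarrow> inner x = 0"
  unfolding inner_def by (rule cutoff_0) (use cos_frac_ge[of "1/4" x] in auto)

lemma inner_1: "1/3 \<le> frac (1/x) \<Longrightarrow> frac (1/x) \<le> 2/3 \<Longrightarrow> inner x = 1"
  unfolding inner_def by (rule cutoff_1) (use cos_frac_le[of "1/3" x] cos_120 in auto)

lemma outer_1: "1/6 \<le> frac (1/x) \<Longrightarrow> frac (1/x) \<le> 5/6 \<Longrightarrow> outer x = 1"
  unfolding outer_def by (rule cutoff_1) (use cos_frac_le[of "1/6" x] cos_60 in auto)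

section \<open>Flows of positive fields\<close>

text \<open>The bound \<open>upper\<close> makes both ends infinitely far away in time and
  displacements in \<open>1 / x\<close> small near 0; its factor 2 leaves room for dividing by
  \<open>1 + ripple \<ge> 1 / 2\<close>. Continuity suffices since the flow is obtained by inverting
  the travel time.\<close>

locale positive_field =
  fixes \<mu> :: "real \<Rightarrow> real"
  assumes continuous: "continuous_on {0<..} \<mu>"
    and positive: "x > 0 \<Longrightarrow> \<mu> x > 0"
    and zero: "\<mu> 0 = 0"
    and upper: "x > 0 \<Longrightarrow> \<mu> x \<le> 2 * exp (- (1 / x))"
begin

definition time :: "real \<Rightarrow> real" where
  "time x = (if x \<ge> 1 then integral {1..x} (\<lambda>y. 1 / \<mu> y) else - integral {x..1} (\<lambda>y. 1 / \<mu> y))"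

lemma DERIV_time:
  assumes "x > 0"
  shows "(time has_real_derivative 1 / \<mu> x) (at x)"
proof -
  define a b where "a = min x 1 / 2" and "b = max x 1 + 1"
  have ab: "0 < a" "a < x" "x < b" "a < 1" "1 < b" using assms by (auto simp: a_def b_def)
  have c: "continuous_on {a..b} (\<lambda>y. 1 / \<mu> y)"
  proof (intro continuous_intros continuous_on_subset[OF continuous] ballI)
    show "\<mu> y \<noteq> 0" if "y \<in> {a..b}" for y
      using that ab(1) positive[of y] by auto
  qed (use ab(1) in auto)
  have int: "(\<lambda>y. 1 / \<mu> y) integrable_on {u..v}" if "a \<le> u" "v \<le> b" for u v
    by (rule integrable_continuous_real[OF continuous_on_subset[OF c]]) (use that in auto)
  have eq: "integral {a..u} (\<lambda>y. 1 / \<mu> y) - integral {a..1} (\<lambda>y. 1 / \<mu> y) = time u"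
    if "u \<in> {a<..<b}" for u
  proof (cases "u \<ge> 1")
    case True
    then show ?thesis
      using Henstock_Kurzweil_Integration.integral_combine[of a 1 u "\<lambda>y. 1 / \<mu> y"] int[of a u] that ab
      by (auto simp: time_def)
  next
    case False
    then show ?thesis
      using Henstock_Kurzweil_Integration.integral_combine[of a u 1 "\<lambda>y. 1 / \<mu> y"] int[of a 1] that ab
      by (auto simp: time_def)
  qed
  have "((\<lambda>u. integral {a..u} (\<lambda>y. 1 / \<mu> y)) has_real_derivative 1 / \<mu> x) (at x within {a..b})"
    using integral_has_vector_derivative[OF c, of x] ab
    by (simp add: has_real_derivative_iff_has_vector_derivative)
  moreover have "at x within {a..b} = at x"
    by (rule at_within_interior) (use ab in auto)
  ultimately have "((\<lambda>u. integral {a..u} (\<lambda>y. 1 / \<mu> y)) has_real_derivative 1 / \<mu> x) (at x)" by simp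
  then have "((\<lambda>u. integral {a..u} (\<lambda>y. 1 / \<mu> y) - integral {a..1} (\<lambda>y. 1 / \<mu> y))
      has_real_derivative 1 / \<mu> x) (at x)"
    by (auto intro!: derivative_eq_intros)
  then show ?thesis
    by (rule has_field_derivative_transform_within_open[where S = "{a<..<b}"]) (use ab eq in auto)
qed

lemma time_strict_mono: "0 < x \<Longrightarrow> x < y \<Longrightarrow> time x < time y"
proof (rule DERIV_pos_imp_increasing[of x y time])
  fix u assume "0 < x" "x \<le> u"
  then have "u > 0" by simp
  then show "\<exists>D. (time has_real_derivative D) (at u) \<and> 0 < D"
    using DERIV_time[of u] positive[of u] by (intro exI[of _ "1 / \<mu> u"]) simp
qed

lemma time_less_iff: "0 < x \<Longrightarrow> 0 < y \<Longrightarrow> time x < time y \<longleftrightarrow> x < y"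
  using time_strict_mono by (metis linorder_less_linear order_less_asym)

lemma time_inj: "0 < x \<Longrightarrow> 0 < y \<Longrightarrow> time x = time y \<longleftrightarrow> x = y"
  using time_strict_mono by (metis linorder_less_linear order_less_irrefl)

text \<open>From \<open>\<mu> u \<le> 2 * exp (- (1 / u)) \<le> 2 * u\<close> the time grows at
  least as fast as \<open>ln / 2\<close>, so it is unbounded in both directions. This is the
  completeness of the flow.\<close>

lemma time_surj: "\<exists>x>0. time x = s"
proof -
  have mono: "time x - ln x / 2 \<le> time y - ln y / 2" if "0 < x" "x \<le> y" for x y
  proof (rule DERIV_nonneg_imp_nondecreasing[OF that(2)])
    fix u assume u: "x \<le> u" "u \<le> y"
    then have u0: "u > 0" using that by simp
    have "\<mu> u \<le> 2 * exp (- (1 / u))" by (rule upper[OF u0])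
    also have "\<dots> \<le> 2 * u"
    proof -
      have "1 / u \<le> exp (1 / u)" using exp_ge_add_one_self[of "1 / u"] by linarith
      then show ?thesis using u0 by (simp add: exp_minus field_simps)
    qed
    finally have "1 / \<mu> u - 1 / u / 2 \<ge> 0" using positive[OF u0] u0 by (simp add: field_simps)
    moreover have "((\<lambda>u. time u - ln u / 2) has_real_derivative 1 / \<mu> u - 1 / u / 2) (at u)"
      using u0 by (auto intro!: derivative_eq_intros DERIV_time)
    ultimately show "\<exists>D. ((\<lambda>u. time u - ln u / 2) has_real_derivative D) (at u) \<and> 0 \<le> D" by blast
  qed
  define b where "b = exp (2 * (\<bar>s\<bar> + \<bar>time 1\<bar>))"
  have b: "b \<ge> 1" "1 / b \<le> 1" "1 / b > 0" unfolding b_def by auto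
  have lnb: "ln b / 2 = \<bar>s\<bar> + \<bar>time 1\<bar>" by (simp add: b_def)
  have "time b \<ge> s" using mono[of 1 b] b lnb by simp
  moreover have "time (1 / b) \<le> s"
    using mono[of "1 / b" 1] b lnb by (simp add: ln_div)
  moreover have "1 / b \<le> b" using b by linarith
  moreover have "isCont time x" if "x > 0" for x
    using DERIV_time[OF that] by (rule DERIV_isCont)
  ultimately obtain x where "1 / b \<le> x" "time x = s"
    using IVT[of time "1 / b" s b] b by (metis order_less_le_trans)
  then show ?thesis using b(3) by (intro exI[of _ x] conjI) linarith+
qed

definition position :: "real \<Rightarrow> real" where
  "position s = (THE x. x > 0 \<and> time x = s)"

lemma position: "position s > 0" "time (position s) = s"
proof -
  have "\<exists>!x. x > 0 \<and> time x = s"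
    using time_surj[of s] time_inj by metis
  from theI'[OF this] show "position s > 0" "time (position s) = s"
    unfolding position_def by auto
qed

lemma position_time: "x > 0 \<Longrightarrow> position (time x) = x"
  using position[of "time x"] time_inj by metis

lemma isCont_position: "isCont position s"
proof -
  define x where "x = position s"
  have x: "x > 0" "time x = s" using position by (auto simp: x_def)
  have "isCont position (time x)"
  proof (rule isCont_inverse_function2[of "x / 2" x "2 * x"])
    show "position (time z) = z" if "x / 2 \<le> z" for z
      using that x by (intro position_time) linarith
    show "isCont time z" if "x / 2 \<le> z" for z
      using that x by (intro DERIV_isCont[OF DERIV_time]) linarith
  qed (use x in auto)
  then show ?thesis using x by simp
qed

lemma DERIV_position: "(position has_real_derivative \<mu> (position s)) (at s)"
proof -
  have "(position has_real_derivative inverse (1 / \<mu> (position s))) (at s)"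
    by (rule DERIV_inverse_function[where f = time and a = "s - 1" and b = "s + 1"])
      (use DERIV_time positive position isCont_position in \<open>auto simp: less_le\<close>)
  then show ?thesis by simp
qed

definition flow :: "real \<Rightarrow> real \<Rightarrow> real" where
  "flow t x = (if x \<le> 0 then 0 else position (time x + t))"

lemma flow_0 [simp]: "flow t 0 = 0"
  by (simp add: flow_def)

lemma flow_pos: "x > 0 \<Longrightarrow> flow t x > 0"
  by (simp add: flow_def position)

lemma flow_nonneg: "flow t x \<ge> 0"
  using flow_pos[of x t] by (cases "x > 0") (auto simp: flow_def)

lemma time_flow: "x > 0 \<Longrightarrow> time (flow t x) = time x + t"
  by (simp add: flow_def position)

lemma flow_eqI: "x > 0 \<Longrightarrow> y > 0 \<Longrightarrow> time y = time x + t \<Longrightarrow> flow t x = y"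
  by (metis flow_def not_le position_time)

lemma flow_of_flow: "flow_of \<mu> flow"
  unfolding flow_of_def
proof (intro conjI allI impI)
  fix x :: real and t assume "x \<ge> 0"
  show "flow 0 x = x" using \<open>x \<ge> 0\<close> by (auto simp: flow_def position_time)
  show "flow t x \<ge> 0" by (rule flow_nonneg)
  show "((\<lambda>s. flow s x) has_real_derivative \<mu> (flow t x)) (at t)"
  proof (cases "x = 0")
    case True
    then show ?thesis by (simp add: flow_def zero)
  next
    case False
    then have "((\<lambda>s. position (time x + s)) has_real_derivative \<mu> (position (time x + t)) * 1) (at t)"
      by (intro DERIV_chain2[OF DERIV_position]) (auto intro!: derivative_eq_intros)
    then show ?thesis using False \<open>x \<ge> 0\<close> by (simp add: flow_def)
  qed
qed

lemma DERIV_flow: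
  assumes "x > 0"
  shows "(flow t has_real_derivative \<mu> (flow t x) * (1 / \<mu> x)) (at x)"
proof -
  have "((\<lambda>x. position (time x + t)) has_real_derivative \<mu> (position (time x + t)) * (1 / \<mu> x)) (at x)"
    by (intro DERIV_chain2[OF DERIV_position]) (auto intro!: derivative_eq_intros DERIV_time assms)
  moreover have "\<mu> (position (time x + t)) = \<mu> (flow t x)" using assms by (simp add: flow_def)
  ultimately have "((\<lambda>x. position (time x + t)) has_real_derivative \<mu> (flow t x) * (1 / \<mu> x)) (at x)" by simp
  then show ?thesis
    by (rule has_field_derivative_transform_within_open[where S = "{0<..}"])
      (use assms in \<open>auto simp: flow_def\<close>)
qed

text \<open>In the coordinate \<open>1 / x\<close> the field tends to \<open>0\<close> because of \<open>upper\<close>.\<close>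

lemma small_displacement:
  assumes "\<delta> > 0"
  obtains K where "\<And>x y. 0 < x \<Longrightarrow> K \<le> block x \<Longrightarrow> 0 < y \<Longrightarrow> \<bar>time y - time x\<bar> \<le> M \<Longrightarrow>
    \<bar>1 / y - 1 / x\<bar> \<le> \<delta>"
proof -
  define c where "c = (\<bar>M\<bar> + 1) / \<delta>"
  have c: "c > 0" using assms by (simp add: c_def add_pos_nonneg)
  \<comment> \<open>Below \<open>1 / Z\<close> the time changes by at least \<open>c\<close> per
    unit of \<open>1 / x\<close>: here \<open>exp (1 / u) / 2 \<ge> (1 / u) ^ 3 / 54\<close> with
    \<open>54 = 2 * 3 ^ 3\<close>, and one factor \<open>1 / u \<ge> Z\<close> turns the right-hand
    side into \<open>c / u ^ 2\<close>.\<close>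
  define Z where "Z = 54 * c"
  have Z: "Z > 0" using c by (simp add: Z_def)
  have mono: "time x + c / x \<le> time y + c / y" if "0 < x" "x \<le> y" "y \<le> 1 / Z" for x y
  proof (rule DERIV_nonneg_imp_nondecreasing[OF that(2)])
    fix u assume u: "x \<le> u" "u \<le> y"
    then have u0: "u > 0" using that by simp
    have "Z \<le> 1 / y" using that Z by (simp add: field_simps)
    also have "1 / y \<le> 1 / u" using u u0 by (simp add: frac_le)
    finally have uZ: "Z \<le> 1 / u" .
    have "(1 / u) ^ 3 \<le> real 3 ^ 3 * exp (1 / u)" using u0 by (intro power_le_exp) auto
    then have 1: "exp (1 / u) / 2 \<ge> (1 / u) ^ 3 / 54" by simp
    have "(1 / u) ^ 3 / 54 = (1 / u) / 54 * (1 / u)\<^sup>2" by (simp add: power2_eq_square power3_eq_cube)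
    also have "\<dots> \<ge> c * (1 / u)\<^sup>2" using uZ by (intro mult_right_mono) (auto simp: Z_def)
    finally have 2: "c / u\<^sup>2 \<le> (1 / u) ^ 3 / 54" by (simp add: power_divide)
    have "1 / \<mu> u \<ge> 1 / (2 * exp (- (1 / u)))"
      using upper[OF u0] positive[OF u0] by (intro divide_left_mono) auto
    then have "1 / \<mu> u \<ge> exp (1 / u) / 2" by (simp add: exp_minus field_simps)
    then have "1 / \<mu> u - c / u\<^sup>2 \<ge> 0" using 1 2 by linarith
    moreover have "((\<lambda>u. time u + c / u) has_real_derivative 1 / \<mu> u - c / u\<^sup>2) (at u)"
      using u0 by (auto intro!: derivative_eq_intros DERIV_time simp: power2_eq_square)
    ultimately show "\<exists>D. ((\<lambda>u. time u + c / u) has_real_derivative D) (at u) \<and> 0 \<le> D" by blast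
  qed
  \<comment> \<open>From a point below \<open>x0\<close>, whatever is reached within time
    \<open>\<bar>M\<bar>\<close> is still below \<open>1 / Z\<close>.\<close>
  obtain x0 where x0: "x0 > 0" "time x0 = time (1 / Z) - \<bar>M\<bar> - 1" using time_surj by blast
  define K where "K = nat \<lceil>Z + 1 / x0\<rceil>"
  have K: "real K \<ge> Z + 1 / x0" unfolding K_def by linarith
  show thesis
  proof (rule that[of K])
    fix x y assume xy: "0 < x" "K \<le> block x" "0 < y" "\<bar>time y - time x\<bar> \<le> M"
    have xK: "1 / x \<ge> Z + 1 / x0"
      using block_bounds(1)[OF xy(1)] xy(2) K by linarith
    then have "1 / x \<ge> 1 / x0" "1 / x \<ge> Z" using Z x0 by (auto intro: order_trans[rotated])
    then have xx: "x \<le> x0" "x \<le> 1 / Z" using xy(1) x0(1) Z by (auto simp: field_simps)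
    have "time x \<le> time x0" using xx(1) xy(1) x0(1) time_less_iff by (metis not_less)
    then have "time y < time (1 / Z)" using xy(4) x0(2) by linarith
    then have yy: "y \<le> 1 / Z" using time_less_iff[of y "1 / Z"] xy(3) Z by simp
    have "c * \<bar>1 / y - 1 / x\<bar> \<le> \<bar>time y - time x\<bar>"
    proof (cases "x \<le> y")
      case True
      then have "1 / y \<le> 1 / x" using xy by (simp add: frac_le)
      then show ?thesis using mono[OF xy(1) True yy] c by (simp add: right_diff_distrib)
    next
      case False
      then have "1 / x \<le> 1 / y" using xy by (simp add: frac_le)
      then show ?thesis using mono[OF xy(3) _ xx(2)] False c by (simp add: right_diff_distrib)
    qed
    also have "\<dots> \<le> c * \<delta>" using xy(4) assms by (simp add: c_def)
    finally show "\<bar>1 / y - 1 / x\<bar> \<le> \<delta>" using c by simp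
  qed
qed

lemma flow_tendsto_0: "((\<lambda>p. flow (fst p) (snd p)) \<longlongrightarrow> 0) (at (s, 0) within UNIV \<times> {0..})"
proof (rule order_tendstoI)
  fix e :: real assume "0 < e"
  \<comment> \<open>From below \<open>r\<close>, fewer than \<open>s + 1\<close> units of time do
    not lead up to \<open>e\<close>; the neighbourhood is thus uniform in the time near
    \<open>s\<close>.\<close>
  define r where "r = position (time e - s - 1)"
  have r: "r > 0" "time r = time e - s - 1" using position by (auto simp: r_def)
  have "flow (fst p) (snd p) < e" if "p \<in> {..<s + 1} \<times> {..<r}" for p
  proof (cases "snd p > 0")
    case True
    then have "time (snd p) < time r" using that time_strict_mono[of "snd p" r] by auto
    then have "time (flow (fst p) (snd p)) < time e" using that r time_flow[OF True] by auto
    then show ?thesis using time_less_iff flow_pos[OF True] \<open>0 < e\<close> by blast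
  next
    case False
    then show ?thesis using \<open>0 < e\<close> by (simp add: flow_def)
  qed
  moreover have "\<forall>\<^sub>F p in at (s, 0) within UNIV \<times> {0..}. p \<in> {..<s + 1} \<times> {..<r}"
    by (rule eventually_at_topological[THEN iffD2])
      (use r in \<open>auto intro!: exI[of _ "{..<s + 1} \<times> {..<r}"] open_Times\<close>)
  ultimately show "\<forall>\<^sub>F p in at (s, 0) within UNIV \<times> {0..}. flow (fst p) (snd p) < e"
    by (auto elim: eventually_mono)
next
  fix e :: real assume "e < 0"
  then show "\<forall>\<^sub>F p in at (s, 0) within UNIV \<times> {0..}. e < flow (fst p) (snd p)"
    by (intro always_eventually allI order_less_le_trans[OF _ flow_nonneg])
qed

lemma continuous_flow: "continuous_on (UNIV \<times> {0..}) (\<lambda>p. flow (fst p) (snd p))"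
  unfolding continuous_on_eq_continuous_within
proof
  fix p :: "real \<times> real" assume p: "p \<in> UNIV \<times> {0..}"
  show "continuous (at p within UNIV \<times> {0..}) (\<lambda>p. flow (fst p) (snd p))"
  proof (cases "snd p = 0")
    case True
    then have "p = (fst p, 0)" by (metis surjective_pairing)
    then show ?thesis using flow_tendsto_0[of "fst p"] True
      unfolding continuous_within by (metis flow_0)
  next
    case False
    then have x: "snd p > 0" using p by auto
    have "isCont (\<lambda>p. time (snd p)) p"
      by (rule isCont_o2[where f = snd and g = time]) (use DERIV_isCont[OF DERIV_time[OF x]] in \<open>auto intro: continuous_intros\<close>)
    then have "isCont (\<lambda>p. time (snd p) + fst p) p" by (intro continuous_intros)
    then have "isCont (\<lambda>p. position (time (snd p) + fst p)) p"
      by (rule isCont_o2[OF _ isCont_position])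
    moreover have "\<forall>\<^sub>F q in nhds p. position (time (snd q) + fst q) = flow (fst q) (snd q)"
    proof -
      have "\<forall>\<^sub>F q in nhds p. q \<in> UNIV \<times> {0<..}"
        using x by (intro eventually_nhds_in_open open_Times) (auto simp: mem_Times_iff)
      then show ?thesis by (rule eventually_mono) (auto simp: flow_def)
    qed
    ultimately have "isCont (\<lambda>p. flow (fst p) (snd p)) p"
      using isCont_cong by fastforce
    then show ?thesis by (rule continuous_at_imp_continuous_at_within)
  qed
qed

end

section \<open>Smooth dependence on the initial condition\<close>

lemma Ck_on_SucD: "Ck_on (Suc n) f S \<Longrightarrow> Ck_on n f S"
proof (induction n arbitrary: f)
  case 0
  then show ?case by (auto intro: DERIV_continuous_on)
next
  case (Suc n)
  then show ?case by (metis Ck_on.simps(2))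
qed

lemma Ck_on_le: "Ck_on n f S \<Longrightarrow> m \<le> n \<Longrightarrow> Ck_on m f S"
  by (induction n) (auto simp: le_Suc_eq simp del: Ck_on.simps dest: Ck_on_SucD)

lemma Ck_on_add: "Ck_on n f S \<Longrightarrow> Ck_on n g S \<Longrightarrow> Ck_on n (\<lambda>x. f x + g x) S"
proof (induction n arbitrary: f g)
  case 0
  then show ?case by (auto intro: continuous_on_add)
next
  case (Suc n)
  then obtain f' g' where
    "\<forall>x\<in>S. (f has_real_derivative f' x) (at x within S)" "Ck_on n f' S"
    "\<forall>x\<in>S. (g has_real_derivative g' x) (at x within S)" "Ck_on n g' S"
    by auto
  then show ?case
    using Suc.IH[of f' g'] by (auto intro!: exI[of _ "\<lambda>x. f' x + g' x"] DERIV_add)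
qed

text \<open>\<open>deriv\<close> is two-sided, so at 0 it is not determined by the half-line; 0 is
  the one-sided derivative of a flat function there.\<close>

definition deriv0 :: "(real \<Rightarrow> real) \<Rightarrow> real \<Rightarrow> real" where
  "deriv0 f x = (if x > 0 then deriv f x else 0)"

lemma negligible_near_0:
  assumes "flat_on {0<..<r} f"
  obtains C where "\<And>x. 0 < x \<Longrightarrow> x < r \<Longrightarrow> \<bar>f x\<bar> \<le> C * x\<^sup>2"
proof -
  obtain C where C: "\<forall>x\<in>{0<..<r}. \<bar>f x\<bar> * (1 / x) ^ 2 \<le> C"
    using assms unfolding negligible_wrt_def by blast
  then have "\<bar>f x\<bar> \<le> C * x\<^sup>2" if "0 < x" "x < r" for x
    using that by (force simp: field_simps)
  then show thesis using that by blast
qed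

lemma DERIV_flat_at_0:
  assumes "flat_on {0<..<r} f" "f 0 = 0" "r > 0"
  shows "(f has_real_derivative 0) (at 0 within {0..})"
proof -
  obtain C where C: "\<And>x. 0 < x \<Longrightarrow> x < r \<Longrightarrow> \<bar>f x\<bar> \<le> C * x\<^sup>2"
    using negligible_near_0[OF assms(1)] by blast
  have "\<forall>\<^sub>F x in at 0 within {0..}. x \<in> {..<r}"
    using assms(3) eventually_at_topological by (force intro!: exI[of _ "{..<r}"])
  moreover have "\<forall>\<^sub>F x in at 0 within {0..}. x \<noteq> 0 \<and> x \<in> {0..}"
    using eventually_at_filter by (force simp: eventually_at_filter)
  ultimately have "\<forall>\<^sub>F x in at 0 within {0..}. norm ((f x - f 0) / (x - 0)) \<le> C * x"
  proof eventually_elim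
    case (elim x)
    then have "x > 0" by auto
    then show ?case using C[of x] elim assms(2) by (simp add: field_simps power2_eq_square)
  qed
  moreover have "((\<lambda>x. C * x) \<longlongrightarrow> 0) (at 0 within {0..})"
    by (auto intro!: tendsto_eq_intros)
  ultimately have "((\<lambda>x. (f x - f 0) / (x - 0)) \<longlongrightarrow> 0) (at 0 within {0..})"
    by (rule Lim_null_comparison)
  then show ?thesis by (simp add: has_field_derivative_iff)
qed

lemma DERIV_flat:
  assumes "\<And>x. x > 0 \<Longrightarrow> (f has_real_derivative deriv f x) (at x)"
    "flat_on {0<..<r} f" "f 0 = 0" "r > 0" "x \<ge> 0"
  shows "(f has_real_derivative deriv0 f x) (at x within {0..})"
proof (cases "x = 0")
  case True
  then show ?thesis using DERIV_flat_at_0[OF assms(2-4)] by (simp add: deriv0_def)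
next
  case False
  then have "(f has_real_derivative deriv f x) (at x)" using assms(1)[of x] assms(5) by linarith
  then show ?thesis using False assms(5) by (auto simp: deriv0_def intro: has_field_derivative_at_within)
qed

text \<open>\<open>deriv0 f\<close> satisfies the same hypotheses one order lower, so one-sided
  differentiation at 0 can be repeated. The interior hypothesis has order \<open>Suc n\<close>
  because continuity is read off from a derivative.\<close>

lemma Ck_on_flat:
  assumes "ctl (\<lambda>_. True) {0<..} (Suc n) f" "ctl (flat_on {0<..<r}) {0<..<r} n f"
    "f 0 = 0" "0 < r" "r \<le> 1"
  shows "Ck_on n f {0..}"
  using assms(1-3)
proof (induction n arbitrary: f)
  case 0
  then have "(f has_real_derivative deriv0 f x) (at x within {0..})" if "x \<ge> 0" for x
    by (intro DERIV_flat[where r = r] assms(4) that) auto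
  then show ?case by (auto intro: DERIV_continuous_on)
next
  case (Suc n)
  have D: "(f has_real_derivative deriv0 f x) (at x within {0..})" if "x \<ge> 0" for x
  proof (rule DERIV_flat[where r = r])
    show "(f has_real_derivative deriv f x) (at x)" if "x > 0" for x
      using Suc.prems(1) that by simp
    show "flat_on {0<..<r} f" by (rule ctl_imp[OF Suc.prems(2)])
  qed (use Suc.prems(3) assms(4) that in auto)
  have "Ck_on n (deriv0 f) {0..}"
  proof (rule Suc.IH)
    show "ctl (\<lambda>_. True) {0<..} (Suc n) (deriv0 f)"
      by (rule ctl_cong[OF algebra_solid[OF True_algebra], where F = "deriv f"])
        (use Suc.prems(1) in \<open>auto simp: deriv0_def\<close>)
    show "ctl (flat_on {0<..<r}) {0<..<r} n (deriv0 f)"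
      by (rule ctl_cong[OF negligible_solid, where F = "deriv f"])
        (use Suc.prems(2) assms(5) in \<open>auto simp: deriv0_def field_simps\<close>)
  qed (simp add: deriv0_def)
  then show ?case using D by auto
qed

text \<open>Derivatives in \<open>x\<close> only, each jointly continuous in time and space: this is
  what differentiation under the time integral needs and what it returns.\<close>

primrec joint_Ck :: "nat \<Rightarrow> (real \<Rightarrow> real \<Rightarrow> real) \<Rightarrow> bool" where
  "joint_Ck 0 F \<longleftrightarrow> continuous_on (UNIV \<times> {0..}) (\<lambda>p. F (fst p) (snd p))"
| "joint_Ck (Suc n) F \<longleftrightarrow> continuous_on (UNIV \<times> {0..}) (\<lambda>p. F (fst p) (snd p)) \<and>
     (\<exists>F'. (\<forall>s. \<forall>x\<ge>0. (F s has_real_derivative F' s x) (at x within {0..})) \<and> joint_Ck n F')"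

lemma joint_Ck_continuous: "joint_Ck n F \<Longrightarrow> continuous_on (UNIV \<times> {0..}) (\<lambda>p. F (fst p) (snd p))"
  by (cases n) simp_all

lemma joint_Ck_SucI:
  assumes "continuous_on (UNIV \<times> {0..}) (\<lambda>p. F (fst p) (snd p))"
    "\<And>s x. x \<ge> 0 \<Longrightarrow> (F s has_real_derivative F' s x) (at x within {0..})" "joint_Ck n F'"
  shows "joint_Ck (Suc n) F"
  unfolding joint_Ck.simps using assms by (intro conjI exI[of _ F']) simp_all

lemma joint_Ck_SucE:
  assumes "joint_Ck (Suc n) F"
  obtains F' where "\<forall>s. \<forall>x\<ge>0. (F s has_real_derivative F' s x) (at x within {0..})" "joint_Ck n F'"
  using assms unfolding joint_Ck.simps by (elim conjE exE)

lemma joint_Ck_SucD: "joint_Ck (Suc n) F \<Longrightarrow> joint_Ck n F"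
proof (induction n arbitrary: F)
  case 0
  then show ?case using joint_Ck_continuous by simp
next
  case (Suc n)
  obtain F' where F': "\<forall>s. \<forall>x\<ge>0. (F s has_real_derivative F' s x) (at x within {0..})" "joint_Ck (Suc n) F'"
    using Suc.prems by (rule joint_Ck_SucE)
  show ?case
    by (rule joint_Ck_SucI[OF joint_Ck_continuous[OF Suc.prems] _ Suc.IH[OF F'(2)]]) (simp add: F'(1))
qed

lemma joint_Ck_add: "joint_Ck n F \<Longrightarrow> joint_Ck n G \<Longrightarrow> joint_Ck n (\<lambda>s x. F s x + G s x)"
proof (induction n arbitrary: F G)
  case 0
  then show ?case by (simp add: continuous_on_add)
next
  case (Suc n)
  obtain F' where F': "\<forall>s. \<forall>x\<ge>0. (F s has_real_derivative F' s x) (at x within {0..})" "joint_Ck n F'"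
    using Suc.prems(1) by (rule joint_Ck_SucE)
  obtain G' where G': "\<forall>s. \<forall>x\<ge>0. (G s has_real_derivative G' s x) (at x within {0..})" "joint_Ck n G'"
    using Suc.prems(2) by (rule joint_Ck_SucE)
  show ?case
    by (rule joint_Ck_SucI[OF _ _ Suc.IH[OF F'(2) G'(2)]])
      (use F' G' Suc.prems[THEN joint_Ck_continuous] in \<open>simp_all add: continuous_on_add DERIV_add\<close>)
qed

lemma joint_Ck_mult: "joint_Ck n F \<Longrightarrow> joint_Ck n G \<Longrightarrow> joint_Ck n (\<lambda>s x. F s x * G s x)"
proof (induction n arbitrary: F G)
  case 0
  then show ?case by (simp add: continuous_on_mult)
next
  case (Suc n)
  obtain F' where F': "\<forall>s. \<forall>x\<ge>0. (F s has_real_derivative F' s x) (at x within {0..})" "joint_Ck n F'"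
    using Suc.prems(1) by (rule joint_Ck_SucE)
  obtain G' where G': "\<forall>s. \<forall>x\<ge>0. (G s has_real_derivative G' s x) (at x within {0..})" "joint_Ck n G'"
    using Suc.prems(2) by (rule joint_Ck_SucE)
  show ?case
    by (rule joint_Ck_SucI[OF _ _ joint_Ck_add[OF Suc.IH[OF F'(2) joint_Ck_SucD[OF Suc.prems(2)]]
            Suc.IH[OF G'(2) joint_Ck_SucD[OF Suc.prems(1)]]]])
      (use F' G' Suc.prems[THEN joint_Ck_continuous] in \<open>simp_all add: continuous_on_mult DERIV_mult\<close>)
qed

lemma joint_Ck_time: "joint_Ck n (\<lambda>s x. s)"
proof -
  have c: "joint_Ck n (\<lambda>s x. 0)" for n
  proof (induction n)
    case (Suc n)
    show ?case by (rule joint_Ck_SucI[OF _ _ Suc]) simp_all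
  qed simp
  have "joint_Ck (Suc n) (\<lambda>s x. s)"
    by (rule joint_Ck_SucI[OF _ _ c]) (simp_all add: continuous_on_fst continuous_on_id)
  then show ?thesis by (rule joint_Ck_SucD)
qed

lemma joint_Ck_compose:
  assumes "\<And>s x. x \<ge> 0 \<Longrightarrow> F s x \<in> S" "Ck_on n g S" "joint_Ck n F"
  shows "joint_Ck n (\<lambda>s x. g (F s x))"
  using assms(2,3)
proof (induction n arbitrary: g)
  case 0
  then show ?case using assms(1)
    by (auto intro!: continuous_on_compose2[of S g])
next
  case (Suc n)
  obtain F' where F': "\<forall>s. \<forall>x\<ge>0. (F s has_real_derivative F' s x) (at x within {0..})" "joint_Ck n F'"
    using Suc.prems(2) by (rule joint_Ck_SucE)
  obtain g' where g': "\<forall>x\<in>S. (g has_real_derivative g' x) (at x within S)" "Ck_on n g' S"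
    using Suc.prems(1) by auto
  have "joint_Ck n (\<lambda>s x. g' (F s x) * F' s x)"
    by (rule joint_Ck_mult[OF Suc.IH[OF g'(2) joint_Ck_SucD[OF Suc.prems(2)]] F'(2)])
  moreover have "((\<lambda>x. g (F s x)) has_real_derivative g' (F s x) * F' s x) (at x within {0..})"
    if x: "x \<ge> 0" for s x
  proof -
    have "(g has_real_derivative g' (F s x)) (at (F s x) within F s ` {0..})"
      by (rule DERIV_subset[of g _ _ S]) (use g'(1) assms(1) x in auto)
    then show ?thesis
      using DERIV_image_chain[of g _ "F s" x "{0..}"] F'(1) x by (auto simp: o_def)
  qed
  moreover have "continuous_on (UNIV \<times> {0..}) (\<lambda>p. g (F (fst p) (snd p)))"
    by (rule continuous_on_compose2[of S g])
      (use assms(1) joint_Ck_continuous[OF Suc.prems(2)] Ck_on_le[OF Suc.prems(1), of 0] in \<open>simp_all add: image_subset_iff\<close>)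
  ultimately show ?case
    by (intro joint_Ck_SucI[where F' = "\<lambda>s x. g' (F s x) * F' s x"])
qed

lemma continuous_on_joint:
  fixes F :: "real \<Rightarrow> real \<Rightarrow> real"
  assumes "continuous_on (UNIV \<times> {0..}) (\<lambda>p. F (fst p) (snd p))"
    "continuous_on S a" "continuous_on S b" "\<And>q. q \<in> S \<Longrightarrow> b q \<ge> 0"
  shows "continuous_on S (\<lambda>q. F (a q) (b q))"
proof -
  have "continuous_on S (\<lambda>q. (a q, b q))" using assms by (intro continuous_intros)
  moreover have "(\<lambda>q. (a q, b q)) ` S \<subseteq> UNIV \<times> {0..}" using assms(4) by auto
  ultimately show ?thesis using continuous_on_compose2[OF assms(1)] by fastforce
qed

lemma continuous_on_integral_joint:
  fixes F :: "real \<Rightarrow> real \<Rightarrow> real"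
  assumes "continuous_on (UNIV \<times> {0..}) (\<lambda>p. F (fst p) (snd p))"
  shows "continuous_on (UNIV \<times> {0..}) (\<lambda>p. integral {0..1} (\<lambda>u. F (fst p * u) (snd p)))"
proof -
  have "continuous_on ((UNIV \<times> {0..}) \<times> cbox 0 1) (\<lambda>q. F (fst (fst q) * snd q) (snd (fst q)))"
    by (rule continuous_on_joint[OF assms]) (auto intro!: continuous_intros)
  then show ?thesis
    using integral_continuous_on_param[of "UNIV \<times> {0..}" 0 1 "\<lambda>p u. F (fst p * u) (snd p)"]
    by (simp add: case_prod_beta)
qed

text \<open>Time enters as \<open>s * u\<close> over a fixed interval, so Leibniz' rule applies
  directly and negative times need no separate case.\<close>

lemma joint_Ck_integral:
  assumes "joint_Ck n F"
  shows "joint_Ck n (\<lambda>s x. integral {0..1} (\<lambda>u. F (s * u) x))"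
  using assms
proof (induction n arbitrary: F)
  case 0
  then show ?case using continuous_on_integral_joint by simp
next
  case (Suc n)
  obtain F' where D: "\<forall>s. \<forall>x\<ge>0. (F s has_real_derivative F' s x) (at x within {0..})" "joint_Ck n F'"
    using Suc.prems by (rule joint_Ck_SucE)
  have cF: "continuous_on (UNIV \<times> {0..}) (\<lambda>p. F (fst p) (snd p))"
    by (rule joint_Ck_continuous[OF Suc.prems])
  have "((\<lambda>x. integral {0..1} (\<lambda>u. F (s * u) x)) has_real_derivative
      integral {0..1} (\<lambda>u. F' (s * u) x)) (at x within {0..})" if x: "x \<ge> 0" for s x
  proof -
    have "((\<lambda>x. integral (cbox 0 1) (\<lambda>u. F (s * u) x)) has_real_derivative
      integral (cbox 0 1) (\<lambda>u. F' (s * u) x)) (at x within {0..})"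
    proof (rule leibniz_rule_field_derivative)
      show "((\<lambda>x. F (s * u) x) has_real_derivative F' (s * u) x) (at x within {0..})" if "x \<in> {0..}" for x u
        using D(1) that by simp
      show "(\<lambda>u. F (s * u) x) integrable_on cbox 0 1" if "x \<in> {0..}" for x
        using continuous_on_joint[OF cF, of "{0..1}" "\<lambda>u. s * u" "\<lambda>_. x"] that
        by (simp add: integrable_continuous_real continuous_on_mult)
      show "continuous_on ({0..} \<times> cbox 0 1) (\<lambda>(x, u). F' (s * u) x)"
        unfolding case_prod_beta
        by (rule continuous_on_joint[OF joint_Ck_continuous[OF D(2)]]) (auto intro!: continuous_intros)
    qed (use x in auto)
    then show ?thesis by simp
  qed
  then show ?case
    by (rule joint_Ck_SucI[OF continuous_on_integral_joint[OF cF] _ Suc.IH[OF D(2)]])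
qed

lemma Ck_on_joint: "joint_Ck n F \<Longrightarrow> Ck_on n (F s) {0..}"
proof (induction n arbitrary: F)
  case 0
  then have "continuous_on {0..} (\<lambda>x. F (fst (s, x)) (snd (s, x)))"
    by (intro continuous_on_compose2[of "UNIV \<times> {0..}" "\<lambda>p. F (fst p) (snd p)" "{0..}" "\<lambda>x. (s, x)"])
      (auto intro!: continuous_intros)
  then show ?case by (simp cong: continuous_on_cong_simp)
next
  case (Suc n)
  obtain F' where "\<forall>s. \<forall>x\<ge>0. (F s has_real_derivative F' s x) (at x within {0..})" "joint_Ck n F'"
    using Suc.prems by (rule joint_Ck_SucE)
  then show ?case using Suc.IH[of F'] by (auto intro!: exI[of _ "F' s"])
qed

lemma Ck_on_exp: "Ck_on n exp (UNIV :: real set)"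
  by (induction n) (auto intro!: continuous_intros exI[of _ exp] DERIV_exp)

locale smooth_field = positive_field +
  fixes \<mu>' :: "real \<Rightarrow> real"
  assumes DERIV_field: "x \<ge> 0 \<Longrightarrow> (\<mu> has_real_derivative \<mu>' x) (at x within {0..})"
    and field'_0: "\<mu>' 0 = 0"
    and Ck_field': "Ck_on n \<mu>' {0..}"
begin

text \<open>The variational equation, with the time integral rescaled to \<open>{0..1}\<close>.\<close>

lemma DERIV_flow_variational:
  assumes "x \<ge> 0"
  shows "(flow s has_real_derivative exp (s * integral {0..1} (\<lambda>u. \<mu>' (flow (s * u) x)))) (at x within {0..})"
proof (cases "x = 0")
  case False
  then have x: "x > 0" using assms by simp
  \<comment> \<open>Along an orbit \<open>ln \<mu>\<close> has derivative \<open>s * \<mu>'\<close>,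
    so its increment identifies \<open>\<mu> (flow s x) / \<mu> x\<close> with the
    exponential.\<close>
  have "((\<lambda>u. s * \<mu>' (flow (s * u) x)) has_integral ln (\<mu> (flow (s * 1) x)) - ln (\<mu> (flow (s * 0) x))) {0..1}"
  proof (rule fundamental_theorem_of_calculus)
    fix u :: real
    have p: "flow (s * u) x > 0" using x by (rule flow_pos)
    have "(\<mu> has_real_derivative \<mu>' (flow (s * u) x)) (at (flow (s * u) x) within {0..})"
      using p by (intro DERIV_field) auto
    moreover have "at (flow (s * u) x) within {0..} = at (flow (s * u) x)"
      using p by (intro at_within_interior) auto
    ultimately have d: "(\<mu> has_real_derivative \<mu>' (flow (s * u) x)) (at (flow (s * u) x))" by simp
    have f: "((\<lambda>v. flow (s * v) x) has_real_derivative \<mu> (flow (s * u) x) * s) (at u)"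
      using flow_of_flow assms unfolding flow_of_def
      by (intro DERIV_chain2[where f = "\<lambda>r. flow r x"]) (auto intro!: derivative_eq_intros)
    have "((\<lambda>v. ln (\<mu> (flow (s * v) x))) has_real_derivative
        1 / \<mu> (flow (s * u) x) * (\<mu>' (flow (s * u) x) * (\<mu> (flow (s * u) x) * s))) (at u)"
      by (intro DERIV_chain2[where f = ln] DERIV_ln_divide positive p
          DERIV_chain2[where f = \<mu> and g = "\<lambda>v. flow (s * v) x"] d f)
    moreover have "1 / \<mu> (flow (s * u) x) * (\<mu>' (flow (s * u) x) * (\<mu> (flow (s * u) x) * s)) = s * \<mu>' (flow (s * u) x)"
      using positive[OF p] by simp
    ultimately show "((\<lambda>v. ln (\<mu> (flow (s * v) x))) has_vector_derivative s * \<mu>' (flow (s * u) x)) (at u within {0..1})"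
      by (simp add: has_real_derivative_iff_has_vector_derivative[symmetric] has_field_derivative_at_within)
  qed simp
  from integral_unique[OF this] have "s * integral {0..1} (\<lambda>u. \<mu>' (flow (s * u) x)) = ln (\<mu> (flow s x)) - ln (\<mu> x)"
    using flow_of_flow assms unfolding flow_of_def by simp
  then have "exp (s * integral {0..1} (\<lambda>u. \<mu>' (flow (s * u) x))) = \<mu> (flow s x) * (1 / \<mu> x)"
    using positive flow_pos x by (simp add: exp_diff)
  then show ?thesis
    using DERIV_flow[OF x, of s] by (simp add: has_field_derivative_at_within)
next
  case True
  \<comment> \<open>At 0 the exponent vanishes, so the derivative has to be 1. A displacement of at
    most 1 in \<open>1 / x\<close> gives \<open>\<bar>flow s x / x - 1\<bar> \<le> flow s x\<close>,
    which tends to 0.\<close>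
  obtain K where K: "\<And>x y. 0 < x \<Longrightarrow> K \<le> block x \<Longrightarrow> 0 < y \<Longrightarrow> \<bar>time y - time x\<bar> \<le> \<bar>s\<bar> \<Longrightarrow>
    \<bar>1 / y - 1 / x\<bar> \<le> 1"
    using small_displacement[of 1 "\<bar>s\<bar>"] by auto
  have "\<forall>\<^sub>F x in at 0 within {0..}. x \<in> {..< 1 / real (Suc K)}"
    using eventually_at_topological by (force intro!: exI[of _ "{..< 1 / real (Suc K)}"])
  moreover have "\<forall>\<^sub>F x::real in at 0 within {0..}. x \<noteq> 0 \<and> x \<in> {0..}"
    by (auto simp: eventually_at_filter)
  ultimately have "\<forall>\<^sub>F x in at 0 within {0..}. norm ((flow s x - flow s 0) / (x - 0) - 1) \<le> flow s x"
  proof eventually_elim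
    case (elim x)
    then have x: "x > 0" by auto
    have "K \<le> block x" using block_tendsto[of x K] elim x by simp
    then have "\<bar>1 / flow s x - 1 / x\<bar> \<le> 1"
      using K[OF x _ flow_pos[OF x]] time_flow[OF x] by simp
    then have "flow s x * \<bar>1 / flow s x - 1 / x\<bar> \<le> flow s x"
      using flow_pos[OF x] by (simp add: mult_left_le)
    moreover have "\<bar>flow s x / x - 1\<bar> = flow s x * \<bar>1 / flow s x - 1 / x\<bar>"
      using flow_pos[OF x, of s] x
      by (subst abs_minus_commute) (simp add: abs_mult_pos' right_diff_distrib)
    ultimately show ?case by simp
  qed
  moreover have "(flow s \<longlongrightarrow> 0) (at 0 within {0..})"
  proof -
    have "continuous_on {0..} (\<lambda>x. flow (fst (s, x)) (snd (s, x)))"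
      by (rule continuous_on_compose2[OF continuous_flow, of "{0..}" "\<lambda>x. (s, x)"])
        (auto intro!: continuous_intros)
    then have "continuous_on {0..} (flow s)" by simp
    then show ?thesis by (force simp: continuous_on_def)
  qed
  ultimately have "((\<lambda>x. (flow s x - flow s 0) / (x - 0) - 1) \<longlongrightarrow> 0) (at 0 within {0..})"
    by (rule Lim_null_comparison)
  then have "((\<lambda>x. (flow s x - flow s 0) / (x - 0)) \<longlongrightarrow> 1) (at 0 within {0..})"
    by (simp add: LIM_zero_iff)
  then show ?thesis using True field'_0 by (simp add: has_field_derivative_iff)
qed

text \<open>The variational formula involves the flow only through \<open>\<mu>'\<close>, so it is
  as regular as the flow itself and each pass gains one order. Unlike the quotient
  \<open>\<mu> (flow s x) / \<mu> x\<close> it makes sense at 0.\<close>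

lemma joint_Ck_flow: "joint_Ck n flow"
proof (induction n)
  case 0
  then show ?case using continuous_flow by simp
next
  case (Suc n)
  have "joint_Ck n (\<lambda>s x. exp (s * integral {0..1} (\<lambda>u. \<mu>' (flow (s * u) x))))"
    by (rule joint_Ck_compose[where S = UNIV] UNIV_I Ck_on_exp joint_Ck_mult joint_Ck_time
        joint_Ck_integral[where F = "\<lambda>s x. \<mu>' (flow s x)"] joint_Ck_compose[OF _ Ck_field' Suc])+
      (simp add: flow_nonneg)
  then show ?case
    using continuous_flow DERIV_flow_variational by (intro joint_Ck_SucI)
qed

lemma smooth_flow: "Ck_on n (flow s) {0..}"
  by (rule Ck_on_joint[OF joint_Ck_flow])

end

section \<open>Approximation of a Liouville number\<close>

text \<open>There are finitely many denominators, and for each the integer nearest to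
  \<open>q * \<alpha>\<close> minimises the distance.\<close>

lemma irrational_gap:
  fixes \<alpha> :: real
  assumes "\<alpha> \<notin> \<rat>"
  shows "\<exists>e>0. \<forall>(p::int) (q::nat). 1 \<le> q \<and> q \<le> Q \<longrightarrow> e \<le> \<bar>\<alpha> - of_int p / real q\<bar>"
proof (induction Q)
  case 0
  then show ?case by (intro exI[of _ 1]) auto
next
  case (Suc Q)
  then obtain e where e: "e > 0" "\<And>(p::int) q. 1 \<le> q \<Longrightarrow> q \<le> Q \<Longrightarrow> e \<le> \<bar>\<alpha> - of_int p / real q\<bar>"
    by blast
  define d where "d = \<bar>real (Suc Q) * \<alpha> - of_int (round (real (Suc Q) * \<alpha>))\<bar> / real (Suc Q)"
  have ne: "real (Suc Q) * \<alpha> \<noteq> of_int m" for m :: int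
  proof
    assume "real (Suc Q) * \<alpha> = of_int m"
    then have "\<alpha> = of_int m / real (Suc Q)" by (simp add: field_simps)
    then show False using assms by (metis Rats_divide Rats_of_int Rats_of_nat)
  qed
  then have d: "d > 0" by (simp add: d_def del: of_nat_Suc)
  have "d \<le> \<bar>\<alpha> - of_int p / real (Suc Q)\<bar>" for p :: int
  proof -
    have "\<bar>real (Suc Q) * \<alpha> - of_int (round (real (Suc Q) * \<alpha>))\<bar> \<le> \<bar>real (Suc Q) * \<alpha> - of_int p\<bar>"
      using round_diff_minimal by blast
    also have "\<dots> = \<bar>\<alpha> - of_int p / real (Suc Q)\<bar> * real (Suc Q)"
    proof -
      have "real (Suc Q) * \<alpha> - of_int p = (\<alpha> - of_int p / real (Suc Q)) * real (Suc Q)"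
        by (simp add: field_simps del: of_nat_Suc)
      then show ?thesis by (simp add: abs_mult del: of_nat_Suc)
    qed
    finally show ?thesis unfolding d_def by (simp add: divide_le_eq del: of_nat_Suc)
  qed
  then show ?case
    using e d by (intro exI[of _ "min e d"]) (auto simp: le_Suc_eq min_le_iff_disj simp del: of_nat_Suc)
qed

lemma liouville_approximation:
  assumes "liouville_number \<alpha>"
  obtains p :: int and q :: nat where "q > Q" "\<bar>real q * \<alpha> - of_int p\<bar> \<le> 1 / real q ^ N"
proof -
  have irr: "\<alpha> \<notin> \<rat>" and nd: "\<not> diophantine \<alpha>"
    using assms by (auto simp: liouville_number_def)
  obtain e where e: "e > 0" "\<And>(p::int) q. 1 \<le> q \<Longrightarrow> q \<le> Q \<Longrightarrow> e \<le> \<bar>\<alpha> - of_int p / real q\<bar>"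
    using irrational_gap[OF irr, of Q] by blast
  \<comment> \<open>The constant \<open>min e 1\<close> does two jobs: the bound by \<open>e\<close>
    excludes denominators up to \<open>Q\<close>, the bound by 1 removes the constant from the final
    estimate.\<close>
  have "\<not> (\<forall>(p::int) (q::nat). q \<ge> 1 \<longrightarrow>
      \<bar>\<alpha> - of_int p / real q\<bar> \<ge> min e 1 * real q powr (- 2 - real N))"
  proof
    assume A: "\<forall>(p::int) (q::nat). q \<ge> 1 \<longrightarrow>
      \<bar>\<alpha> - of_int p / real q\<bar> \<ge> min e 1 * real q powr (- 2 - real N)"
    have "diophantine \<alpha>" unfolding diophantine_def
      by (rule exI[of _ "min e 1"], rule conjI, use e(1) in simp,
          rule exI[of _ "real N"], rule conjI, simp, rule A)
    then show False using nd by simp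
  qed
  then obtain p :: int and q :: nat where pq: "q \<ge> 1"
      "\<bar>\<alpha> - of_int p / real q\<bar> < min e 1 * real q powr (- 2 - real N)"
    by (auto simp: not_le)
  have "real q powr (- 2 - real N) \<le> real q powr 0" using pq(1) by (intro powr_mono) auto
  then have "min e 1 * real q powr (- 2 - real N) \<le> e * 1"
    using e(1) pq(1) by (intro mult_mono) auto
  then have "q > Q" using pq e(2)[of q p] by force
  have "real q powr (- 2 - real N) \<le> real q powr (- real (Suc N))"
    using pq(1) by (intro powr_mono) auto
  also have "\<dots> = 1 / real q ^ Suc N"
    using pq(1) by (simp only: powr_minus_divide powr_realpow)
  finally have "min e 1 * real q powr (- 2 - real N) \<le> 1 * (1 / real q ^ Suc N)"
    using e(1) by (intro mult_mono) auto
  then have "\<bar>\<alpha> - of_int p / real q\<bar> \<le> 1 / real q ^ Suc N" using pq(2) by linarith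
  then have "real q * \<bar>\<alpha> - of_int p / real q\<bar> \<le> real q * (1 / real q ^ Suc N)"
    by (rule mult_left_mono) simp
  moreover have "real q * \<bar>\<alpha> - of_int p / real q\<bar> = \<bar>real q * \<alpha> - of_int p\<bar>"
    using pq(1) by (simp add: abs_mult_pos' right_diff_distrib)
  ultimately have "\<bar>real q * \<alpha> - of_int p\<bar> \<le> 1 / real q ^ N" using pq(1) by simp
  then show thesis using \<open>q > Q\<close> that by blast
qed

text \<open>\<open>q_exp\<close> puts \<open>exp (- 1 / x)\<close> above \<open>1 / q k\<close> on
  block \<open>k\<close>; \<open>q_square\<close> makes windows thick in the scale
  \<open>q k\<close>; \<open>q_growth\<close> bounds sums of earlier denominators and allows the
  nesting of resonance-free intervals; \<open>small\<close> is the bound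
  \<open>v k ^ (k + 2)\<close> for \<open>v k = 1 / q k ^ (k + 1)\<close>, eventually below any
  fixed power of \<open>v k\<close>; \<open>halving\<close> controls tails of sums, and
  \<open>nonzero\<close> keeps the finite sums from being isolated.\<close>

locale approximation_sequence =
  fixes \<alpha> :: real and p :: "nat \<Rightarrow> int" and q :: "nat \<Rightarrow> nat"
  assumes q_exp: "exp (real (k + 1)) \<le> real (q k)"
    and q_square: "real (k + 1) ^ 2 \<le> real (q k)"
    and q_growth: "4 * q k \<le> q (Suc k)"
    and nonzero: "real (q k) * \<alpha> - of_int (p k) \<noteq> 0"
    and small: "\<bar>real (q k) * \<alpha> - of_int (p k)\<bar> \<le> 1 / real (q k) ^ ((k + 1) * (k + 2))"
    and halving: "\<bar>real (q (Suc k)) * \<alpha> - of_int (p (Suc k))\<bar> \<le> \<bar>real (q k) * \<alpha> - of_int (p k)\<bar> / 2"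

lemma ex_approximation_sequence:
  assumes "liouville_number \<alpha>"
  obtains p q where "approximation_sequence \<alpha> p q"
proof -
  define c where "c s = \<bar>real (snd s) * \<alpha> - of_int (fst s)\<bar>" for s :: "int \<times> nat"
  have irr: "\<alpha> \<notin> \<rat>" using assms by (auto simp: liouville_number_def)
  define P where "P k s \<longleftrightarrow> exp (real (k + 1)) \<le> real (snd s) \<and> real (k + 1) ^ 2 \<le> real (snd s) \<and>
    c s \<noteq> 0 \<and> c s \<le> 1 / real (snd s) ^ ((k + 1) * (k + 2))" for k and s :: "int \<times> nat"
  define R where "R (k::nat) s s' \<longleftrightarrow> 4 * snd s \<le> snd s' \<and> c s' \<le> c s / 2" for k and s s' :: "int \<times> nat"
  have ex: "\<exists>s'. P k s' \<and> 4 * q \<le> snd s' \<and> c s' \<le> e" if "e > 0" for k q e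
  proof -
    \<comment> \<open>The summand \<open>1 / e\<close> makes \<open>1 / q'\<close> at most
      \<open>e\<close>, so the smallness required by halving follows from the approximation
      bound.\<close>
    define Q where "Q = nat \<lceil>exp (real (k + 1)) + real (k + 1) ^ 2 + 4 * real q + 1 / e\<rceil>"
    have Q: "real Q \<ge> exp (real (k + 1)) + real (k + 1) ^ 2 + 4 * real q + 1 / e"
      unfolding Q_def by linarith
    obtain p' :: int and q' :: nat where pq: "q' > Q"
      "\<bar>real q' * \<alpha> - of_int p'\<bar> \<le> 1 / real q' ^ ((k + 1) * (k + 2))"
      using liouville_approximation[OF assms] by metis
    have q': "real q' \<ge> real Q" "q' \<ge> 1" using pq(1) by auto
    have nonneg: "exp (real (k + 1)) \<ge> 0" "real (k + 1) ^ 2 \<ge> 0" "1 / e \<ge> 0" using that by auto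
    have ge: "exp (real (k + 1)) \<le> real q'" "real (k + 1) ^ 2 \<le> real q'" "4 * real q \<le> real q'" "1 / e \<le> real q'"
      using Q q'(1) nonneg by linarith+
    have "c (p', q') \<noteq> 0"
    proof
      assume "c (p', q') = 0"
      then have "\<alpha> = of_int p' / real q'" using q'(2) by (simp add: c_def field_simps)
      then show False using irr by (metis Rats_divide Rats_of_int Rats_of_nat)
    qed
    moreover have "c (p', q') \<le> e"
    proof -
      have "real q' ^ 1 \<le> real q' ^ ((k + 1) * (k + 2))"
        using q'(2) by (intro power_increasing) auto
      then have "1 / real q' ^ ((k + 1) * (k + 2)) \<le> 1 / real q'"
        using q'(2) by (intro divide_left_mono) auto
      also have "\<dots> \<le> e" using ge(4) that q'(2) by (simp add: field_simps)
      finally show ?thesis using pq(2) by (simp add: c_def)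
    qed
    ultimately show ?thesis
      using ge pq(2) by (intro exI[of _ "(p', q')"]) (auto simp: P_def c_def)
  qed
  have "\<exists>s. \<forall>k. P k (s k) \<and> R k (s k) (s (Suc k))"
  proof (rule dependent_nat_choice)
    show "\<exists>s. P 0 s" using ex[of 1 0 0] by auto
    show "\<exists>s'. P (Suc k) s' \<and> R k s s'" if "P k s" for s k
    proof -
      have "c s / 2 > 0" using that by (auto simp: P_def c_def)
      from ex[OF this, of "Suc k" "snd s"] show ?thesis unfolding R_def by blast
    qed
  qed
  then obtain s where s: "\<And>k. P k (s k)" "\<And>k. R k (s k) (s (Suc k))" by blast
  have "approximation_sequence \<alpha> (\<lambda>k. fst (s k)) (\<lambda>k. snd (s k))"
  proof
    fix k
    show "exp (real (k + 1)) \<le> real (snd (s k))" "real (k + 1) ^ 2 \<le> real (snd (s k))"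
      "real (snd (s k)) * \<alpha> - of_int (fst (s k)) \<noteq> 0"
      "\<bar>real (snd (s k)) * \<alpha> - of_int (fst (s k))\<bar> \<le> 1 / real (snd (s k)) ^ ((k + 1) * (k + 2))"
      using s(1)[of k] unfolding P_def c_def abs_eq_0 by simp_all
    show "4 * snd (s k) \<le> snd (s (Suc k))"
      "\<bar>real (snd (s (Suc k))) * \<alpha> - of_int (fst (s (Suc k)))\<bar> \<le> \<bar>real (snd (s k)) * \<alpha> - of_int (fst (s k))\<bar> / 2"
      using s(2)[of k] unfolding R_def c_def by simp_all
  qed
  then show thesis by (rule that)
qed

context approximation_sequence
begin

definition c :: "nat \<Rightarrow> real" where
  "c k = real (q k) * \<alpha> - of_int (p k)"

lemma c_nonzero: "c k \<noteq> 0" using nonzero by (simp add: c_def)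

lemma c_small: "\<bar>c k\<bar> \<le> 1 / real (q k) ^ ((k + 1) * (k + 2))" using small by (simp add: c_def)

lemma c_halving: "\<bar>c (Suc k)\<bar> \<le> \<bar>c k\<bar> / 2" using halving by (simp add: c_def)

lemma q_ge_2: "q k \<ge> 2"
proof -
  have "1 + real (k + 1) \<le> exp (real (k + 1))" by (rule exp_ge_add_one_self)
  then have "2 \<le> real (q k)" using q_exp[of k] by simp
  then show ?thesis by linarith
qed

lemma q_pos: "real (q k) > 0" "real (q k) \<ge> 1" using q_ge_2[of k] by auto

lemma q_ge_block: "real (k + 1) \<le> real (q k)"
  using q_exp[of k] exp_ge_add_one_self[of "real (k + 1)"] by linarith

lemma c_decay: "\<bar>c (k + n)\<bar> \<le> \<bar>c k\<bar> / 2 ^ n"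
proof (induction n)
  case (Suc n)
  have "\<bar>c (k + Suc n)\<bar> \<le> \<bar>c (k + n)\<bar> / 2" using c_halving by simp
  also have "\<dots> \<le> \<bar>c k\<bar> / 2 ^ n / 2" using Suc by simp
  finally show ?case by simp
qed simp

lemma c_tendsto: "c \<longlonglongrightarrow> 0"
proof (rule Lim_null_comparison)
  show "\<forall>\<^sub>F k in sequentially. norm (c k) \<le> \<bar>c 0\<bar> * (1 / 2) ^ k"
    using c_decay[of 0] by (auto simp: power_one_over field_simps)
  show "(\<lambda>k. \<bar>c 0\<bar> * (1 / 2) ^ k) \<longlonglongrightarrow> 0"
    by (intro tendsto_mult_right_zero LIMSEQ_power_zero) simp
qed

lemma sum_c_tail:
  assumes "finite F" "\<And>i. i \<in> F \<Longrightarrow> j \<le> i"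
  shows "\<bar>\<Sum>i\<in>F. c i\<bar> \<le> 2 * \<bar>c j\<bar>"
proof -
  \<comment> \<open>Halving gives \<open>\<bar>c i\<bar> \<le> 2 * \<bar>c i\<bar> - 2 * \<bar>c (i
    + 1)\<bar>\<close>, so the sum telescopes.\<close>
  have *: "(\<Sum>i = j..<j + n. \<bar>c i\<bar>) \<le> 2 * \<bar>c j\<bar> - 2 * \<bar>c (j + n)\<bar>" for n
  proof (induction n)
    case (Suc n)
    then show ?case using c_halving[of "j + n"] by simp
  qed simp
  obtain m where m: "\<And>i. i \<in> F \<Longrightarrow> i < m" using finite_nat_set_iff_bounded assms(1) by auto
  have "\<bar>\<Sum>i\<in>F. c i\<bar> \<le> (\<Sum>i\<in>F. \<bar>c i\<bar>)" by (rule sum_abs)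
  also have "\<dots> \<le> (\<Sum>i = j..<j + m. \<bar>c i\<bar>)"
  proof (intro sum_mono2 subsetI)
    show "i \<in> {j..<j + m}" if "i \<in> F" for i
      using assms(2)[OF that] m[OF that] by simp
  qed auto
  finally show ?thesis using *[of m] by linarith
qed

lemma sum_q: "1 + (\<Sum>i<j. real (q i)) \<le> real (q j)"
proof (induction j)
  case 0
  then show ?case using q_pos by simp
next
  case (Suc j)
  have "4 * real (q j) \<le> real (q (Suc j))" using q_growth[of j] by linarith
  then show ?case using Suc q_pos[of j] by simp
qed

section \<open>Almost resonant times and the Cantor set\<close>

definition near :: "real \<Rightarrow> nat \<Rightarrow> bool" where
  "near t k \<longleftrightarrow> (\<exists>m::int. \<bar>t - of_int m / real (q k)\<bar> \<le> 4 * \<bar>c k\<bar>)"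

lemma near_1: "near 1 k"
  unfolding near_def using q_pos[of k] by (intro exI[of _ "int (q k)"]) simp

definition finite_sums :: "real set" where
  "finite_sums = {\<alpha> + (\<Sum>i\<in>F. c i) |F. finite F}"

text \<open>For \<open>i < j\<close>, substituting \<open>\<alpha> = p j / q j + c j / q j\<close>
  into \<open>c i\<close> leaves a fraction over \<open>q j\<close> and the error
  \<open>q i * c j / q j\<close>. By \<open>sum_q\<close> these errors and that of
  \<open>\<alpha>\<close> itself add up to at most \<open>\<bar>c j\<bar>\<close>; the terms with
  \<open>i \<ge> j\<close> contribute at most \<open>2 * \<bar>c j\<bar>\<close>.\<close>

lemma finite_sums_near:
  assumes "t \<in> finite_sums"
  shows "\<exists>m::int. \<bar>t - of_int m / real (q j)\<bar> \<le> 3 * \<bar>c j\<bar>"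
proof -
  obtain F where F: "finite F" "t = \<alpha> + (\<Sum>i\<in>F. c i)"
    using assms by (auto simp: finite_sums_def)
  define A where "A = F \<inter> {..<j}"
  define m where "m = p j + (\<Sum>i\<in>A. int (q i) * p j - p i * int (q j))"
  have fA: "finite A" using F by (simp add: A_def)
  have split: "(\<Sum>i\<in>F. c i) = (\<Sum>i\<in>A. c i) + (\<Sum>i\<in>F - A. c i)"
    using F(1) by (intro sum.subset_diff[of A F c, simplified add.commute]) (auto simp: A_def)
  have tail: "\<bar>\<Sum>i\<in>F - A. c i\<bar> \<le> 2 * \<bar>c j\<bar>"
    using F(1) by (intro sum_c_tail) (auto simp: A_def)
  have qj: "real (q j) > 0" by (rule q_pos)
  have 1: "\<alpha> - of_int (p j) / real (q j) = c j / real (q j)"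
    using qj by (simp add: c_def field_simps)
  have 2: "c i - of_int (int (q i) * p j - p i * int (q j)) / real (q j) = real (q i) * (c j / real (q j))" for i
    using qj by (simp add: c_def field_simps)
  have "\<alpha> + (\<Sum>i\<in>A. c i) - of_int m / real (q j)
      = (\<alpha> - of_int (p j) / real (q j)) + (\<Sum>i\<in>A. c i - of_int (int (q i) * p j - p i * int (q j)) / real (q j))"
    unfolding m_def by (simp add: sum_subtractf sum_divide_distrib add_divide_distrib diff_divide_distrib)
  also have "\<dots> = (1 + (\<Sum>i\<in>A. real (q i))) * (c j / real (q j))"
    unfolding 1 2 by (simp only: sum_distrib_right distrib_right mult_1)
  finally have eq: "\<alpha> + (\<Sum>i\<in>A. c i) - of_int m / real (q j) = (1 + (\<Sum>i\<in>A. real (q i))) / real (q j) * c j"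
    by simp
  have "(\<Sum>i\<in>A. real (q i)) \<le> (\<Sum>i<j. real (q i))"
    by (intro sum_mono2) (auto simp: A_def)
  then have "(1 + (\<Sum>i\<in>A. real (q i))) / real (q j) \<le> 1"
    using sum_q[of j] qj by (simp add: divide_le_eq)
  moreover have "0 \<le> (1 + (\<Sum>i\<in>A. real (q i))) / real (q j)"
    by (intro divide_nonneg_nonneg add_nonneg_nonneg sum_nonneg) auto
  ultimately have "\<bar>(1 + (\<Sum>i\<in>A. real (q i))) / real (q j) * c j\<bar> \<le> 1 * \<bar>c j\<bar>"
    unfolding abs_mult by (intro mult_right_mono) auto
  then have "\<bar>t - of_int m / real (q j)\<bar> \<le> 3 * \<bar>c j\<bar>"
    using eq tail F(2) split by linarith
  then show ?thesis by blast
qed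

definition cantor :: "real set" where "cantor = closure finite_sums"

text \<open>A point of the closure lies within \<open>\<bar>c k\<bar>\<close> of a finite sum, hence
  the factor 4 in \<open>near\<close> in place of 3.\<close>

lemma cantor_near: "t \<in> cantor \<Longrightarrow> near t k"
proof -
  assume "t \<in> cantor"
  then obtain s where s: "s \<in> finite_sums" "dist s t < \<bar>c k\<bar>"
    unfolding cantor_def closure_approachable using c_nonzero[of k] by (meson zero_less_abs_iff)
  obtain m :: int where "\<bar>s - of_int m / real (q k)\<bar> \<le> 3 * \<bar>c k\<bar>"
    using finite_sums_near[OF s(1)] by blast
  then have "\<bar>t - of_int m / real (q k)\<bar> \<le> 4 * \<bar>c k\<bar>" using s(2) by (simp add: dist_real_def)
  then show "near t k" unfolding near_def by blast
qed

lemma q_unbounded: "\<exists>k. real (q k) > B"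
proof -
  obtain k where "real k > B" using reals_Archimedean2 by blast
  then show ?thesis using q_ge_block[of k] by (intro exI[of _ k]) simp
qed

lemma \<alpha>_in_finite_sums: "\<alpha> \<in> finite_sums"
  unfolding finite_sums_def by (auto intro: exI[of _ "{}"])

lemma cantor_set_cantor: "cantor_set cantor" "\<alpha> \<in> cantor"
proof -
  show "\<alpha> \<in> cantor" using \<alpha>_in_finite_sums closure_subset by (auto simp: cantor_def)
  have "bounded finite_sums"
  proof (rule boundedI)
    fix t assume "t \<in> finite_sums"
    then obtain F where F: "finite F" "t = \<alpha> + (\<Sum>i\<in>F. c i)" by (auto simp: finite_sums_def)
    have "\<bar>\<Sum>i\<in>F. c i\<bar> \<le> 2 * \<bar>c 0\<bar>" by (rule sum_c_tail[OF F(1)]) simp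
    then show "norm t \<le> \<bar>\<alpha>\<bar> + 2 * \<bar>c 0\<bar>" unfolding F(2) real_norm_def by linarith
  qed
  then have "compact cantor" unfolding cantor_def compact_closure .
  \<comment> \<open>Adjoining a fresh index \<open>k\<close> far out changes the sum by the tiny but
    nonzero \<open>c k\<close>.\<close>
  have lim: "t islimpt finite_sums" if t: "t \<in> finite_sums" for t
    unfolding islimpt_approachable
  proof (intro allI impI)
    fix e :: real assume "e > 0"
    obtain F where F: "finite F" "t = \<alpha> + (\<Sum>i\<in>F. c i)"
      using t by (auto simp: finite_sums_def)
    obtain m where m: "\<And>i. i \<in> F \<Longrightarrow> i < m" using finite_nat_set_iff_bounded F(1) by auto
    obtain n where n: "\<And>k. k \<ge> n \<Longrightarrow> \<bar>c k\<bar> < e"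
      using LIMSEQ_D[OF c_tendsto \<open>e > 0\<close>] by auto
    define k where "k = max m n"
    have "k \<notin> F" using m[of k] by (auto simp: k_def)
    then have eq: "\<alpha> + (\<Sum>i\<in>insert k F. c i) = t + c k" using F by simp
    show "\<exists>x'\<in>finite_sums. x' \<noteq> t \<and> dist x' t < e"
    proof (rule bexI[of _ "t + c k"])
      show "t + c k \<noteq> t \<and> dist (t + c k) t < e"
        using c_nonzero[of k] n[of k] by (simp add: k_def dist_real_def)
      show "t + c k \<in> finite_sums" unfolding finite_sums_def
        using eq F(1) by (intro CollectI exI[of _ "insert k F"]) simp
    qed
  qed
  have perfect: "t islimpt cantor" if "t \<in> cantor" for t
  proof -
    have "t islimpt finite_sums" using that lim by (auto simp: cantor_def closure_def)
    then show ?thesis using islimpt_subset closure_subset unfolding cantor_def by blast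
  qed
  have "\<exists>x. C \<subseteq> {x}" if C: "C \<subseteq> cantor" "connected C" for C
  proof (rule ccontr)
    assume "\<nexists>x. C \<subseteq> {x}"
    then obtain x y where xy: "x \<in> C" "y \<in> C" "x < y"
      by (metis empty_subsetI insert_iff linorder_neqE_linordered_idom subsetI)
    \<comment> \<open>The interval from \<open>x\<close> to \<open>y\<close> is longer than
      \<open>2 / q k\<close>, so it contains a midpoint between neighbours of
      \<open>\<int> / q k\<close>. Since \<open>q k > 8\<close>, the error
      \<open>4 / q k ^ 2\<close> allowed by \<open>near\<close> is below the distance
      \<open>1 / (2 * q k)\<close> of that midpoint from \<open>\<int> / q k\<close>.\<close>
    obtain k where k: "real (q k) > max 8 (2 / (y - x))" using q_unbounded by blast
    define m where "m = \<lceil>real (q k) * x\<rceil>"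
    define u where "u = (of_int m + 1 / 2) / real (q k)"
    have q0: "real (q k) > 0" by (rule q_pos)
    have mm: "real (q k) * x \<le> of_int m" "of_int m < real (q k) * x + 1" unfolding m_def by linarith+
    have "2 / (y - x) < real (q k)" using k by simp
    then have "2 < real (q k) * (y - x)" using xy by (simp add: divide_less_eq)
    then have "real (q k) * x \<le> of_int m + 1 / 2" "of_int m + 1 / 2 \<le> real (q k) * y"
      using mm by (auto simp: right_diff_distrib)
    then have "x \<le> u" "u \<le> y" unfolding u_def using q0 by (simp_all add: field_simps)
    then have "u \<in> C" using connected_contains_Icc[OF C(2) xy(1,2)] by auto
    then have "near u k" using C(1) cantor_near by blast
    then obtain m' :: int where "\<bar>u - of_int m' / real (q k)\<bar> \<le> 4 * \<bar>c k\<bar>"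
      unfolding near_def by blast
    also have "4 * \<bar>c k\<bar> \<le> 4 / real (q k) ^ 2"
    proof -
      have "1 / real (q k) ^ ((k + 1) * (k + 2)) \<le> 1 / real (q k) ^ 2"
        using q_pos[of k] by (intro divide_left_mono power_increasing) auto
      then show ?thesis using c_small[of k] by linarith
    qed
    finally have "\<bar>u - of_int m' / real (q k)\<bar> * real (q k) \<le> 4 / real (q k) ^ 2 * real (q k)"
      using q0 by (intro mult_right_mono) auto
    moreover have "\<bar>u - of_int m' / real (q k)\<bar> * real (q k) = \<bar>of_int (m - m') + 1 / 2\<bar>"
    proof -
      have "(u - of_int m' / real (q k)) * real (q k) = of_int (m - m') + 1 / 2"
        using q0 by (simp add: u_def field_simps)
      then show ?thesis using q0 by (metis abs_mult abs_of_pos)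
    qed
    moreover have "4 / real (q k) ^ 2 * real (q k) < 1 / 2"
      using k q0 by (simp add: power2_eq_square field_simps)
    moreover have "\<bar>of_int (m - m') + 1 / 2\<bar> \<ge> (1 / 2 :: real)"
    proof (cases "m - m' \<ge> 0")
      case True
      then have "real_of_int (m - m') \<ge> 0" by linarith
      then show ?thesis by linarith
    next
      case False
      then have "real_of_int (m - m') \<le> -1" by linarith
      then show ?thesis by linarith
    qed
    ultimately show False by linarith
  qed
  then show "cantor_set cantor"
    unfolding cantor_set_def using \<open>compact cantor\<close> \<open>\<alpha> \<in> cantor\<close> perfect by blast
qed

text \<open>The middle half of a cell of \<open>\<int> / q k\<close> has length
  \<open>1 / (2 * q k) \<ge> 2 / q (k + 1)\<close> and so contains a full cell of the next level. A
  point in all the nested middle halves has its phase always in the half-period where the cosine is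
  nonpositive.\<close>

lemma ex_resonance_free_time: "\<exists>t. \<forall>k. cos (2 * pi * real (q k) * t) \<le> 0"
proof -
  define I where "I k m = {(of_int m + 1 / 4) / real (q k) .. (of_int m + 3 / 4) / real (q k)}" for k and m :: int
  \<comment> \<open>\<open>True\<close> is a trivial invariant; only the relation between
    consecutive choices matters.\<close>
  have "\<exists>m. \<forall>k. True \<and> I (Suc k) (m (Suc k)) \<subseteq> I k (m k)"
  proof (rule dependent_nat_choice)
    fix m :: int and k
    define m' where "m' = \<lceil>real (q (Suc k)) * ((of_int m + 1 / 4) / real (q k))\<rceil>"
    define x where "x = (of_int m + 1 / 4) / real (q k)"
    have m': "real (q (Suc k)) * x \<le> of_int m'" "of_int m' < real (q (Suc k)) * x + 1"
      unfolding m'_def x_def by linarith+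
    have q0: "real (q k) > 0" "real (q (Suc k)) > 0" by (rule q_pos)+
    have "2 / real (q (Suc k)) \<le> 2 / (4 * real (q k))"
      using q_growth[of k] q0 by (intro divide_left_mono) auto
    then have g: "x + 2 / real (q (Suc k)) \<le> (of_int m + 3 / 4) / real (q k)"
      using q0 by (simp add: x_def field_simps)
    have "x \<le> (of_int m' + 1 / 4) / real (q (Suc k))"
      using m' q0 by (simp add: field_simps)
    moreover have "(of_int m' + 3 / 4) / real (q (Suc k)) \<le> x + 2 / real (q (Suc k))"
    proof -
      have "(of_int m' + 3 / 4) / real (q (Suc k)) \<le> (real (q (Suc k)) * x + 2) / real (q (Suc k))"
        using m' q0 by (intro divide_right_mono) auto
      then show ?thesis using q0 by (simp add: add_divide_distrib)
    qed
    ultimately have "I (Suc k) m' \<subseteq> I k m" using g unfolding I_def x_def by auto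
    then show "\<exists>m'. True \<and> I (Suc k) m' \<subseteq> I k m" by blast
  qed auto
  then obtain m where m: "\<And>k. I (Suc k) (m (Suc k)) \<subseteq> I k (m k)" by blast
  have "(\<Inter>k. I k (m k)) \<noteq> {}"
  proof (rule compact_nest)
    show "compact (I k (m k))" for k by (simp add: I_def)
    show "I k (m k) \<noteq> {}" for k using q_pos[of k] by (simp add: I_def divide_right_mono)
    show "I n (m n) \<subseteq> I k (m k)" if "k \<le> n" for k n
      using lift_Suc_antimono_le[of "\<lambda>k. I k (m k)", OF m that] .
  qed
  then obtain t where t: "\<And>k. t \<in> I k (m k)" by blast
  have "cos (2 * pi * real (q k) * t) \<le> 0" for k
  proof -
    define u where "u = real (q k) * t - of_int (m k)"
    have u: "1 / 4 \<le> u" "u \<le> 3 / 4"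
      using t[of k] q_pos[of k] unfolding I_def u_def by (auto simp: field_simps)
    have "2 * pi * real (q k) * t = 2 * pi * u + of_int (m k) * (2 * pi)"
      by (simp add: u_def algebra_simps)
    then have "cos (2 * pi * real (q k) * t) = cos (2 * pi * u)"
      using cos.plus_of_int[of "2 * pi * u" "m k"] by simp
    also have "\<dots> = - sin (2 * pi * u - pi / 2)"
      by (simp add: sin_diff)
    also have "\<dots> \<le> 0"
    proof -
      have "2 * pi * (1 / 4) \<le> 2 * pi * u" "2 * pi * u \<le> 2 * pi * (3 / 4)"
        using u by (intro mult_left_mono; simp)+
      then have "0 \<le> 2 * pi * u - pi / 2" "2 * pi * u - pi / 2 \<le> pi" by linarith+
      then show ?thesis using sin_ge_zero by simp
    qed
    finally show ?thesis .
  qed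
  then show ?thesis by blast
qed

end

section \<open>The vector field\<close>

text \<open>A factor \<open>(1 / x) ^ N\<close> only raises the index of \<open>flat_exp\<close>,
  and the bound holds for every index.\<close>

lemma ctl_negligible_flat_exp:
  assumes "open X" "X \<subseteq> {0<..1}"
  shows "ctl (flat_on X) X n (flat_exp m)"
proof -
  have L: "1 / x \<ge> 1" if "x \<in> X" for x using that assms(2) by auto
  note S = negligible_solid[of X "\<lambda>x. 1 / x", OF L]
  have b: "flat_on X (flat_exp m)" for m
    unfolding negligible_wrt_def
  proof (intro allI exI ballI)
    fix N x assume "x \<in> X"
    then have "\<bar>flat_exp m x\<bar> * (1 / x) ^ N = \<bar>flat_exp (m + N) x\<bar>"
      using assms(2) by (auto simp: flat_exp_def power_add power_divide abs_mult)
    then show "\<bar>flat_exp m x\<bar> * (1 / x) ^ N \<le> real (m + N) ^ (m + N)"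
      using flat_exp_le[of "m + N" x] by simp
  qed
  have c: "ctl (moderate X (\<lambda>x. 1 / x)) X n (\<lambda>_. c)" for n c
    by (rule ctl_const[OF moderate_algebra[OF L] assms(1)])
  show ?thesis
  proof (induction n arbitrary: m)
    case 0
    show ?case using b by simp
  next
    case (Suc n)
    have "ctl (flat_on X) X n (\<lambda>x. flat_exp (m + 2) x - flat_exp (m + 1) x * real m)"
      by (rule ctl_diff[OF S assms(1) Suc ctl_mult[OF S assms(1) negligible_mult_moderate[OF L] Suc c]])
    then have "ctl (flat_on X) X n (\<lambda>x. flat_exp (m + 2) x - real m * flat_exp (m + 1) x)"
      by (simp add: mult.commute)
    then show ?case by (intro ctl_SucI[OF S assms(1) b DERIV_flat_exp])
  qed
qed

lemma DERIV_block_const_open: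
  assumes "x \<in> X" "X \<subseteq> window 0 1 0"
  shows "((\<lambda>y. c (block y)) has_real_derivative 0) (at x)"
  by (rule DERIV_block_const[of x 0 1 0]) (use assms in auto)

lemma ctl_block_const_open:
  assumes "solid X P" "open X" "X \<subseteq> window 0 1 0" "P (\<lambda>y. c (block y))"
  shows "ctl P X n (\<lambda>y. c (block y))"
proof (rule ctl_locally_const[OF assms(1,2,4)])
  show "P (\<lambda>_. 0)" by (rule solidD[OF assms(1,4)]) simp
qed (rule DERIV_block_const_open[OF _ assms(3)])

lemma window_mono: "a' \<le> a \<Longrightarrow> b \<le> b' \<Longrightarrow> K' \<le> K \<Longrightarrow> window a b K \<subseteq> window a' b' K'"
  by (auto simp: window_def)

lemma window_move:
  assumes "x \<in> window a b K" "0 < y" "\<bar>1 / y - 1 / x\<bar> \<le> \<delta>" "0 \<le> a - \<delta>" "b + \<delta> \<le> 1"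
  shows "y \<in> window (a - \<delta>) (b + \<delta>) K" "block y = block x"
proof -
  have x: "0 < x" "K \<le> block x" "a < frac (1 / x)" "frac (1 / x) < b" using assms(1) by (auto simp: window_def)
  note e = one_over_eq[OF x(1)]
  have y: "real (block x) \<le> 1 / y" "1 / y < real (block x) + 1" using e x assms(3-5) by linarith+
  then show "block y = block x" using block_unique(1)[OF assms(2)] by blast
  moreover have "frac (1 / y) = 1 / y - real (block x)" using block_unique(2)[OF assms(2) y] .
  ultimately show "y \<in> window (a - \<delta>) (b + \<delta>) K"
    using e x assms(2,3) unfolding window_def by auto
qed

lemma between_inverse:
  assumes "0 < x" "0 < y" "u \<in> closed_segment x (y::real)"
  shows "0 < u" "\<bar>1 / u - 1 / x\<bar> \<le> \<bar>1 / y - 1 / x\<bar>"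
proof -
  have u: "min x y \<le> u" "u \<le> max x y" using assms(3) by (auto simp: closed_segment_eq_real_ivl split: if_splits)
  then show "0 < u" using assms by auto
  then show "\<bar>1 / u - 1 / x\<bar> \<le> \<bar>1 / y - 1 / x\<bar>"
  proof (cases "x \<le> y")
    case True
    then have "1 / y \<le> 1 / u" "1 / u \<le> 1 / x" using u assms \<open>0 < u\<close> by (auto intro!: divide_left_mono)
    then show ?thesis by linarith
  next
    case False
    then have "1 / u \<le> 1 / y" "1 / x \<le> 1 / u" using u assms \<open>0 < u\<close> by (auto intro!: divide_left_mono)
    then show ?thesis by linarith
  qed
qed

lemma DERIV_zero_segment:
  fixes g :: "real \<Rightarrow> real"
  assumes "\<And>u. u \<in> closed_segment x y \<Longrightarrow> (g has_real_derivative 0) (at u)"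
  shows "g y = g x"
proof (rule has_field_derivative_zero_constant[of "closed_segment x y", THEN exE])
  show "convex (closed_segment x y)" by simp
  show "(g has_real_derivative 0) (at u within closed_segment x y)" if "u \<in> closed_segment x y" for u
    using assms[OF that] by (rule has_field_derivative_at_within)
  fix c assume "\<forall>u\<in>closed_segment x y. g u = c"
  then show "g y = g x" by simp
qed

lemma outer_0_near_integer:
  assumes "\<bar>1 / x - of_int n\<bar> \<le> 1 / 12"
  shows "outer x = 0"
  unfolding outer_def
proof (rule cutoff_0)
  have "cos (pi / 6) \<le> cos (2 * pi / x)" using cos_near_integer[OF assms] by simp
  moreover have "sqrt 3 / 2 \<ge> 3/4" using real_le_rsqrt[of "3/2" 3] by (simp add: power2_eq_square)
  ultimately show "3/4 \<le> cos (2 * pi / x)" by (simp add: cos_30)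
qed simp

text \<open>A neighbourhood of the block ends, where \<open>block\<close> jumps. Both cutoffs vanish
  on it, so nothing that depends on the block enters the fields there; elsewhere block constants are
  locally constant.\<close>

definition integer_zone :: "real set" where
  "integer_zone = {x. 0 < x \<and> cos (2 * pi / x) > 3 / 4}"

lemma open_cos_inverse: "open {x. 0 < x \<and> cos (2 * pi / x) > a}"
proof -
  have "open ({0<..} \<inter> (\<lambda>x. cos (2 * pi / x)) -` {a<..})"
    by (intro continuous_open_preimage continuous_intros) auto
  also have "{0<..} \<inter> (\<lambda>x. cos (2 * pi / x)) -` {a<..} = {x. 0 < x \<and> cos (2 * pi / x) > a}" by auto
  finally show ?thesis .
qed

lemma open_integer_zone: "open integer_zone"
  unfolding integer_zone_def by (rule open_cos_inverse)

lemma integer_zone_cover: "{0<..} \<subseteq> integer_zone \<union> window 0 1 0"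
proof
  fix x :: real assume "x \<in> {0<..}"
  moreover have "cos (2 * pi / x) = 1" if "frac (1 / x) = 0" using cos_frac[of x] that by simp
  ultimately show "x \<in> integer_zone \<union> window 0 1 0"
    using frac_ge_0[of "1 / x"] frac_lt_1[of "1 / x"] unfolding integer_zone_def window_def
    by (cases "frac (1 / x) = 0") (auto simp: less_le)
qed

lemma inner_integer_zone: "x \<in> integer_zone \<Longrightarrow> inner x = 0"
  and outer_integer_zone: "x \<in> integer_zone \<Longrightarrow> outer x = 0"
  unfolding integer_zone_def inner_def outer_def by (auto intro!: cutoff_0)

lemma inner_range: "0 \<le> inner x" "inner x \<le> 1" and outer_range: "0 \<le> outer x" "outer x \<le> 1"
  by (simp_all add: inner_def outer_def cutoff_range)

section \<open>The unperturbed field and its smooth flow\<close>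

context approximation_sequence
begin

definition v :: "nat \<Rightarrow> real" where
  "v k = 1 / real (q k) ^ (k + 1)"

lemma v_pos: "v k > 0" using q_pos by (simp add: v_def)

lemma v_le_q: "v k \<le> 1 / real (q k)"
proof -
  have "real (q k) ^ 1 \<le> real (q k) ^ (k + 1)" using q_pos(2)[of k] by (intro power_increasing) auto
  then show ?thesis using q_pos(1)[of k] by (simp add: v_def frac_le)
qed

lemma v_le_half: "v k \<le> 1 / 2"
proof -
  have "1 / real (q k) \<le> 1 / 2" using q_ge_2[of k] by (simp add: frac_le)
  then show ?thesis using v_le_q[of k] by linarith
qed

lemma inverse_q_le_flat_exp: "x > 0 \<Longrightarrow> 1 / real (q (block x)) \<le> flat_exp 0 x"
proof -
  assume x: "x > 0"
  have "exp (1 / x) \<le> exp (real (block x + 1))" using block_bounds(2)[OF x] by simp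
  also have "\<dots> \<le> real (q (block x))" by (rule q_exp)
  finally have "1 / real (q (block x)) \<le> 1 / exp (1 / x)"
    by (simp add: frac_le)
  then show ?thesis using x by (simp add: flat_exp_def exp_minus inverse_eq_divide)
qed

lemma v_le_flat_exp: "x > 0 \<Longrightarrow> v (block x) \<le> flat_exp 0 x"
  using inverse_q_le_flat_exp[of x] v_le_q[of "block x"] by linarith

definition base_field :: "real \<Rightarrow> real" where
  "base_field x = flat_exp 0 x + (v (block x) - flat_exp 0 x) * inner x"

lemma base_field_0: "base_field 0 = 0"
  by (simp add: base_field_def flat_exp_def inner_0)

lemma base_field_ge: "x > 0 \<Longrightarrow> v (block x) \<le> base_field x"
proof -
  assume "x > 0"
  then have "0 \<le> (flat_exp 0 x - v (block x)) * (1 - inner x)"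
    using v_le_flat_exp inner_range by (intro mult_nonneg_nonneg) auto
  then show ?thesis by (simp add: base_field_def algebra_simps)
qed

lemma base_field_le: "x > 0 \<Longrightarrow> base_field x \<le> flat_exp 0 x"
  using v_le_flat_exp inner_range by (simp add: base_field_def mult_nonpos_nonneg)

lemma base_field_pos: "x > 0 \<Longrightarrow> base_field x > 0"
  using base_field_ge v_pos by (metis order_less_le_trans)

lemma flat_exp_le_1: "flat_exp 0 x \<le> 1"
  by (simp add: flat_exp_def)

lemma base_field_le_1: "x > 0 \<Longrightarrow> base_field x \<le> 1"
  using base_field_le[of x] flat_exp_le_1[of x] by linarith

lemma base_field_integer_zone: "x \<in> integer_zone \<Longrightarrow> base_field x = flat_exp 0 x"
  by (simp add: base_field_def inner_integer_zone)

lemma ctl_base_field: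
  assumes "algebra_class X P" "open X" "X \<subseteq> window 0 1 0" "P (\<lambda>x. 1 / x)"
  shows "ctl P X n base_field"
proof -
  have X0: "X \<subseteq> {0<..}" using assms(3) window_subset_pos by blast
  note S = algebra_solid[OF assms(1)]
  have b: "P F" if "bounded_class UNIV F" for F
    using bounded_class_algebra[of X P UNIV F "\<lambda>x. x", OF assms(1) that] by simp
  have w: "ctl P X n (flat_exp 0)" by (rule ctl_weaken[OF ctl_flat_exp _ b]) simp_all
  have "P (\<lambda>y. v (block y))"
    by (rule b) (auto simp: bounded_class_iff intro!: exI[of _ "1 / 2"] v_le_half simp: abs_of_pos v_pos)
  then have "ctl P X n (\<lambda>x. v (block x))" by (rule ctl_block_const_open[OF S assms(2,3)])
  moreover have "ctl P X n inner" unfolding inner_def by (rule ctl_cutoff[OF assms(1,2) X0 assms(4)])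
  ultimately show ?thesis unfolding base_field_def[abs_def]
    by (intro ctl_add[OF S assms(2) w] ctl_algebra_mult[OF assms(1,2)] ctl_diff[OF S assms(2) _ w])
qed

lemma smooth_base_field: "ctl (\<lambda>_. True) {0<..} n base_field"
proof -
  have "ctl (\<lambda>_. True) integer_zone n base_field"
    by (rule ctl_cong[OF algebra_solid[OF True_algebra] open_integer_zone
          ctl_weaken[OF ctl_flat_exp[of n 0]]]) (simp_all add: base_field_integer_zone)
  moreover have "ctl (\<lambda>_. True) (window 0 1 0) n base_field"
    by (rule ctl_base_field[OF True_algebra open_window]) auto
  ultimately have "ctl (\<lambda>_. True) (integer_zone \<union> window 0 1 0) n base_field"
    by (rule ctl_Un)
  then show ?thesis by (rule ctl_weaken[OF _ integer_zone_cover])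
qed

lemma window_1_subset: "window a b 1 \<subseteq> {0<..1}"
proof
  fix x assume "x \<in> window a b 1"
  then have "0 < x" "1 \<le> block x" by (auto simp: window_def)
  then have "1 \<le> 1 / x" using block_bounds(1)[of x] by linarith
  then show "x \<in> {0<..1}" using \<open>0 < x\<close> by simp
qed

lemma unit_interval_cover: "{0<..<1} \<subseteq> (integer_zone \<inter> {0<..<1}) \<union> window 0 1 1"
proof
  fix x :: real assume x: "x \<in> {0<..<1}"
  then have "0 < block x" by (intro block_tendsto) auto
  then show "x \<in> (integer_zone \<inter> {0<..<1}) \<union> window 0 1 1"
    using x integer_zone_cover by (fastforce simp: window_def)
qed

lemma negligible_Un:
  "negligible_wrt X \<Lambda> F \<Longrightarrow> negligible_wrt Y \<Lambda> F \<Longrightarrow> negligible_wrt (X \<union> Y) \<Lambda> F"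
  unfolding negligible_wrt_def
proof
  fix N assume "\<forall>N. \<exists>C. \<forall>x\<in>X. \<bar>F x\<bar> * \<Lambda> x ^ N \<le> C" "\<forall>N. \<exists>C. \<forall>x\<in>Y. \<bar>F x\<bar> * \<Lambda> x ^ N \<le> C"
  then obtain C D where "\<forall>x\<in>X. \<bar>F x\<bar> * \<Lambda> x ^ N \<le> C" "\<forall>x\<in>Y. \<bar>F x\<bar> * \<Lambda> x ^ N \<le> D" by blast
  then show "\<exists>C. \<forall>x\<in>X \<union> Y. \<bar>F x\<bar> * \<Lambda> x ^ N \<le> C"
    by (intro exI[of _ "max C D"]) (auto simp: le_max_iff_disj)
qed

lemma negligible_subset:
  "negligible_wrt X \<Lambda> F \<Longrightarrow> Y \<subseteq> X \<Longrightarrow> negligible_wrt Y \<Lambda> F"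
  unfolding negligible_wrt_def by (meson subsetD)

lemma ctl_negligible_Un:
  "ctl (negligible_wrt X \<Lambda>) X n F \<Longrightarrow> ctl (negligible_wrt Y \<Lambda>) Y n F \<Longrightarrow>
    ctl (negligible_wrt (X \<union> Y) \<Lambda>) (X \<union> Y) n F"
  by (rule ctl_Un[OF _ _ negligible_Un])

lemma ctl_negligible_subset:
  "ctl (negligible_wrt X \<Lambda>) X n F \<Longrightarrow> Y \<subseteq> X \<Longrightarrow> ctl (negligible_wrt Y \<Lambda>) Y n F"
  by (rule ctl_weaken[OF _ _ negligible_subset])

text \<open>Near the block ends the field is \<open>exp (- 1 / x)\<close> itself. Inside the blocks
  \<open>v (block x)\<close> lies below this flat function and has derivative 0, while the
  derivatives of \<open>inner\<close> grow only polynomially in \<open>1 / x\<close>.\<close>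

lemma ctl_negligible_base_field: "ctl (flat_on {0<..<1}) {0<..<1} n base_field"
proof -
  let ?I = "integer_zone \<inter> {0<..<1}" and ?W = "window 0 1 1"
  have LI: "1 / x \<ge> 1" if "x \<in> ?I" for x using that by auto
  have LW: "1 / x \<ge> 1" if "x \<in> ?W" for x using that window_1_subset[of 0 1] by auto
  have I: "ctl (flat_on ?I) ?I n base_field"
    by (rule ctl_cong[OF negligible_solid[OF LI] _ ctl_negligible_flat_exp[of _ n 0]])
      (auto simp: base_field_integer_zone intro: open_integer_zone)
  have S: "solid ?W (flat_on ?W)" by (rule negligible_solid[OF LW])
  have A: "algebra_class ?W (moderate ?W (\<lambda>x. 1 / x))" by (rule moderate_algebra[OF LW])
  have sub: "?W \<subseteq> window 0 1 0" by (rule window_mono) auto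
  have oW: "open ?W" by (rule open_window) auto
  have w: "ctl (flat_on ?W) ?W n (flat_exp 0)"
    by (rule ctl_negligible_flat_exp[OF oW window_1_subset])
  have v: "flat_on ?W (\<lambda>x. v (block x))"
  proof (rule solidD[OF S])
    show "flat_on ?W (flat_exp 0)" by (rule ctl_imp[OF w])
    fix x assume "x \<in> ?W"
    then have "v (block x) \<le> flat_exp 0 x" by (intro v_le_flat_exp) (simp add: window_def)
    then show "\<bar>v (block x)\<bar> \<le> \<bar>flat_exp 0 x\<bar>" using v_pos[of "block x"] by linarith
  qed
  have "ctl (flat_on ?W) ?W n (\<lambda>x. v (block x))"
    by (rule ctl_block_const_open[where c = v, OF S oW sub v])
  then have d: "ctl (flat_on ?W) ?W n (\<lambda>x. v (block x) - flat_exp 0 x)"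
    by (rule ctl_diff[OF S oW _ w])
  have m: "ctl (moderate ?W (\<lambda>x. 1 / x)) ?W n inner"
    unfolding inner_def
  proof (rule ctl_cutoff[OF A oW window_subset_pos])
    show "moderate ?W (\<lambda>x. 1 / x) (\<lambda>x. 1 / x)"
      by (rule moderateI[of _ _ 1 _ 1]) (simp add: window_def)
  qed
  have W: "ctl (flat_on ?W) ?W n base_field"
    unfolding base_field_def[abs_def]
  proof (rule ctl_add[OF S oW w ctl_mult[OF S oW _ d m]])
    show "flat_on ?W (\<lambda>x. F x * G x)"
      if "flat_on ?W F" "moderate ?W (\<lambda>x. 1 / x) G" for F G
      by (rule negligible_mult_moderate[OF LW that])
  qed
  show ?thesis
    by (rule ctl_negligible_subset[OF ctl_negligible_Un[OF I W] unit_interval_cover])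
qed

lemma Ck_base_field: "Ck_on n base_field {0..}"
  by (rule Ck_on_flat[OF smooth_base_field ctl_negligible_base_field base_field_0]) auto

lemma smooth_field_base: "smooth_field base_field (deriv0 base_field)"
proof
  show "continuous_on {0<..} base_field"
    by (rule continuous_on_subset[of "{0..}"]) (use Ck_base_field[of 0] in auto)
  show "base_field 0 = 0" by (rule base_field_0)
  show D: "(base_field has_real_derivative deriv0 base_field x) (at x within {0..})" if "x \<ge> 0" for x
  proof (rule DERIV_flat[OF _ ctl_imp[OF ctl_negligible_base_field] base_field_0 _ that])
    show "(base_field has_real_derivative deriv base_field x) (at x)" if "x > 0" for x
      using smooth_base_field[of 1] that by simp
  qed auto
  show "deriv0 base_field 0 = 0" by (simp add: deriv0_def)
  show "Ck_on n (deriv0 base_field) {0..}" for n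
  proof (rule Ck_on_flat[of _ _ 1])
    show "ctl (\<lambda>_. True) {0<..} (Suc n) (deriv0 base_field)"
      by (rule ctl_cong[OF algebra_solid[OF True_algebra], where F = "deriv base_field"])
        (use smooth_base_field[of "Suc (Suc n)"] in \<open>auto simp: deriv0_def\<close>)
    show "ctl (flat_on {0<..<1}) {0<..<1} n (deriv0 base_field)"
      by (rule ctl_cong[OF negligible_solid, where F = "deriv base_field"])
        (use ctl_negligible_base_field[of "Suc n"] in \<open>auto simp: deriv0_def\<close>)
  qed (auto simp: deriv0_def)
  fix x :: real assume x: "x > 0"
  show "base_field x > 0" by (rule base_field_pos[OF x])
  show "base_field x \<le> 2 * exp (- (1 / x))"
    using base_field_le[OF x] x by (simp add: flat_exp_def) (smt (verit) exp_gt_zero)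
qed

sublocale base: smooth_field base_field "deriv0 base_field"
  by (rule smooth_field_base)

section \<open>The ripple and the perturbed field\<close>

definition ripple :: "real \<Rightarrow> real" where
  "ripple x = v (block x) * outer x * cos (2 * pi * real (q (block x)) * base.time x)"

text \<open>The reciprocal is \<open>(1 + ripple x) / base_field x\<close>: division makes the
  travel time change additively, and a cosine in \<open>base.time\<close> then integrates explicitly
  to a sine.\<close>

definition field :: "real \<Rightarrow> real" where
  "field x = base_field x * inverse (1 + ripple x)"

lemma abs_ripple_le: "\<bar>ripple x\<bar> \<le> v (block x)"
proof -
  have "\<bar>ripple x\<bar> = v (block x) * (outer x * \<bar>cos (2 * pi * real (q (block x)) * base.time x)\<bar>)"
    using v_pos outer_range by (simp add: ripple_def abs_mult less_imp_le)
  also have "\<dots> \<le> v (block x) * (1 * 1)"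
    using v_pos outer_range by (intro mult_left_mono mult_mono) (auto simp: less_imp_le)
  finally show ?thesis by simp
qed

lemma ripple_bounds: "1 / 2 \<le> 1 + ripple x" "1 + ripple x \<le> 3 / 2"
  using abs_ripple_le[of x] v_le_half[of "block x"] by linarith+

lemma DERIV_phase:
  assumes "x \<in> window 0 1 0"
  shows "((\<lambda>x. 2 * pi * real (q (block x)) * base.time x) has_real_derivative
    2 * pi * real (q (block x)) * (1 / base_field x)) (at x)"
proof -
  have x: "x > 0" using assms by (simp add: window_def)
  have "((\<lambda>x. 2 * pi * real (q (block x)) * base.time x) has_real_derivative
     0 * base.time x + (1 / base_field x) * (2 * pi * real (q (block x)))) (at x)"
    by (rule DERIV_mult[OF DERIV_block_const[OF assms, of "\<lambda>k. 2 * pi * real (q k)"] base.DERIV_time[OF x]]) auto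
  then show ?thesis by (simp add: mult.commute)
qed

text \<open>One statement for the class of all functions and for the moderate functions in both
  scales. A class containing \<open>1 / x\<close>, \<open>q (block x)\<close> and
  \<open>1 / base_field x\<close> controls the derivative of the phase, which is all that
  \<open>ctl_sin_cos\<close> asks.\<close>

lemma ctl_field:
  assumes A: "algebra_class X P" and X: "open X" "X \<subseteq> window 0 1 0" and P: "P (\<lambda>x. 1 / x)"
    "P (\<lambda>x. real (q (block x)))" "P (\<lambda>x. inverse (base_field x))"
  shows "ctl P X n (\<lambda>x. inverse (base_field x))" "ctl P X n ripple"
    "ctl P X n field" "ctl P X n (\<lambda>x. inverse (field x))"
proof -
  note S = algebra_solid[OF A]
  have X0: "X \<subseteq> {0<..}" using X(2) window_subset_pos by blast
  have b: "P F" if "\<And>x. \<bar>F x\<bar> \<le> C" for F C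
    by (rule solidD[OF S algebra_const[OF A, of C]]) (use that in \<open>auto intro: order_trans[OF _ abs_ge_self]\<close>)
  have base: "ctl P X n base_field" for n by (rule ctl_base_field[OF A X P(1)])
  have ibase: "ctl P X n (\<lambda>x. inverse (base_field x))" for n
    by (rule ctl_inverse[OF A X(1) _ P(3) base]) (use base_field_pos X0 in \<open>force\<close>)
  then show "ctl P X n (\<lambda>x. inverse (base_field x))" .
  have "ctl P X n (\<lambda>x. 2 * pi * (real (q (block x)) * inverse (base_field x)))" for n
    by (rule ctl_cmult[OF A X(1) ctl_algebra_mult[OF A X(1) ctl_block_const_open[OF S X P(2)] ibase]])
  then have ph: "ctl P X n (\<lambda>x. 2 * pi * real (q (block x)) * (1 / base_field x))" for n
    by (simp add: inverse_eq_divide mult.assoc)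
  have D: "((\<lambda>x. 2 * pi * real (q (block x)) * base.time x) has_real_derivative
    2 * pi * real (q (block x)) * (1 / base_field x)) (at x)" if "x \<in> X" for x
    using DERIV_phase X(2) that by blast
  have co: "ctl P X n (\<lambda>x. cos (2 * pi * real (q (block x)) * base.time x))" for n
    using ctl_sin_cos[OF A X(1) D ph] by blast
  have "P (\<lambda>x. v (block x))"
    by (rule b[of _ "1/2"]) (use v_le_half v_pos in \<open>auto simp: abs_of_pos\<close>)
  then have vv: "ctl P X n (\<lambda>x. v (block x))" for n by (rule ctl_block_const_open[OF S X])
  have out: "ctl P X n outer" for n unfolding outer_def by (rule ctl_cutoff[OF A X(1) X0 P(1)])
  have rip: "ctl P X n ripple" for n
    unfolding ripple_def[abs_def]
    by (rule ctl_algebra_mult[OF A X(1) ctl_algebra_mult[OF A X(1) vv out] co])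
  then show "ctl P X n ripple" .
  have rip1: "ctl P X n (\<lambda>x. 1 + ripple x)" for n
    by (rule ctl_add[OF S X(1) ctl_const[OF A X(1)] rip])
  have pos: "1 + ripple x > 0" for x using ripple_bounds(1)[of x] by linarith
  have ir: "P (\<lambda>x. inverse (1 + ripple x))"
  proof (rule b[of _ 2])
    show "\<bar>inverse (1 + ripple x)\<bar> \<le> 2" for x
      using le_imp_inverse_le[OF ripple_bounds(1)[of x]] pos[of x] by simp
  qed
  have irip: "ctl P X n (\<lambda>x. inverse (1 + ripple x))" for n
    by (rule ctl_inverse[OF A X(1) _ ir rip1]) (use pos in \<open>auto simp: less_le\<close>)
  show "ctl P X n field"
    unfolding field_def[abs_def] by (rule ctl_algebra_mult[OF A X(1) base irip])
  have "ctl P X n (\<lambda>x. inverse (base_field x) * (1 + ripple x))"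
    by (rule ctl_algebra_mult[OF A X(1) ibase rip1])
  then show "ctl P X n (\<lambda>x. inverse (field x))" by (simp add: field_def)
qed

lemma ripple_integer_zone: "x \<in> integer_zone \<Longrightarrow> ripple x = 0"
  by (simp add: ripple_def outer_integer_zone)

lemma smooth_field_field: "ctl (\<lambda>_. True) {0<..} n field"
proof -
  have "ctl (\<lambda>_. True) integer_zone n field"
    by (rule ctl_cong[OF algebra_solid[OF True_algebra] open_integer_zone
          ctl_weaken[OF ctl_flat_exp[of n 0]]])
      (simp_all add: field_def base_field_integer_zone ripple_integer_zone)
  moreover have "ctl (\<lambda>_. True) (window 0 1 0) n field"
    by (rule ctl_field(3)[OF True_algebra open_window]) auto
  ultimately have "ctl (\<lambda>_. True) (integer_zone \<union> window 0 1 0) n field"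
    by (rule ctl_Un)
  then show ?thesis by (rule ctl_weaken[OF _ integer_zone_cover])
qed

lemma field_0: "field 0 = 0" by (simp add: field_def base_field_0)

lemma field_pos: "x > 0 \<Longrightarrow> field x > 0"
  using base_field_pos ripple_bounds(1)[of x] by (simp add: field_def)

lemma field_le: "x > 0 \<Longrightarrow> field x \<le> 2 * base_field x"
proof -
  assume x: "x > 0"
  have "inverse (1 + ripple x) \<le> 2"
    using le_imp_inverse_le[OF ripple_bounds(1)[of x]] by simp
  then have "base_field x * inverse (1 + ripple x) \<le> base_field x * 2"
    using base_field_pos[OF x] by (intro mult_left_mono) auto
  then show ?thesis by (simp add: field_def)
qed

text \<open>Only the theory of continuous fields is invoked here; smoothness of the perturbed flow
  at selected times comes from comparison with the base flow.\<close>

sublocale rippled: positive_field field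
proof
  show "continuous_on {0<..} field"
    using smooth_field_field[of 1] by (auto intro!: continuous_at_imp_continuous_on DERIV_isCont)
  fix x :: real assume x: "x > 0"
  show "field x \<le> 2 * exp (- (1 / x))"
    using field_le[OF x] base_field_le[OF x] x by (simp add: flat_exp_def)
qed (use field_0 field_pos in auto)

end

section \<open>Comparison of the two flows\<close>

lemma bounded_sequence:
  fixes a :: "nat \<Rightarrow> real"
  assumes "\<And>k. N \<le> k \<Longrightarrow> a k \<le> B"
  obtains C where "\<And>k. a k \<le> C"
proof
  fix k
  show "a k \<le> \<bar>B\<bar> + (\<Sum>i<N. \<bar>a i\<bar>)"
  proof (cases "k < N")
    case True
    then have "\<bar>a k\<bar> \<le> (\<Sum>i<N. \<bar>a i\<bar>)" by (intro member_le_sum) auto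
    then show ?thesis by linarith
  next
    case False
    then have "a k \<le> B" using assms by simp
    moreover have "0 \<le> (\<Sum>i<N. \<bar>a i\<bar>)" by (intro sum_nonneg) auto
    ultimately show ?thesis by linarith
  qed
qed

lemma abs_sin_diff_le: "\<bar>sin x - sin y\<bar> \<le> \<bar>x - (y::real)\<bar>"
  using field_differentiable_bound[of UNIV sin cos 1 x y] by (auto intro: DERIV_sin abs_cos_le_one)

lemma abs_cos_diff_le: "\<bar>cos x - cos y\<bar> \<le> \<bar>x - (y::real)\<bar>"
  using field_differentiable_bound[of UNIV cos "\<lambda>x. - sin x" 1 x y] by (auto intro: DERIV_cos abs_sin_le_one)

section \<open>Travel times of the two fields\<close>

context approximation_sequence
begin

lemma DERIV_time_difference:
  assumes "x > 0"
  shows "((\<lambda>x. rippled.time x - base.time x) has_real_derivative ripple x / base_field x) (at x)"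
proof -
  have "1 + ripple x \<noteq> 0" using ripple_bounds(1)[of x] by linarith
  then have "1 / field x - 1 / base_field x = ripple x / base_field x"
    using base_field_pos[OF assms] by (simp add: field_def field_simps)
  then show ?thesis
    using DERIV_diff[OF rippled.DERIV_time[OF assms] base.DERIV_time[OF assms]] by simp
qed

text \<open>The derivative \<open>ripple / base_field\<close> of the time difference is at most
  \<open>w\<close> times that of \<open>base.time\<close> in absolute value; \<open>s = 1\<close>
  and \<open>s = -1\<close> give the two inequalities.\<close>

lemma time_drift_le:
  assumes "0 < x" "x \<le> y" "\<And>u. x \<le> u \<Longrightarrow> u \<le> y \<Longrightarrow> \<bar>ripple u\<bar> \<le> w"
  shows "\<bar>rippled.time y - rippled.time x - (base.time y - base.time x)\<bar> \<le> w * (base.time y - base.time x)"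
proof -
  have "w * base.time x + s * (rippled.time x - base.time x) \<le> w * base.time y + s * (rippled.time y - base.time y)"
    if "\<bar>s\<bar> \<le> 1" for s
  proof (rule DERIV_nonneg_imp_nondecreasing[OF assms(2)])
    fix u assume u: "x \<le> u" "u \<le> y"
    then have u0: "u > 0" using assms(1) by simp
    have "\<bar>s * ripple u\<bar> \<le> 1 * w"
      unfolding abs_mult using that assms(3)[OF u] by (intro mult_mono) auto
    then have "0 \<le> (w + s * ripple u) / base_field u"
      using base_field_pos[OF u0] by (intro divide_nonneg_pos) linarith+
    moreover have "((\<lambda>u. w * base.time u + s * (rippled.time u - base.time u)) has_real_derivative
        w * (1 / base_field u) + s * (ripple u / base_field u)) (at u)"
      by (intro DERIV_add DERIV_cmult base.DERIV_time DERIV_time_difference u0)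
    ultimately show "\<exists>D. ((\<lambda>u. w * base.time u + s * (rippled.time u - base.time u)) has_real_derivative D) (at u) \<and> 0 \<le> D"
      by (intro exI[of _ "w * (1 / base_field u) + s * (ripple u / base_field u)"]) (simp add: add_divide_distrib)
  qed
  from this[of 1] this[of "-1"] show ?thesis by (simp add: algebra_simps abs_le_iff)
qed

lemma time_drift:
  assumes "0 < x" "0 < y" "\<And>u. u \<in> closed_segment x y \<Longrightarrow> \<bar>ripple u\<bar> \<le> w"
  shows "\<bar>rippled.time y - rippled.time x - (base.time y - base.time x)\<bar> \<le> w * \<bar>base.time y - base.time x\<bar>"
proof (cases "x \<le> y")
  case True
  then have "base.time x \<le> base.time y"
    using base.time_less_iff[of y x] assms by (simp add: not_less[symmetric])
  then show ?thesis
    using time_drift_le[OF assms(1) True, of w] assms(3) True by (simp add: closed_segment_eq_real_ivl)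
next
  case False
  then have "base.time y \<le> base.time x"
    using base.time_less_iff[of x y] assms by (simp add: not_less[symmetric])
  then show ?thesis
    using time_drift_le[OF assms(2), of x w] assms(3) False by (simp add: closed_segment_eq_real_ivl)
qed

lemma base_time_le:
  assumes "0 < x" "0 < y"
  shows "\<bar>base.time y - base.time x\<bar> \<le> 2 * \<bar>rippled.time y - rippled.time x\<bar>"
proof -
  have "\<bar>ripple u\<bar> \<le> 1 / 2" for u
    using abs_ripple_le[of u] v_le_half[of "block u"] by linarith
  then have "\<bar>rippled.time y - rippled.time x - (base.time y - base.time x)\<bar> \<le> 1 / 2 * \<bar>base.time y - base.time x\<bar>"
    by (intro time_drift assms)
  then show ?thesis by (auto simp: abs_if split: if_splits)
qed

text \<open>The base field is at most 1, so errors in base time bound errors in position.\<close>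

lemma distance_le_base_time:
  assumes "0 < x" "0 < y"
  shows "\<bar>y - x\<bar> \<le> \<bar>base.time y - base.time x\<bar>"
proof -
  have mono: "base.time x - x \<le> base.time y - y" if "0 < x" "x \<le> y" for x y
  proof (rule DERIV_nonneg_imp_nondecreasing[OF that(2)])
    fix u assume "x \<le> u"
    then have u0: "u > 0" using that by simp
    have "1 / base_field u - 1 \<ge> 0" using base_field_le_1[OF u0] base_field_pos[OF u0] by simp
    moreover have "((\<lambda>u. base.time u - u) has_real_derivative 1 / base_field u - 1) (at u)"
      by (intro DERIV_diff base.DERIV_time u0 DERIV_ident)
    ultimately show "\<exists>D. ((\<lambda>u. base.time u - u) has_real_derivative D) (at u) \<and> 0 \<le> D" by blast
  qed
  show ?thesis
    using mono[OF assms(1), of y] mono[OF assms(2), of x] by linarith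
qed

text \<open>Where \<open>outer = 1\<close>, the rippled time is obtained from \<open>base.time\<close> by a
  \<open>1 / q k\<close>-periodic change of variable.\<close>

lemma time_resonance:
  assumes "0 < x" "0 < y"
    and seg: "\<And>u. u \<in> closed_segment x y \<Longrightarrow> u \<in> window 0 1 0 \<and> block u = k \<and> outer u = 1"
  shows "rippled.time y - rippled.time x = base.time y - base.time x +
    v k / (2 * pi * real (q k)) * (sin (2 * pi * real (q k) * base.time y) - sin (2 * pi * real (q k) * base.time x))"
proof -
  define a where "a = 2 * pi * real (q k)"
  have a: "a > 0" using q_pos(1)[of k] by (simp add: a_def)
  let ?g = "\<lambda>u. rippled.time u - base.time u - v k / a * sin (a * base.time u)"
  have "?g y = ?g x"
  proof (rule DERIV_zero_segment[where g = ?g])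
    fix u assume "u \<in> closed_segment x y"
    from seg[OF this] have u: "u > 0" "block u = k" "outer u = 1" by (auto simp: window_def)
    have "((\<lambda>u. sin (a * base.time u)) has_real_derivative cos (a * base.time u) * (a * (1 / base_field u))) (at u)"
      by (intro DERIV_chain2[OF DERIV_sin] DERIV_cmult base.DERIV_time u)
    then have D: "(?g has_real_derivative ripple u / base_field u - v k / a * (cos (a * base.time u) * (a * (1 / base_field u)))) (at u)"
      by (intro DERIV_diff DERIV_time_difference u DERIV_cmult)
    have "ripple u / base_field u - v k / a * (cos (a * base.time u) * (a * (1 / base_field u))) = 0"
      using u a q_pos(1)[of k] by (simp add: ripple_def a_def)
    with D show "(?g has_real_derivative 0) (at u)" by (simp only:)
  qed
  then show ?thesis unfolding a_def by (simp add: algebra_simps)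
qed

text \<open>One margin serves all windows. Enlarged by \<open>1 / 60\<close>,
  \<open>(1/5, 4/5)\<close> stays where \<open>outer = 1\<close>, \<open>(1/20, 9/40)\<close> and
  \<open>(31/40, 19/20)\<close> stay where \<open>inner = 0\<close>, and
  \<open>(29/60, 31/60)\<close> stays where \<open>inner = 1\<close>; moreover
  \<open>1/15 + 1/60 = 1/12\<close> is a radius around the integers within which
  \<open>outer = 0\<close>.\<close>

definition tame :: "real \<Rightarrow> nat \<Rightarrow> bool" where
  "tame t K \<longleftrightarrow> (\<forall>x. 0 < x \<longrightarrow> K \<le> block x \<longrightarrow>
     \<bar>1 / rippled.flow t x - 1 / x\<bar> \<le> 1 / 60 \<and> \<bar>1 / base.flow t x - 1 / x\<bar> \<le> 1 / 60)"

lemma ex_tame: "\<exists>K\<ge>1. tame t K"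
proof -
  obtain K1 where K1: "\<And>x y. 0 < x \<Longrightarrow> K1 \<le> block x \<Longrightarrow> 0 < y \<Longrightarrow>
      \<bar>rippled.time y - rippled.time x\<bar> \<le> \<bar>t\<bar> \<Longrightarrow> \<bar>1 / y - 1 / x\<bar> \<le> 1 / 60"
    by (rule rippled.small_displacement[of "1 / 60" "\<bar>t\<bar>"]) auto
  obtain K2 where K2: "\<And>x y. 0 < x \<Longrightarrow> K2 \<le> block x \<Longrightarrow> 0 < y \<Longrightarrow>
      \<bar>base.time y - base.time x\<bar> \<le> \<bar>t\<bar> \<Longrightarrow> \<bar>1 / y - 1 / x\<bar> \<le> 1 / 60"
    by (rule base.small_displacement[of "1 / 60" "\<bar>t\<bar>"]) auto
  have "tame t (max 1 (max K1 K2))"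
    unfolding tame_def
    using K1[OF _ _ rippled.flow_pos] K2[OF _ _ base.flow_pos] rippled.time_flow base.time_flow by simp
  then show ?thesis by (intro exI[of _ "max 1 (max K1 K2)"]) simp
qed

lemma segment_window:
  assumes "tame t K" "x \<in> window a b K" "1 / 60 \<le> a" "b \<le> 59 / 60"
    and u: "u \<in> closed_segment x (rippled.flow t x)"
  shows "u \<in> window (a - 1 / 60) (b + 1 / 60) K" "block u = block x"
proof -
  have x: "0 < x" "K \<le> block x" using assms(2) by (auto simp: window_def)
  have d: "\<bar>1 / u - 1 / x\<bar> \<le> 1 / 60" "0 < u"
  proof -
    have "\<bar>1 / rippled.flow t x - 1 / x\<bar> \<le> 1 / 60" using assms(1) x unfolding tame_def by simp
    then show "\<bar>1 / u - 1 / x\<bar> \<le> 1 / 60" "0 < u"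
      using between_inverse[OF x(1) rippled.flow_pos[OF x(1)] u] by linarith+
  qed
  have ab: "0 \<le> a - 1 / 60" "b + 1 / 60 \<le> 1" using assms(3,4) by linarith+
  show "u \<in> window (a - 1 / 60) (b + 1 / 60) K" "block u = block x"
    using window_move[OF assms(2) d(2,1) ab] .
qed

lemma inverse_le_q: "x > 0 \<Longrightarrow> 1 / x \<le> real (q (block x))"
  using block_bounds(2)[of x] q_ge_block[of "block x"] by linarith

text \<open>The argument common to both scales: if \<open>L\<close> dominates \<open>q k\<close> and
  the reciprocal of the base field on the slightly larger window into which both flows map, all
  derivatives of both flows are moderate. Interpolation then spreads negligibility from the
  difference to its derivatives, and \<open>1 / x \<le> L (block x)\<close> turns it into flatness
  at 0.\<close>

lemma ctl_flow_difference:
  assumes ab: "1 / 60 \<le> a" "a < b" "b \<le> 59 / 60" and K: "1 \<le> K" "tame t K"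
    and L: "\<And>k. real (q k) \<le> L k"
    and base: "\<And>x. x \<in> window (a - 1 / 60) (b + 1 / 60) K \<Longrightarrow> inverse (base_field x) \<le> L (block x)"
    and neg: "negligible_wrt (window a b K) (\<lambda>x. L (block x)) (\<lambda>x. rippled.flow t x - base.flow t x)"
  shows "ctl (flat_on (window a b K)) (window a b K) n (\<lambda>x. rippled.flow t x - base.flow t x)"
proof -
  define X Y where "X = window a b K" and "Y = window (a - 1 / 60) (b + 1 / 60) K"
  define \<Lambda> where "\<Lambda> x = L (block x)" for x
  have ab': "0 \<le> a - 1 / 60" "b + 1 / 60 \<le> 1" "0 \<le> a" "b \<le> 1" using ab by linarith+
  have X: "open X" "X \<subseteq> window 0 1 0" "X \<subseteq> {0<..}"
    unfolding X_def by (rule open_window window_mono window_subset_pos ab' le0)+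
  have Y: "open Y" "Y \<subseteq> window 0 1 0"
    unfolding Y_def by (rule open_window window_mono ab' le0)+
  have XY: "X \<subseteq> Y" unfolding X_def Y_def by (rule window_mono) simp_all
  have L1: "\<Lambda> x \<ge> 1" for x using L[of "block x"] q_pos(2)[of "block x"] by (simp add: \<Lambda>_def)
  have AX: "algebra_class X (moderate X \<Lambda>)" and AY: "algebra_class Y (moderate Y \<Lambda>)"
    by (rule moderate_algebra, rule L1)+
  have mq: "moderate Z \<Lambda> (\<lambda>x. real (q (block x)))" for Z
    by (rule moderateI[of _ _ 1 _ 1]) (simp add: L \<Lambda>_def)
  have mi: "moderate Z \<Lambda> (\<lambda>x. 1 / x)" if "Z \<subseteq> Y" for Z
  proof (rule moderateI[of _ _ 1 _ 1])
    fix x assume "x \<in> Z"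
    then have "x > 0" using that Y(2) by (auto simp: window_def)
    then show "\<bar>1 / x\<bar> \<le> 1 * \<Lambda> x ^ 1" using inverse_le_q[of x] L[of "block x"] by (simp add: \<Lambda>_def)
  qed
  have mb: "moderate Z \<Lambda> (\<lambda>x. inverse (base_field x))" if "Z \<subseteq> Y" for Z
  proof (rule moderateI[of _ _ 1 _ 1])
    fix x assume x: "x \<in> Z"
    then have "x > 0" using that Y(2) by (auto simp: window_def)
    then show "\<bar>inverse (base_field x)\<bar> \<le> 1 * \<Lambda> x ^ 1"
      using base[of x] x that base_field_pos[of x] by (auto simp: Y_def \<Lambda>_def)
  qed
  have maps: "f x \<in> Y \<and> \<Lambda> (f x) = \<Lambda> x" if "f = rippled.flow t \<or> f = base.flow t" "x \<in> X" for f x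
  proof -
    have x: "0 < x" "K \<le> block x" using that(2) by (auto simp: X_def window_def)
    have "0 < f x" "\<bar>1 / f x - 1 / x\<bar> \<le> 1 / 60"
      using that(1) K(2) x rippled.flow_pos base.flow_pos unfolding tame_def by auto
    then show ?thesis using window_move[of x a b K "f x" "1/60"] that(2) ab by (auto simp: X_def Y_def \<Lambda>_def)
  qed
  have pull: "moderate X \<Lambda> (\<lambda>x. G (f x))" if f: "f = rippled.flow t \<or> f = base.flow t" and G: "moderate Y \<Lambda> G" for f G
  proof -
    obtain C c where C: "\<And>y. y \<in> Y \<Longrightarrow> \<bar>G y\<bar> \<le> C * \<Lambda> y ^ c" using moderateE[OF G L1] by metis
    show ?thesis
    proof (rule moderateI)
      fix x assume "x \<in> X"
      then show "\<bar>G (f x)\<bar> \<le> C * \<Lambda> x ^ c" using C[of "f x"] maps[OF f, of x] by simp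
    qed
  qed
  have bdd: "moderate X \<Lambda> f" if f: "f = rippled.flow t \<or> f = base.flow t" for f
  proof (rule moderateI[of _ _ 1 _ 0])
    fix x assume "x \<in> X"
    then have "f x \<in> window (a - 1 / 60) (b + 1 / 60) 1"
      using maps[OF f] K(1) unfolding Y_def by (force simp: window_def)
    then show "\<bar>f x\<bar> \<le> 1 * \<Lambda> x ^ 0" using window_1_subset by fastforce
  qed
  have rip: "ctl (moderate X \<Lambda>) X n (rippled.flow t)" for n
  proof (rule ctl_flow[OF AX X(1), where Q = "moderate Y \<Lambda>" and Y = Y and \<mu> = field and \<rho> = "\<lambda>x. inverse (field x)"])
    show "ctl (moderate Y \<Lambda>) Y n field" for n by (rule ctl_field(3)[OF AY Y mi mq mb]) simp_all
    show "ctl (moderate X \<Lambda>) X n (\<lambda>x. inverse (field x))" for n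
      by (rule ctl_field(4)[OF AX X(1,2) mi[OF XY] mq mb[OF XY]])
    show "(rippled.flow t has_real_derivative field (rippled.flow t x) * inverse (field x)) (at x)" if "x \<in> X" for x
      using rippled.DERIV_flow[of x t] that X(3) by (auto simp: inverse_eq_divide)
  qed (use pull maps bdd in auto)
  have bas: "ctl (moderate X \<Lambda>) X n (base.flow t)" for n
  proof (rule ctl_flow[OF AX X(1), where Q = "moderate Y \<Lambda>" and Y = Y and \<mu> = base_field and \<rho> = "\<lambda>x. inverse (base_field x)"])
    show "ctl (moderate Y \<Lambda>) Y n base_field" for n by (rule ctl_base_field[OF AY Y mi]) simp
    show "ctl (moderate X \<Lambda>) X n (\<lambda>x. inverse (base_field x))" for n
      by (rule ctl_field(1)[OF AX X(1,2) mi[OF XY] mq mb[OF XY]])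
    show "(base.flow t has_real_derivative base_field (base.flow t x) * inverse (base_field x)) (at x)" if "x \<in> X" for x
      using base.DERIV_flow[of x t] that X(3) by (auto simp: inverse_eq_divide)
  qed (use pull maps bdd in auto)
  have "ctl (moderate X \<Lambda>) X (Suc n) (\<lambda>x. rippled.flow t x - base.flow t x)"
    by (rule ctl_diff[OF algebra_solid[OF AX] X(1) rip bas])
  then have "ctl (negligible_wrt X \<Lambda>) X n (\<lambda>x. rippled.flow t x - base.flow t x)"
  proof (rule negligible_ctl[rotated 3])
    show "negligible_wrt X \<Lambda> (\<lambda>x. rippled.flow t x - base.flow t x)"
      using neg unfolding X_def \<Lambda>_def .
    show "(b - a) / 4 > 0" using ab by simp
    fix x h assume x: "x \<in> X" and h: "0 < h" "h \<le> (b - a) / 4 / \<Lambda> x"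
    have sq: "real (block x + 1) ^ 2 \<le> L (block x)" using q_square L by (rule order_trans)
    show "(\<forall>y\<in>{x..x+h}. y \<in> X \<and> \<Lambda> y = \<Lambda> x) \<or> (\<forall>y\<in>{x-h..x}. y \<in> X \<and> \<Lambda> y = \<Lambda> x)"
      unfolding X_def \<Lambda>_def
      by (rule window_thick) (use ab x h K(1) sq in \<open>simp_all add: X_def \<Lambda>_def\<close>)
  qed (rule L1)
  then show ?thesis
    unfolding X_def[symmetric]
  proof (rule ctl_weaken)
    fix F assume F: "negligible_wrt X \<Lambda> F"
    show "flat_on X F" unfolding negligible_wrt_def
    proof
      fix N obtain C where C: "\<forall>x\<in>X. \<bar>F x\<bar> * \<Lambda> x ^ N \<le> C" using F unfolding negligible_wrt_def by blast
      have "\<bar>F x\<bar> * (1 / x) ^ N \<le> C" if x: "x \<in> X" for x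
      proof -
        have "x > 0" using x X(3) by auto
        then have "1 / x \<le> \<Lambda> x" using inverse_le_q[of x] L[of "block x"] by (simp add: \<Lambda>_def)
        then have "\<bar>F x\<bar> * (1 / x) ^ N \<le> \<bar>F x\<bar> * \<Lambda> x ^ N"
          using \<open>x > 0\<close> by (intro mult_left_mono power_mono) auto
        then show ?thesis using C x by fastforce
      qed
      then show "\<exists>C. \<forall>x\<in>X. \<bar>F x\<bar> * (1 / x) ^ N \<le> C" by blast
    qed
  qed simp
qed

text \<open>For each \<open>N\<close> only the finitely many blocks \<open>k < N\<close> escape the
  hypothesis on \<open>e\<close>, and they merely enlarge the constant.\<close>

lemma negligible_block_sequence:
  assumes "\<And>x. x \<in> X \<Longrightarrow> \<bar>F x\<bar> \<le> B * e (block x)" "B \<ge> 0" "\<And>k. L k \<ge> (1::real)"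
    "\<And>N k. N \<le> k \<Longrightarrow> e k * L k ^ N \<le> 1"
  shows "negligible_wrt X (\<lambda>x. L (block x)) F"
  unfolding negligible_wrt_def
proof
  fix N
  obtain C where C: "\<And>k. e k * L k ^ N \<le> C"
    using bounded_sequence[of N "\<lambda>k. e k * L k ^ N" 1] assms(4) by metis
  have "\<bar>F x\<bar> * L (block x) ^ N \<le> B * C" if "x \<in> X" for x
  proof -
    have "\<bar>F x\<bar> * L (block x) ^ N \<le> B * e (block x) * L (block x) ^ N"
      using assms(1)[OF that] assms(3)[of "block x"] by (intro mult_right_mono) auto
    also have "\<dots> \<le> B * C" using mult_left_mono[OF C assms(2)] by (simp add: mult.assoc)
    finally show ?thesis .
  qed
  then show "\<exists>C. \<forall>x\<in>X. \<bar>F x\<bar> * L (block x) ^ N \<le> C" by blast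
qed

lemma flow_difference_le:
  assumes "x > 0"
  shows "\<bar>rippled.flow t x - base.flow t x\<bar> \<le> \<bar>base.time (rippled.flow t x) - base.time x - t\<bar>"
  using distance_le_base_time[OF base.flow_pos[OF assms] rippled.flow_pos[OF assms], of t t]
    base.time_flow[OF assms, of t] by (simp add: algebra_simps)

text \<open>The scale is \<open>1 / v k\<close>, which bounds the reciprocal of the base field.
  Resonance reduces the error in base time to the distance of \<open>t\<close> from
  \<open>\<int> / q k\<close>, and \<open>c_small\<close> beats any fixed power of
  \<open>1 / v k\<close>.\<close>

lemma ctl_flow_difference_inner:
  assumes "1 \<le> K" "tame t K" "\<And>k. near t k"
  shows "ctl (flat_on (window (1/5) (4/5) K)) (window (1/5) (4/5) K) n
    (\<lambda>x. rippled.flow t x - base.flow t x)"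
proof (rule ctl_flow_difference[where L = "\<lambda>k. real (q k) ^ (k + 1)"])
  show "real (q k) \<le> real (q k) ^ (k + 1)" for k
    using power_increasing[of 1 "k + 1" "real (q k)"] q_pos(2)[of k] by simp
  show "inverse (base_field x) \<le> real (q (block x)) ^ (block x + 1)"
    if "x \<in> window (1/5 - 1/60) (4/5 + 1/60) K" for x
  proof -
    have "x > 0" using that by (simp add: window_def)
    from le_imp_inverse_le[OF base_field_ge[OF this] v_pos] show ?thesis by (simp add: v_def)
  qed
  show "negligible_wrt (window (1/5) (4/5) K) (\<lambda>x. real (q (block x)) ^ (block x + 1))
     (\<lambda>x. rippled.flow t x - base.flow t x)"
  proof (rule negligible_block_sequence[where e = "\<lambda>k. \<bar>c k\<bar>" and B = 4 and L = "\<lambda>k. real (q k) ^ (k + 1)"])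
    fix x assume x: "x \<in> window (1/5) (4/5) K"
    define k y where "k = block x" and "y = rippled.flow t x"
    have x0: "x > 0" using x by (simp add: window_def)
    have y0: "y > 0" unfolding y_def by (rule rippled.flow_pos[OF x0])
    obtain m :: int where m: "\<bar>t - of_int m / real (q k)\<bar> \<le> 4 * \<bar>c k\<bar>"
      using assms(3)[of k] unfolding near_def by blast
    define e where "e = t - of_int m / real (q k)"
    define D where "D = base.time y - base.time x - t"
    define a where "a = 2 * pi * real (q k)"
    have a: "a > 0" using q_pos(1)[of k] by (simp add: a_def)
    have "u \<in> window 0 1 0 \<and> block u = k \<and> outer u = 1" if "u \<in> closed_segment x y" for u
    proof -
      have w: "u \<in> window (1/5 - 1/60) (4/5 + 1/60) K" "block u = k"
        using segment_window[OF assms(2) x _ _ that[unfolded y_def]] by (auto simp: k_def)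
      moreover have "window (1/5 - 1/60) (4/5 + 1/60) K \<subseteq> window 0 1 0"
        by (rule window_mono) auto
      moreover have "1 / 6 \<le> frac (1 / u)" "frac (1 / u) \<le> 5 / 6"
        using w(1) unfolding window_def mem_Collect_eq by linarith+
      ultimately show ?thesis using outer_1[of u] by blast
    qed
    from time_resonance[OF x0 y0 this]
    have "t = base.time y - base.time x + v k / a * (sin (a * base.time y) - sin (a * base.time x))"
      using rippled.time_flow[OF x0, of t] by (simp add: y_def a_def)
    then have D: "D = - (v k / a * (sin (a * base.time y) - sin (a * base.time x)))"
      by (simp add: D_def)
    \<comment> \<open>A time \<open>m / q k\<close> is a whole number of periods, so the two sines
      differ only through \<open>e + D\<close>. The resulting
      \<open>\<bar>D\<bar> \<le> \<bar>e + D\<bar> / 2\<close> has \<open>D\<close> on both sides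
      and forces \<open>\<bar>D\<bar> \<le> \<bar>e\<bar>\<close>.\<close>
    have "a * base.time y = a * base.time x + a * (e + D) + of_int m * (2 * pi)"
      using q_pos(1)[of k] by (simp add: D_def e_def a_def field_simps)
    then have "sin (a * base.time y) = sin (a * base.time x + a * (e + D))"
      using sin.plus_of_int[of "a * base.time x + a * (e + D)" m] by simp
    then have "\<bar>sin (a * base.time y) - sin (a * base.time x)\<bar> \<le> a * \<bar>e + D\<bar>"
      using abs_sin_diff_le[of "a * base.time x + a * (e + D)" "a * base.time x"] a by (simp add: abs_mult)
    then have "\<bar>D\<bar> \<le> v k / a * (a * \<bar>e + D\<bar>)"
      unfolding D abs_minus_cancel abs_mult using a v_pos[of k] by (intro mult_mono) auto
    also have "\<dots> = v k * \<bar>e + D\<bar>" using a by simp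
    also have "\<dots> \<le> 1 / 2 * \<bar>e + D\<bar>" using v_le_half by (intro mult_right_mono) auto
    finally have "\<bar>D\<bar> \<le> \<bar>e\<bar>" by (auto simp: abs_if split: if_splits)
    then show "\<bar>rippled.flow t x - base.flow t x\<bar> \<le> 4 * \<bar>c (block x)\<bar>"
      using flow_difference_le[OF x0, of t] m unfolding D_def e_def y_def k_def by linarith
  next
    show "1 \<le> real (q k) ^ (k + 1)" for k using q_pos(2)[of k] by (rule one_le_power)
    fix N k :: nat assume "N \<le> k"
    then have "(k + 1) * N \<le> (k + 1) * (k + 2)" by (intro mult_le_mono2) simp
    then have "real (q k) ^ ((k + 1) * N) \<le> real (q k) ^ ((k + 1) * (k + 2))"
      using q_pos(2)[of k] by (rule power_increasing)
    then have "\<bar>c k\<bar> * real (q k) ^ ((k + 1) * N) \<le> 1 / real (q k) ^ ((k + 1) * (k + 2)) * real (q k) ^ ((k + 1) * (k + 2))"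
      using c_small[of k] q_pos(1)[of k] by (intro mult_mono) auto
    also have "\<dots> = 1" using q_pos(1)[of k] by simp
    finally show "\<bar>c k\<bar> * (real (q k) ^ (k + 1)) ^ N \<le> 1" by (simp only: power_mult)
  qed auto
qed (use assms in auto)

text \<open>With \<open>inner = 0\<close> the base field is at least \<open>1 / q k\<close>, so the
  scale drops to \<open>q k\<close>. In this scale even the crude drift
  \<open>2 * \<bar>t\<bar> * v k\<close> is negligible, the exponent \<open>k + 1\<close> in
  \<open>v k\<close> exceeding any fixed \<open>N\<close>.\<close>

lemma ctl_flow_difference_outer:
  assumes K: "1 \<le> K" "tame t K" and ab: "1 / 60 \<le> a" "a < b" "b \<le> 59 / 60"
    and side: "b + 1 / 60 \<le> 1 / 4 \<or> 3 / 4 \<le> a - 1 / 60"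
  shows "ctl (flat_on (window a b K)) (window a b K) n
    (\<lambda>x. rippled.flow t x - base.flow t x)"
proof (rule ctl_flow_difference[where L = "\<lambda>k. real (q k)"])
  show "inverse (base_field x) \<le> real (q (block x))" if "x \<in> window (a - 1/60) (b + 1/60) K" for x
  proof -
    have x: "x > 0" using that by (simp add: window_def)
    have "inner x = 0" using that side by (intro inner_0) (auto simp: window_def)
    then have "1 / real (q (block x)) \<le> base_field x"
      using inverse_q_le_flat_exp[OF x] by (simp add: base_field_def)
    from le_imp_inverse_le[OF this] show ?thesis using q_pos by simp
  qed
  show "negligible_wrt (window a b K) (\<lambda>x. real (q (block x))) (\<lambda>x. rippled.flow t x - base.flow t x)"
  proof (rule negligible_block_sequence[where e = v and B = "2 * \<bar>t\<bar>" and L = "\<lambda>k. real (q k)"])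
    fix x assume x: "x \<in> window a b K"
    define y where "y = rippled.flow t x"
    have x0: "x > 0" using x by (simp add: window_def)
    have y0: "y > 0" unfolding y_def by (rule rippled.flow_pos[OF x0])
    have T: "rippled.time y - rippled.time x = t" using rippled.time_flow[OF x0, of t] by (simp add: y_def)
    have "\<bar>ripple u\<bar> \<le> v (block x)" if "u \<in> closed_segment x y" for u
      using abs_ripple_le[of u] segment_window(2)[OF K(2) x _ _ that[unfolded y_def]] ab by simp
    from time_drift[OF x0 y0 this]
    have "\<bar>t - (base.time y - base.time x)\<bar> \<le> v (block x) * \<bar>base.time y - base.time x\<bar>" unfolding T by simp
    also have "\<dots> \<le> v (block x) * (2 * \<bar>t\<bar>)"
      using base_time_le[OF x0 y0] v_pos unfolding T by (intro mult_left_mono) (auto simp: less_imp_le)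
    finally have "\<bar>base.time y - base.time x - t\<bar> \<le> 2 * \<bar>t\<bar> * v (block x)" by (simp add: abs_minus_commute mult.commute)
    then show "\<bar>rippled.flow t x - base.flow t x\<bar> \<le> 2 * \<bar>t\<bar> * v (block x)"
      using flow_difference_le[OF x0, of t] unfolding y_def by linarith
  next
    fix N k :: nat assume "N \<le> k"
    then have "real (q k) ^ N \<le> real (q k) ^ (k + 1)" using q_pos(2)[of k] by (intro power_increasing) auto
    then show "v k * real (q k) ^ N \<le> 1" using q_pos(1)[of k] by (simp add: v_def divide_le_eq)
  qed (use q_pos in auto)
qed (use K ab in auto)

text \<open>The whole orbit segment stays within \<open>1/15 + 1/60 = 1/12\<close> of an integer in
  the coordinate \<open>1 / x\<close>. The ripple vanishes there, so both travel times
  agree.\<close>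

lemma flow_eq_near_integer:
  assumes "tame t K" "0 < x" "K \<le> block x" "frac (1 / x) < 1 / 15 \<or> frac (1 / x) > 14 / 15"
  shows "rippled.flow t x = base.flow t x"
proof -
  define n where "n = (if frac (1 / x) < 1 / 15 then \<lfloor>1 / x\<rfloor> else \<lfloor>1 / x\<rfloor> + 1)"
  have n: "\<bar>1 / x - of_int n\<bar> \<le> 1 / 15"
    using assms(4) frac_ge_0[of "1 / x"] frac_lt_1[of "1 / x"]
    unfolding n_def frac_def by (auto simp: abs_le_iff)
  define y where "y = rippled.flow t x"
  have y0: "y > 0" unfolding y_def by (rule rippled.flow_pos[OF assms(2)])
  have "\<bar>ripple u\<bar> \<le> 0" if "u \<in> closed_segment x y" for u
  proof -
    have "\<bar>1 / u - 1 / x\<bar> \<le> \<bar>1 / y - 1 / x\<bar>" by (rule between_inverse[OF assms(2) y0 that])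
    also have "\<dots> \<le> 1 / 60" using assms unfolding tame_def y_def by blast
    finally have "outer u = 0" using n by (intro outer_0_near_integer[of u n]) linarith
    then show ?thesis by (simp add: ripple_def)
  qed
  from time_drift[OF assms(2) y0 this] have "base.time y = base.time x + t"
    using rippled.time_flow[OF assms(2), of t] by (simp add: y_def)
  then show ?thesis using base.flow_eqI[OF assms(2) y0] by (simp add: y_def)
qed

lemma smooth_on_flow_difference:
  assumes "\<And>k. near t k"
  shows "Ck_on n (\<lambda>x. rippled.flow t x - base.flow t x) {0..}"
proof -
  obtain K where K: "1 \<le> K" "tame t K" using ex_tame by blast
  define r where "r = 1 / real (Suc K)"
  let ?d = "\<lambda>x. rippled.flow t x - base.flow t x"
  \<comment> \<open>The zones have to be open and therefore overlap: \<open>Z\<close> contains the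
    points with fractional part up to \<open>1/20\<close> or from \<open>19/20\<close> on and stays
    within \<open>1/15\<close> of the integers, while the switching windows reach from
    \<open>1/20\<close> past \<open>1/5\<close> and symmetrically.\<close>
  define Z where "Z = {x. 0 < x \<and> cos (2 * pi / x) > cos (2 * pi / 15)} \<inter> {0<..<r}"
  define W where "W = window (1/5) (4/5) K \<union> (window (1/20) (9/40) K \<union> window (31/40) (19/20) K)"
  have blk: "K \<le> block x" if "x \<in> {0<..<r}" for x
    using block_tendsto[of x K] that by (simp add: r_def)
  have r: "0 < r" "r \<le> 1" by (auto simp: r_def)
  have "ctl (flat_on W) W n ?d"
    unfolding W_def
    by (intro ctl_negligible_Un ctl_flow_difference_inner ctl_flow_difference_outer K assms) auto
  moreover have "ctl (flat_on Z) Z n ?d"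
  proof -
    have ZL: "1 / x \<ge> 1" if "x \<in> Z" for x using that r by (auto simp: Z_def)
    have S: "solid Z (flat_on Z)" by (rule negligible_solid[OF ZL])
    have oZ: "open Z" unfolding Z_def by (intro open_Int open_cos_inverse open_greaterThanLessThan)
    have z: "?d x = 0" if "x \<in> Z" for x
    proof -
      have x: "0 < x" "K \<le> block x" "cos (2 * pi / x) > cos (2 * pi / 15)" using that blk by (auto simp: Z_def)
      have "frac (1 / x) < 1 / 15 \<or> frac (1 / x) > 14 / 15"
        using cos_frac_le[of "1/15" x] x(3) by (force simp: not_less)
      then show ?thesis using flow_eq_near_integer[OF K(2) x(1,2)] by simp
    qed
    have n0: "flat_on Z (\<lambda>_. 0)"
      by (auto simp: negligible_wrt_def)
    have "ctl (flat_on Z) Z n (\<lambda>_. 0)"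
      by (rule ctl_locally_const[OF S oZ n0 n0]) simp
    then show ?thesis by (rule ctl_cong[OF S oZ]) (use z in simp)
  qed
  ultimately have "ctl (flat_on (W \<union> Z)) (W \<union> Z) n ?d"
    by (rule ctl_negligible_Un)
  moreover have "{0<..<r} \<subseteq> W \<union> Z"
  proof
    fix x assume x: "x \<in> {0<..<r}"
    define s where "s = frac (1 / x)"
    consider "s \<le> 1/20 \<or> s \<ge> 19/20" | "1/20 < s" "s < 9/40" | "1/5 < s" "s < 4/5" | "31/40 < s" "s < 19/20"
      by linarith
    then show "x \<in> W \<union> Z"
    proof cases
      case 1
      then have "cos (2 * pi * (1/20)) \<le> cos (2 * pi / x)"
        unfolding s_def by (intro cos_frac_ge) auto
      moreover have "cos (2 * pi / 15) < cos (2 * pi * (1/20))"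
        by (rule cos_monotone_0_pi) (use pi_gt_zero in auto)
      ultimately show ?thesis using x by (simp add: Z_def)
    qed (use x blk[OF x] in \<open>auto simp: W_def window_def s_def\<close>)
  qed
  ultimately have neg: "ctl (flat_on {0<..<r}) {0<..<r} n ?d"
    by (rule ctl_negligible_subset)
  have o: "open {0::real<..}" by simp
  have sm: "ctl (\<lambda>_. True) {0<..} n (rippled.flow t)" for n
  proof (rule ctl_flow[OF True_algebra o, where Q = "\<lambda>_. True" and Y = "{0<..}" and \<mu> = field and \<rho> = "\<lambda>x. inverse (field x)"])
    show "ctl (\<lambda>_. True) {0<..} n (\<lambda>x. inverse (field x))" for n
      by (rule ctl_inverse[OF True_algebra o _ _ smooth_field_field]) (use field_pos in \<open>force simp: less_le\<close>)+
    show "(rippled.flow t has_real_derivative field (rippled.flow t x) * inverse (field x)) (at x)" if "x \<in> {0<..}" for x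
      using rippled.DERIV_flow[of x t] that by (auto simp: inverse_eq_divide)
  qed (use rippled.flow_pos smooth_field_field in auto)
  have sb: "ctl (\<lambda>_. True) {0<..} n (base.flow t)" for n
  proof (rule ctl_flow[OF True_algebra o, where Q = "\<lambda>_. True" and Y = "{0<..}" and \<mu> = base_field and \<rho> = "\<lambda>x. inverse (base_field x)"])
    show "ctl (\<lambda>_. True) {0<..} n (\<lambda>x. inverse (base_field x))" for n
      by (rule ctl_inverse[OF True_algebra o _ _ smooth_base_field]) (use base_field_pos in \<open>force simp: less_le\<close>)+
    show "(base.flow t has_real_derivative base_field (base.flow t x) * inverse (base_field x)) (at x)" if "x \<in> {0<..}" for x
      using base.DERIV_flow[of x t] that by (auto simp: inverse_eq_divide)
  qed (use base.flow_pos smooth_base_field in auto)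
  have "ctl (\<lambda>_. True) {0<..} (Suc n) ?d"
    by (rule ctl_diff[OF algebra_solid[OF True_algebra] o sm sb])
  then show ?thesis by (rule Ck_on_flat[OF _ neg _ r]) simp
qed

lemma smooth_rippled_flow:
  assumes "\<And>k. near t k"
  shows "smooth_on (rippled.flow t) {0..}"
  unfolding smooth_on_def
proof
  fix n
  have "Ck_on n (\<lambda>x. (rippled.flow t x - base.flow t x) + base.flow t x) {0..}"
    by (rule Ck_on_add[OF smooth_on_flow_difference[OF assms] base.smooth_flow])
  then show "Ck_on n (rippled.flow t) {0..}" by simp
qed

section \<open>Continuous differentiability of the perturbed field\<close>

lemma DERIV_ripple:
  assumes "x \<in> window 0 1 1"
  shows "(ripple has_real_derivative
    v (block x) * (deriv outer x * cos (2 * pi * real (q (block x)) * base.time x)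
      - outer x * (sin (2 * pi * real (q (block x)) * base.time x) * (2 * pi * real (q (block x)) * (1 / base_field x))))) (at x)"
proof -
  have x: "x \<in> window 0 1 0" using assms by (auto simp: window_def)
  have "ctl (\<lambda>_. True) {0<..} 1 outer" unfolding outer_def by (rule ctl_cutoff[OF True_algebra]) auto
  then have o: "(outer has_real_derivative deriv outer x) (at x)" using assms by (simp add: window_def)
  have v: "((\<lambda>x. v (block x)) has_real_derivative 0) (at x)" by (rule DERIV_block_const[OF x]) auto
  have "((\<lambda>x. cos (2 * pi * real (q (block x)) * base.time x)) has_real_derivative
     - sin (2 * pi * real (q (block x)) * base.time x) * (2 * pi * real (q (block x)) * (1 / base_field x))) (at x)"
    by (rule DERIV_chain2[OF DERIV_cos DERIV_phase[OF x]])
  from DERIV_mult[OF DERIV_mult[OF v o] this] show ?thesis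
    unfolding ripple_def[abs_def] by (simp add: algebra_simps)
qed

text \<open>The critical term of the derivative is \<open>base_field\<close> times the derivative of
  the ripple: the factor \<open>1 / base_field\<close> from the phase cancels and leaves a multiple
  of \<open>v k * q k\<close>. For \<open>k \<ge> 1\<close> this is bounded via
  \<open>v k * q k \<le> 1 / q k \<le> exp (- 1 / x)\<close>, so the derivative is flat at
  0.\<close>

lemma Ck_field: "Ck_on 1 field {0..}"
proof -
  let ?I = "integer_zone \<inter> {0<..<1}" and ?W = "window 0 1 1"
  have LI: "1 / x \<ge> 1" if "x \<in> ?I" for x using that by auto
  have LW: "1 / x \<ge> 1" if "x \<in> ?W" for x using that window_1_subset[of 0 1] by auto
  have I: "ctl (flat_on ?I) ?I 1 field"
    by (rule ctl_cong[OF negligible_solid[OF LI] _ ctl_negligible_flat_exp[of _ 1 0]])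
      (auto simp: field_def ripple_integer_zone base_field_integer_zone intro: open_integer_zone)
  let ?N = "flat_on ?W"
  have S: "solid ?W ?N" by (rule negligible_solid[OF LW])
  have A: "algebra_class ?W (moderate ?W (\<lambda>x. 1 / x))" by (rule moderate_algebra[OF LW])
  have oW: "open ?W" by (rule open_window) auto
  have flat: "?N (flat_exp 0)"
    by (rule ctl_imp[OF ctl_negligible_flat_exp[OF oW window_1_subset, of 0]])
  have cb: "ctl (\<lambda>_. True) {0<..} 1 base_field" by (rule smooth_base_field)
  have nb: "?N (deriv base_field)"
  proof -
    have "ctl ?N ?W 1 base_field"
    proof -
      have "ctl (flat_on (?W \<inter> {0<..<1})) (?W \<inter> {0<..<1}) 1 base_field"
        by (rule ctl_negligible_subset[OF ctl_negligible_base_field]) auto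
      moreover have "?W \<inter> {0<..<1} = ?W"
      proof -
        have "x \<noteq> 1" if "x \<in> ?W" for x using that by (auto simp: window_def)
        then show ?thesis using window_1_subset[of 0 1] by force
      qed
      ultimately show ?thesis by simp
    qed
    then show ?thesis by simp
  qed
  have mo: "moderate ?W (\<lambda>x. 1 / x) (deriv outer)"
  proof -
    have "moderate ?W (\<lambda>x. 1 / x) (\<lambda>x. 1 / x)" by (rule moderateI[of _ _ 1 _ 1]) (simp add: window_def)
    from ctl_cutoff[OF A oW window_subset_pos this, of 1] show ?thesis unfolding outer_def by simp
  qed
  \<comment> \<open>A flat majorant of the derivative: \<open>1 / (1 + ripple)\<close> is at most 2,
    its square at most 4, and \<open>8 * pi\<close> is 4 times the factor \<open>2 * pi\<close> of
    the phase.\<close>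
  define B where "B = (\<lambda>x. \<bar>flat_exp 0 x * deriv outer x\<bar> * 4 + (\<bar>deriv base_field x\<bar> * 2 + \<bar>flat_exp 0 x\<bar> * (8 * pi)))"
  have cm: "?N (\<lambda>x. \<bar>F x\<bar> * C)" if "?N F" for F C
  proof -
    have "?N (\<lambda>x. F x * C)"
      by (rule negligible_mult_moderate[OF LW that algebra_const[OF A]])
    then show ?thesis by (rule solidD[OF S, where G = "\<lambda>x. F x * C"]) (simp add: abs_mult)
  qed
  have nB: "?N B"
  proof -
    have "?N (\<lambda>x. flat_exp 0 x * deriv outer x)" by (rule negligible_mult_moderate[OF LW flat mo])
    from cm[OF this, of 4] cm[OF nb, of 2] cm[OF flat, of "8 * pi"]
    have n1: "?N (\<lambda>x. \<bar>flat_exp 0 x * deriv outer x\<bar> * 4)" and n2: "?N (\<lambda>x. \<bar>deriv base_field x\<bar> * 2)"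
      and n3: "?N (\<lambda>x. \<bar>flat_exp 0 x\<bar> * (8 * pi))" .
    have "?N (\<lambda>x. \<bar>deriv base_field x\<bar> * 2 + \<bar>flat_exp 0 x\<bar> * (8 * pi))"
      by (rule solid_add[where P = ?N, OF S n2 n3])
    from solid_add[where P = ?N, OF S n1 this] show ?thesis unfolding B_def .
  qed
  define R where "R x = v (block x) * (deriv outer x * cos (2 * pi * real (q (block x)) * base.time x)
      - outer x * (sin (2 * pi * real (q (block x)) * base.time x) * (2 * pi * real (q (block x)) * (1 / base_field x))))" for x
  define F' where "F' x = deriv base_field x * inverse (1 + ripple x) +
    - (inverse (1 + ripple x) * (0 + R x) * inverse (1 + ripple x)) * base_field x" for x
  have DF: "(field has_real_derivative F' x) (at x)" if x: "x \<in> ?W" for x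
  proof -
    have x0: "x > 0" using x by (simp add: window_def)
    have b: "(base_field has_real_derivative deriv base_field x) (at x)" using cb x0 by simp
    have n: "1 + ripple x \<noteq> 0" using ripple_bounds(1)[of x] by linarith
    have "(ripple has_real_derivative R x) (at x)" unfolding R_def by (rule DERIV_ripple[OF x])
    then have "((\<lambda>x. 1 + ripple x) has_real_derivative 0 + R x) (at x)"
      by (rule DERIV_add[OF DERIV_const])
    from DERIV_mult[OF b DERIV_inverse'[OF this n]] show ?thesis
      unfolding field_def[abs_def] F'_def .
  qed
  have "\<bar>F' x\<bar> \<le> \<bar>B x\<bar>" if x: "x \<in> ?W" for x
  proof -
    define k where "k = block x"
    define ph where "ph = 2 * pi * real (q k) * base.time x"
    define i where "i = inverse (1 + ripple x)"
    have x0: "x > 0" "k \<ge> 1" using x by (auto simp: window_def k_def)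
    have b: "base_field x > 0" "base_field x \<le> 1" using base_field_pos base_field_le_1 x0 by auto
    have i: "0 \<le> i" "i \<le> 2"
      using le_imp_inverse_le[OF ripple_bounds(1)[of x]] ripple_bounds(1)[of x] by (auto simp: i_def)
    have fl: "v k \<le> flat_exp 0 x" "v k > 0" using v_le_flat_exp[OF x0(1)] v_pos by (auto simp: k_def)
    have vq: "v k * real (q k) \<le> flat_exp 0 x"
    proof -
      have "real (q k) ^ 2 \<le> real (q k) ^ (k + 1)"
        using q_pos(2)[of k] x0(2) by (intro power_increasing) auto
      then have "v k \<le> 1 / real (q k) ^ 2" using q_pos(1)[of k] by (simp add: v_def frac_le)
      then have "v k * real (q k) \<le> 1 / real (q k) ^ 2 * real (q k)" by (rule mult_right_mono) simp
      also have "\<dots> = 1 / real (q k)" using q_pos(1)[of k] by (simp add: power2_eq_square)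
      also have "\<dots> \<le> flat_exp 0 x" using inverse_q_le_flat_exp[OF x0(1)] by (simp add: k_def)
      finally show ?thesis .
    qed
    have F': "F' x = deriv base_field x * i - (i * i) * (v k * deriv outer x * cos ph * base_field x)
        + (i * i) * (v k * real (q k) * (outer x * sin ph) * (2 * pi))"
      using b unfolding F'_def R_def k_def[symmetric] ph_def[symmetric] i_def[symmetric] by (simp add: field_simps)
    have ii: "\<bar>i * i\<bar> \<le> 4" using i mult_mono[of i 2 i 2] by simp
    have 1: "\<bar>deriv base_field x * i\<bar> \<le> \<bar>deriv base_field x\<bar> * 2"
      unfolding abs_mult using i by (intro mult_left_mono) auto
    have "\<bar>v k * deriv outer x * cos ph * base_field x\<bar> \<le> flat_exp 0 x * \<bar>deriv outer x\<bar> * 1 * 1"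
      unfolding abs_mult using fl b flat_exp_nonneg by (intro mult_mono) auto
    then have 2: "\<bar>(i * i) * (v k * deriv outer x * cos ph * base_field x)\<bar> \<le> 4 * (flat_exp 0 x * \<bar>deriv outer x\<bar>)"
      unfolding abs_mult[of "i * i"] using ii by (intro mult_mono) auto
    have "\<bar>outer x * sin ph\<bar> \<le> 1 * 1"
      unfolding abs_mult using outer_range by (intro mult_mono) auto
    then have "\<bar>v k * real (q k) * (outer x * sin ph) * (2 * pi)\<bar> \<le> flat_exp 0 x * 1 * (2 * pi)"
      unfolding abs_mult[of "v k * real (q k) * (outer x * sin ph)"] abs_mult[of "v k * real (q k)"]
      using vq fl flat_exp_nonneg by (intro mult_mono) (auto simp: abs_mult)
    then have 3: "\<bar>(i * i) * (v k * real (q k) * (outer x * sin ph) * (2 * pi))\<bar> \<le> 4 * (flat_exp 0 x * 1 * (2 * pi))"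
      unfolding abs_mult[of "i * i"] using ii by (intro mult_mono) auto
    have "\<bar>F' x\<bar> \<le> \<bar>deriv base_field x\<bar> * 2 + 4 * (flat_exp 0 x * \<bar>deriv outer x\<bar>) + 4 * (flat_exp 0 x * 1 * (2 * pi))"
      unfolding F' using 1 2 3 by linarith
    also have "\<dots> = B x" unfolding B_def using flat_exp_nonneg[of 0 x] by (simp add: abs_mult)
    finally show ?thesis by linarith
  qed
  then have nF: "?N F'" by (rule solidD[where P = ?N, OF S nB])
  have W: "ctl ?N ?W 1 field"
  proof -
    have "?N field"
    proof (rule solidD[OF S, where G = "\<lambda>x. \<bar>flat_exp 0 x\<bar> * 2"])
      show "?N (\<lambda>x. \<bar>flat_exp 0 x\<bar> * 2)" by (rule cm[OF flat])
      fix x assume "x \<in> ?W"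
      then have "x > 0" by (simp add: window_def)
      then show "\<bar>field x\<bar> \<le> \<bar>\<bar>flat_exp 0 x\<bar> * 2\<bar>"
        using field_le[of x] base_field_le[of x] field_pos[of x] by simp
    qed
    moreover have "ctl ?N ?W 0 F'" using nF by (simp only: ctl.simps)
    ultimately have "ctl ?N ?W (Suc 0) field"
      by (intro ctl_SucI[where P = ?N and F = field and F' = F'] S oW DF)
    then show ?thesis by (simp only: One_nat_def)
  qed
  show ?thesis
    by (rule Ck_on_flat[OF smooth_field_field
          ctl_negligible_subset[OF ctl_negligible_Un[OF I W] unit_interval_cover] field_0]) auto
qed

end

section \<open>Failure of \<open>C\<^sup>2\<close>\<close>

text \<open>The continuous second derivative is bounded on the unit interval. Two-sided derivatives
  appear in the conclusion because that is the form in which the derivative of the flow is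
  known.\<close>

lemma Ck_2_Lipschitz_deriv:
  assumes "Ck_on 2 f {0..}"
  obtains L where "\<And>x y f'x f'y. 0 < x \<Longrightarrow> x \<le> 1 \<Longrightarrow> 0 < y \<Longrightarrow> y \<le> 1 \<Longrightarrow>
    (f has_real_derivative f'x) (at x) \<Longrightarrow> (f has_real_derivative f'y) (at y) \<Longrightarrow>
    \<bar>f'x - f'y\<bar> \<le> L * \<bar>x - y\<bar>"
proof -
  obtain g h where g: "\<And>x. x \<in> {0..} \<Longrightarrow> (f has_real_derivative g x) (at x within {0..})"
    and h: "\<And>x. x \<in> {0..} \<Longrightarrow> (g has_real_derivative h x) (at x within {0..})"
    and c: "continuous_on {0..} h"
    using assms by (auto simp: numeral_2_eq_2)
  have "bounded (h ` {0..1})"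
    by (intro compact_imp_bounded compact_continuous_image continuous_on_subset[OF c]) auto
  then obtain L where L: "\<forall>x\<in>{0..1}. \<bar>h x\<bar> \<le> L"
    unfolding bounded_iff by auto
  have gf: "f' = g x" if "0 < x" "(f has_real_derivative f') (at x)" for x f'
  proof -
    have "at x within {0..} = at x" using that by (intro at_within_interior) auto
    then show ?thesis using g[of x] that DERIV_unique[of f f' x "g x"] by simp
  qed
  show thesis
  proof (rule that[of L])
    fix x y f'x f'y assume xy: "0 < x" "x \<le> 1" "0 < y" "y \<le> 1"
      and d: "(f has_real_derivative f'x) (at x)" "(f has_real_derivative f'y) (at y)"
    have "norm (g x - g y) \<le> L * norm (x - y)"
    proof (rule field_differentiable_bound[of "{0..1}" g h])
      show "(g has_real_derivative h u) (at u within {0..1})" if "u \<in> {0..1}" for u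
        using h[of u] that by (auto intro: DERIV_subset)
      show "norm (h u) \<le> L" if "u \<in> {0..1}" for u using L that by simp
    qed (use xy in auto)
    then show "\<bar>f'x - f'y\<bar> \<le> L * \<bar>x - y\<bar>" using gf xy d by simp
  qed
qed

context approximation_sequence
begin

text \<open>At a point where \<open>base.time x \<in> \<int> / q k\<close> the ripple of the field is extremal. If the phase of
  the image is a quarter of a period or more away, the derivative of the flow there is off by
  at least \<open>v k / 2\<close>; \<open>s = -1\<close> is the same statement half a period later.\<close>

lemma deriv_flow_extremal:
  assumes x: "x \<in> window (29/60) (31/60) K" "block x = k" and K: "tame t K"
    and phase: "cos (2 * pi * real (q k) * base.time x) = s" "s = 1 \<or> s = -1"
    and t: "cos (2 * pi * real (q k) * t) \<le> 0" and small: "v k \<le> 1 / 5"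
  shows "s * (field (rippled.flow t x) * (1 / field x) - 1) \<ge> v k / 2"
proof -
  define y where "y = rippled.flow t x"
  define a where "a = 2 * pi * real (q k)"
  have a: "a > 0" using q_pos(1)[of k] by (simp add: a_def)
  have x0: "x > 0" using x by (simp add: window_def)
  have y0: "y > 0" unfolding y_def by (rule rippled.flow_pos[OF x0])
  have seg: "u \<in> window 0 1 0 \<and> block u = k \<and> outer u = 1 \<and> inner u = 1" if "u \<in> closed_segment x y" for u
  proof -
    have w: "u \<in> window (29/60 - 1/60) (31/60 + 1/60) K" "block u = k"
      using segment_window[OF K x(1) _ _ that[unfolded y_def]] x(2) by auto
    moreover have "window (29/60 - 1/60) (31/60 + 1/60) K \<subseteq> window 0 1 0"
      by (rule window_mono) auto
    moreover have "1 / 3 \<le> frac (1 / u)" "frac (1 / u) \<le> 2 / 3" "1 / 6 \<le> frac (1 / u)" "frac (1 / u) \<le> 5 / 6"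
      using w(1) unfolding window_def mem_Collect_eq by linarith+
    ultimately show ?thesis using outer_1[of u] inner_1[of u] by blast
  qed
  have bx: "base_field x = v k" "base_field y = v k" and rx: "ripple x = v k * s"
    and ry: "ripple y = v k * cos (a * base.time y)"
    using seg[of x] seg[of y] phase x(2) by (auto simp: base_field_def ripple_def a_def)
  have "t = base.time y - base.time x + v k / a * (sin (a * base.time y) - sin (a * base.time x))"
    using time_resonance[OF x0 y0, of k] seg rippled.time_flow[OF x0, of t] by (simp add: y_def a_def)
  then have "a * t = a * (base.time y - base.time x) + a * (v k / a * (sin (a * base.time y) - sin (a * base.time x)))"
    by (metis distrib_left)
  then have e: "a * base.time y = a * base.time x + (a * t + v k * (sin (a * base.time x) - sin (a * base.time y)))"
    using a by (simp add: algebra_simps)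
  \<comment> \<open>This is the deviation of the phase advance from \<open>a * t\<close>. Being at
    most \<open>2 * v k\<close>, it can raise the nonpositive cosine of \<open>a * t\<close> to at
    most \<open>2 * v k\<close>.\<close>
  define e where "e = v k * (sin (a * base.time x) - sin (a * base.time y))"
  have "\<bar>sin (a * base.time x) - sin (a * base.time y)\<bar> \<le> 2"
    using abs_sin_le_one[of "a * base.time x"] abs_sin_le_one[of "a * base.time y"] by linarith
  then have "\<bar>e\<bar> \<le> v k * 2" unfolding e_def abs_mult using v_pos[of k] by (intro mult_mono) auto
  then have "cos (a * t + e) \<le> 2 * v k"
    using abs_cos_diff_le[of "a * t + e" "a * t"] t unfolding a_def[symmetric] by simp
  moreover have "sin (a * base.time x) = 0"
  proof -
    have "(sin (a * base.time x))\<^sup>2 = 0" using phase sin_cos_squared_add[of "a * base.time x"] unfolding a_def by auto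
    then show ?thesis by simp
  qed
  moreover have "cos (a * base.time y) = cos (a * base.time x) * cos (a * t + e) - sin (a * base.time x) * sin (a * t + e)"
    using e unfolding e_def[symmetric] by (simp add: cos_add)
  ultimately have sy: "s * cos (a * base.time y) \<le> 2 * v k"
    using phase unfolding a_def[symmetric] by auto
  define w z where "w = v k" and "z = v k * cos (a * base.time y)"
  have w: "0 < w" "w \<le> 1 / 5" using v_pos small by (auto simp: w_def)
  have sz: "s * z \<le> w * (2 * w)"
    using mult_left_mono[OF sy, of "v k"] w by (simp add: w_def z_def mult.left_commute)
  have "\<bar>z\<bar> \<le> w * 1" unfolding z_def w_def abs_mult using v_pos[of k] by (intro mult_mono) auto
  then have z: "0 < 1 + z" using w by linarith
  have "field y = w / (1 + z)" "field x = w / (1 + w * s)"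
    by (simp_all add: field_def bx rx ry w_def z_def divide_inverse)
  then have ratio: "field y * (1 / field x) = (1 + w * s) / (1 + z)" using w by simp
  have ww: "w * w \<le> w / 5" "w * w \<le> 1 / 25"
    using mult_left_mono[OF w(2), of w] mult_mono[OF w(2,2)] w by auto
  have "s * ((1 + w * s) / (1 + z) - 1) = (w - s * z) / (1 + z)"
    using phase(2) z by (auto simp: field_simps)
  also have "\<dots> \<ge> w / 2"
  proof -
    \<comment> \<open>With \<open>w \<le> 1 / 5\<close> the correction \<open>2 * w ^ 2\<close> is
      at most \<open>2 * w / 5\<close>. For \<open>s = 1\<close> this is just enough: both sides are
      separated by \<open>3 * w / 5\<close>.\<close>
    have "w / 2 * (1 + z) \<le> w - s * z"
    proof (cases "s = 1")
      case True
      then have "w / 2 * (1 + z) \<le> w / 2 * (1 + 2 * w * w)" using sz w by (intro mult_left_mono) auto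
      also have "\<dots> \<le> w / 2 * (6 / 5)"
        using ww w by (intro mult_left_mono) linarith+
      also have "\<dots> \<le> w - w * (2 * w)" using ww by linarith
      finally show ?thesis using sz True by simp
    next
      case False
      then have s: "s = -1" using phase(2) by simp
      define A where "A = z * (1 - w / 2)"
      have "- (2 * (w * w)) * (1 - w / 2) \<le> A"
        unfolding A_def using sz s w by (intro mult_right_mono) auto
      moreover have "2 * (w * w) * (1 - w / 2) \<le> 2 * (w * w) * 1" using w by (intro mult_left_mono) auto
      ultimately have "- (2 * (w * w)) \<le> A" by simp
      then have "0 \<le> w / 2 + A" using ww(1) w(1) by linarith
      moreover have "w + z - w / 2 * (1 + z) = w / 2 + A" by (simp add: A_def field_simps)
      ultimately have "w / 2 * (1 + z) \<le> w + z" by linarith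
      then show ?thesis using s by simp
    qed
    then show ?thesis using z by (simp add: le_divide_eq)
  qed
  finally show ?thesis unfolding ratio[unfolded y_def] w_def .
qed

text \<open>Two points in the middle of block \<open>k\<close>, half a period of the ripple apart,
  are at distance \<open>v k / (2 * q k)\<close>, since the base field is constantly
  \<open>v k\<close> between them; yet the derivatives of the flow there differ by at least
  \<open>v k\<close>. A Lipschitz constant of the derivative would have to be at least
  \<open>2 * q k\<close>.\<close>

lemma not_C2_flow:
  assumes t: "\<And>k. cos (2 * pi * real (q k) * t) \<le> 0"
  shows "\<not> Ck_on 2 (rippled.flow t) {0..}"
proof
  assume "Ck_on 2 (rippled.flow t) {0..}"
  then obtain L where L: "\<And>x y f'x f'y. 0 < x \<Longrightarrow> x \<le> 1 \<Longrightarrow> 0 < y \<Longrightarrow> y \<le> 1 \<Longrightarrow>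
    (rippled.flow t has_real_derivative f'x) (at x) \<Longrightarrow> (rippled.flow t has_real_derivative f'y) (at y) \<Longrightarrow>
    \<bar>f'x - f'y\<bar> \<le> L * \<bar>x - y\<bar>"
    by (rule Ck_2_Lipschitz_deriv) blast
  obtain K where K: "1 \<le> K" "tame t K" using ex_tame by blast
  \<comment> \<open>The bound \<open>1 / 120\<close> puts both sample points into the central window
    and within \<open>1 / 60\<close> of each other.\<close>
  obtain K2 where K2: "\<And>x y. 0 < x \<Longrightarrow> K2 \<le> block x \<Longrightarrow> 0 < y \<Longrightarrow>
      \<bar>base.time y - base.time x\<bar> \<le> 1 \<Longrightarrow> \<bar>1 / y - 1 / x\<bar> \<le> 1 / 120"
    by (rule base.small_displacement[of "1 / 120" 1]) auto
  \<comment> \<open>The summand 5 yields \<open>v k \<le> 1 / q k \<le> 1 / 5\<close> and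
    \<open>2 / q k \<le> 1\<close>; the latter keeps both sample points within base time 1 of the
    centre \<open>x\<close>.\<close>
  define k where "k = max (max K K2) (nat \<lceil>\<bar>L\<bar>\<rceil> + 5)"
  have k: "K \<le> k" "K2 \<le> k" "real k \<ge> \<bar>L\<bar> + 5" unfolding k_def by linarith+
  have qL: "real (q k) > \<bar>L\<bar> + 5" using q_ge_block[of k] k(3) by simp
  have q0: "real (q k) > 0" by (rule q_pos)
  have "1 / real (q k) \<le> 1 / 5" using qL by (intro divide_left_mono) auto
  then have v5: "v k \<le> 1 / 5" using v_le_q[of k] by linarith
  define x where "x = 1 / (real k + 1 / 2)"
  have x: "x > 0" "1 / x = real k + 1 / 2" by (auto simp: x_def)
  then have bx: "block x = k" "frac (1 / x) = 1 / 2" using block_unique[of x k] by auto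
  define m where "m = \<lceil>real (q k) * base.time x\<rceil>"
  have m: "real (q k) * base.time x \<le> of_int m" "of_int m < real (q k) * base.time x + 1"
    unfolding m_def by linarith+
  define s1 s2 where "s1 = of_int m / real (q k)" and "s2 = (of_int m + 1 / 2) / real (q k)"
  have s12: "base.time x \<le> s1" "s1 \<le> s2" "s2 \<le> base.time x + 1"
  proof -
    show "base.time x \<le> s1" "s1 \<le> s2" using m q0 by (auto simp: s1_def s2_def field_simps)
    have "s2 \<le> (real (q k) * base.time x + 2) / real (q k)"
      unfolding s2_def using m q0 by (intro divide_right_mono) auto
    also have "\<dots> = base.time x + 2 / real (q k)" using q0 by (simp add: add_divide_distrib)
    also have "\<dots> \<le> base.time x + 1" using qL q0 by simp
    finally show "s2 \<le> base.time x + 1" .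
  qed
  define x1 x2 where "x1 = base.position s1" and "x2 = base.position s2"
  have xi: "x1 > 0" "x2 > 0" "base.time x1 = s1" "base.time x2 = s2"
    using base.position by (auto simp: x1_def x2_def)
  have near_center: "y \<in> window (29/60) (31/60) K \<and> block y = k" if y: "0 < y" "\<bar>1 / y - 1 / x\<bar> \<le> 1 / 120" for y
  proof -
    have "real k \<le> 1 / y" "1 / y < real k + 1" using y(2) x(2) by linarith+
    from block_unique[OF y(1) this] show ?thesis
      using y x(2) k(1) unfolding window_def mem_Collect_eq by linarith
  qed
  have d12: "\<bar>1 / x1 - 1 / x\<bar> \<le> 1 / 120" "\<bar>1 / x2 - 1 / x\<bar> \<le> 1 / 120"
    using K2[OF x(1) _ xi(1)] K2[OF x(1) _ xi(2)] bx(1) k(2) s12 xi by auto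
  have x12: "x1 \<in> window (29/60) (31/60) K" "block x1 = k" "x2 \<in> window (29/60) (31/60) K" "block x2 = k"
    using near_center[OF xi(1) d12(1)] near_center[OF xi(2) d12(2)] by auto
  have dist: "\<bar>x1 - x2\<bar> = v k * (1 / (2 * real (q k)))"
  proof -
    have "base.time x2 - x2 / v k = base.time x1 - x1 / v k"
    proof (rule DERIV_zero_segment[where g = "\<lambda>u. base.time u - u / v k"])
      fix u assume u: "u \<in> closed_segment x1 x2"
      have u0: "u > 0" by (rule between_inverse(1)[OF xi(1,2) u])
      have "\<bar>1 / u - 1 / x1\<bar> \<le> \<bar>1 / x2 - 1 / x1\<bar>" by (rule between_inverse(2)[OF xi(1,2) u])
      also have "\<dots> \<le> 1 / 60"
        using d12 unfolding abs_le_iff by linarith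
      finally have d: "\<bar>1 / u - 1 / x1\<bar> \<le> 1 / 60" .
      have w: "u \<in> window (29/60 - 1/60) (31/60 + 1/60) K" "block u = k"
        using window_move[OF x12(1) u0 d] x12(2) by auto
      then have "inner u = 1" unfolding window_def by (intro inner_1) auto
      then have "base_field u = v k" using w by (simp add: base_field_def)
      then show "((\<lambda>u. base.time u - u / v k) has_real_derivative 0) (at u)"
        using DERIV_diff[OF base.DERIV_time[OF u0] DERIV_cdivide[OF DERIV_ident, of "v k"]] by simp
    qed
    then have "(x2 - x1) / v k = s2 - s1" using xi by (simp add: diff_divide_distrib)
    also have "\<dots> = 1 / (2 * real (q k))" using q0 by (simp add: s1_def s2_def field_simps)
    finally have "x2 - x1 = v k * (1 / (2 * real (q k)))" using v_pos[of k] by (simp add: field_simps)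
    moreover have "v k * (1 / (2 * real (q k))) > 0" using v_pos[of k] q0 by simp
    ultimately show ?thesis by linarith
  qed
  have phase: "cos (2 * pi * real (q k) * base.time x1) = 1" "cos (2 * pi * real (q k) * base.time x2) = -1"
  proof -
    have e1: "2 * pi * real (q k) * base.time x1 = 0 + of_int m * (2 * pi)" using q0 by (simp add: xi s1_def)
    show "cos (2 * pi * real (q k) * base.time x1) = 1"
      unfolding e1 using cos.plus_of_int[of "0::real" m] by simp
    have e2: "2 * pi * real (q k) * base.time x2 = pi + of_int m * (2 * pi)"
      using q0 by (simp add: xi s2_def field_simps)
    show "cos (2 * pi * real (q k) * base.time x2) = -1"
      unfolding e2 using cos.plus_of_int[of pi m] by simp
  qed
  define d1 d2 where "d1 = field (rippled.flow t x1) * (1 / field x1)" and "d2 = field (rippled.flow t x2) * (1 / field x2)"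
  have "v k / 2 \<le> 1 * (d1 - 1)"
    unfolding d1_def by (rule deriv_flow_extremal[OF x12(1,2) K(2) phase(1) _ t v5]) simp
  moreover have "v k / 2 \<le> -1 * (d2 - 1)"
    unfolding d2_def by (rule deriv_flow_extremal[OF x12(3,4) K(2) phase(2) _ t v5]) simp
  ultimately have "v k \<le> d1 - d2" by simp
  also have "\<dots> \<le> \<bar>d1 - d2\<bar>" by (rule abs_ge_self)
  also have "\<dots> \<le> L * \<bar>x1 - x2\<bar>"
  proof (rule L)
    have "window (29/60) (31/60) K \<subseteq> window (29/60) (31/60) 1" by (rule window_mono) (use K in auto)
    then show "x1 \<le> 1" "x2 \<le> 1" using x12 window_1_subset by fastforce+
    show "(rippled.flow t has_real_derivative d1) (at x1)" "(rippled.flow t has_real_derivative d2) (at x2)"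
      unfolding d1_def d2_def by (rule rippled.DERIV_flow, rule xi)+
  qed (use xi in auto)
  finally have "v k * 1 \<le> v k * (L * (1 / (2 * real (q k))))" unfolding dist by (simp add: mult.commute)
  then have "1 \<le> L * (1 / (2 * real (q k)))" using v_pos[of k] by (simp only: mult_le_cancel_left_pos)
  then have "2 * real (q k) \<le> L" using q0 by (simp add: field_simps)
  then show False using qL by linarith
qed

end

theorem theoremA:
  fixes \<alpha> :: real
  assumes "liouville_number \<alpha>"
  shows "\<exists>(\<nu> :: real \<Rightarrow> real) (f :: real \<Rightarrow> real \<Rightarrow> real) (K :: real set).
           Ck_on 1 \<nu> {0..} \<and>
           (\<forall>x\<ge>0. \<nu> x = 0 \<longleftrightarrow> x = 0) \<and>
           flow_of \<nu> f \<and>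
           cantor_set K \<and> \<alpha> \<in> K \<and>
           (\<forall>t \<in> {1} \<union> K. smooth_on (f t) {0..}) \<and>
           (\<exists>t. t \<notin> {1} \<union> K \<and> \<not> Ck_on 2 (f t) {0..})"
proof -
  obtain p q where "approximation_sequence \<alpha> p q"
    by (rule ex_approximation_sequence[OF assms])
  then interpret approximation_sequence \<alpha> p q .
  have smooth: "smooth_on (rippled.flow t) {0..}" if "t \<in> {1} \<union> cantor" for t
    using that near_1 cantor_near by (intro smooth_rippled_flow) auto
  obtain t where "\<forall>k. cos (2 * pi * real (q k) * t) \<le> 0" using ex_resonance_free_time by blast
  then have t: "\<not> Ck_on 2 (rippled.flow t) {0..}" by (intro not_C2_flow) blast
  \<comment> \<open>No separate argument is required: every time in
    \<open>{1} \<union> cantor\<close> has a smooth map.\<close>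
  then have "t \<notin> {1} \<union> cantor" using smooth unfolding smooth_on_def by blast
  moreover have "\<forall>x\<ge>0. field x = 0 \<longleftrightarrow> x = 0" using field_pos field_0 by (metis less_le)
  ultimately show ?thesis
    using Ck_field rippled.flow_of_flow cantor_set_cantor smooth t
    by (intro exI[of _ field] exI[of _ rippled.flow] exI[of _ cantor]) blast
qed

end
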